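(* Let $G$ be a separable locally compact group which can be presented as a separably categorical metric structure. Let $H\le G$ be a normal compact clopen subgroup and $d$ a bi-invariant metric on $H$ defining the topology of $H$, of diameter $\frac12$ (with $d=0$ if $H$ is trivial), such that $d$ is conjugacy invariant in $G$ (that is, $d(g^{-1}xg,g^{-1}yg)=d(x,y)$ for all $x,y\in H$, $g\in G$) and the group of automorphisms of $G/H$ induced by automorphisms of $G$ preserving $(H,d)$ is oligomorphic on $G/H$. Let $d^*$ be the metric on $G$ given by $d^*(x_1,x_2)=1$ if $x_1,x_2$ represent distinct $H$-cosets, and $d^*(x_1,x_2)=d(1,x_1^{-1}x_2)$ if $x_1,x_2$ represent the same $H$-coset. Then the continuous theory $\mathrm{Th}(G,d^* )$ does not have $\frac12$-slow formulas with the order property if and only if the elementary (first-order) theory of the structure $G/H$ is stable, where $G/H$ is considered under the structure induced by $\mathrm{Aut}(G,d^* )$.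
   Context: Let $L=\{d,\cdot,{}^{-1}\}$. A continuous metric $L$-structure on a group $G$ is a complete metric space $(G,d)$ with $d\le 1$ such that the group operations $\cdot$ and ${}^{-1}$ are uniformly continuous: there are moduli $\gamma_1,\gamma_2$ such that for every $\varepsilon>0$, $d(x_1,x_2)<\gamma_1(\varepsilon)$ implies $d(x_1^{-1},x_2^{-1})<\varepsilon$, and $d(x_1,x_2)<\gamma_2(\varepsilon)$ implies $\max(d(x_1 y,x_2 y),d(y x_1,y x_2))<\varepsilon$ for all $y\in G$. The metric of the structure is also assumed to be left-invariant. "$G$ can be presented as a separably categorical metric structure" means that there is a metric $d'$ on $G$ defining its topology such that $(G,d')$ is a continuous metric $L$-structure (with left-invariant metric) which is separably categorical. Atomic formulas are the expressions $d(t_1,t_2)$ with $t_1,t_2$ terms of $L$; formulas are built from atomic formulas and rational constants in $[0,1]$ using the connectives $x/2$, $x\dot- y=\max(x-y,0)$, $\min$, $\max$, $|x-y|$, $1-x$, $x\dot+y=\min(x+y,1)$, $x\cdot y$, $\sqrt{x}$ and the quantifiers $\sup_x$, $\inf_x$, interpreted with values in $[0,1]$. The continuous theory of a structure is the set of conditions $\phi=0$, $\phi$ a formula without free variables, true in it. A continuous theory is separably categorical if any two of its separable models are isomorphic (by an isometry preserving the operations); a metric structure is separably categorical if its continuous theory is. An automorphism of $G$ preserves $(H,d)$ if it maps $H$ onto $H$ and its restriction to $H$ preserves $d$. A group acting on a set $\Omega$ is oligomorphic if for every $n\ge1$ it has finitely many orbits on $\Omega^n$. The pair $(G,d^* )$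 is regarded as a continuous metric $L$-structure, and $\mathrm{Aut}(G,d^* )$ is the group of all isometric group automorphisms of $(G,d^* )$; it acts on $G/H$. The structure on $G/H$ induced by $\mathrm{Aut}(G,d^* )$ is the first-order structure with universe $G/H$ whose relations are all relations on $G/H$ (of all finite arities) invariant under the group of permutations of $G/H$ induced by $\mathrm{Aut}(G,d^* )$. A first-order theory is stable if no formula has the (classical) order property, i.e. there is no formula $\theta(\bar x,\bar y)$ and no sequence $(\bar a_i)_{i\in\omega}$ in a model such that $\theta(\bar a_i,\bar a_j)$ holds if and only if $i<j$. A formula $\psi(\bar x,\bar y)$, with $\bar x,\bar y$ of the same length, has the order property for a continuous theory $T$ if there are a model $M$ of $T$ and tuples $(\bar a_i:i\in\omega)$ in $M$ such that $\psi(\bar a_i,\bar a_j)=0\Leftrightarrow i<j$ and $\psi(\bar a_i,\bar a_j)=1\Leftrightarrow i\ge j$. For $r\in[0,1]$, a continuous formula $\psi(\bar x)$ is $r$-slow (in the structure under consideration, here $(G,d^* )$) if there do not exist tuples $\bar b,\bar b'$ with $\max_i d^*(b_i,b_i')\le r$ such that $\psi(\bar b)=0$ and $\psi(\bar b')=1$. (For a formula $\psi(\bar x,\bar y)$ this is applied to the concatenated tuple of variables.) *)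

theory Defs
  imports
    "HOL-Analysis.Abstract_Metric_Spaces"
    "HOL-Algebra.Group_Action"
begin

definition tuples :: "nat \<Rightarrow> 'a set \<Rightarrow> 'a list set" where
  "tuples n A = {xs. length xs = n \<and> set xs \<subseteq> A}"

section \<open>Topological groups and continuous metric structures on groups\<close>

definition topological_group :: "('a, 'm) monoid_scheme \<Rightarrow> 'a topology \<Rightarrow> bool" where
  "topological_group G X \<longleftrightarrow>
     group G \<and> topspace X = carrier G \<and>
     continuous_map (prod_topology X X) X (\<lambda>(x, y). x \<otimes>\<^bsub>G\<^esub> y) \<and>
     continuous_map X X (\<lambda>x. inv\<^bsub>G\<^esub> x)"

definition uniformly_continuous_operations ::
    "('a, 'm) monoid_scheme \<Rightarrow> ('a \<Rightarrow> 'a \<Rightarrow> real) \<Rightarrow> bool" where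
  "uniformly_continuous_operations G d \<longleftrightarrow>
     (\<exists>\<gamma>\<^sub>1 \<gamma>\<^sub>2 :: real \<Rightarrow> real. \<forall>\<epsilon>>0.
        \<gamma>\<^sub>1 \<epsilon> > 0 \<and> \<gamma>\<^sub>2 \<epsilon> > 0 \<and>
        (\<forall>x\<^sub>1\<in>carrier G. \<forall>x\<^sub>2\<in>carrier G.
           d x\<^sub>1 x\<^sub>2 < \<gamma>\<^sub>1 \<epsilon> \<longrightarrow> d (inv\<^bsub>G\<^esub> x\<^sub>1) (inv\<^bsub>G\<^esub> x\<^sub>2) < \<epsilon>) \<and>
        (\<forall>x\<^sub>1\<in>carrier G. \<forall>x\<^sub>2\<in>carrier G. d x\<^sub>1 x\<^sub>2 < \<gamma>\<^sub>2 \<epsilon> \<longrightarrow>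
           (\<forall>y\<in>carrier G.
              max (d (x\<^sub>1 \<otimes>\<^bsub>G\<^esub> y) (x\<^sub>2 \<otimes>\<^bsub>G\<^esub> y)) (d (y \<otimes>\<^bsub>G\<^esub> x\<^sub>1) (y \<otimes>\<^bsub>G\<^esub> x\<^sub>2)) < \<epsilon>)))"

text \<open>Different structures, in particular different models of a theory, may have different moduli.
  Models of the theory of a structure inherit its moduli up to replacing \<open>\<epsilon>\<close> by \<open>\<epsilon>/2\<close>, so the
  class of models is the same as for a signature with fixed moduli.\<close>

definition metric_group_structure ::
    "('a, 'm) monoid_scheme \<Rightarrow> ('a \<Rightarrow> 'a \<Rightarrow> real) \<Rightarrow> bool" where
  "metric_group_structure G d \<longleftrightarrow>
     group G \<and> Metric_space (carrier G) d \<and> Metric_space.mcomplete (carrier G) d \<and>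
     (\<forall>x\<in>carrier G. \<forall>y\<in>carrier G. d x y \<le> 1) \<and>
     uniformly_continuous_operations G d \<and>
     (\<forall>g\<in>carrier G. \<forall>x\<in>carrier G. \<forall>y\<in>carrier G. d (g \<otimes>\<^bsub>G\<^esub> x) (g \<otimes>\<^bsub>G\<^esub> y) = d x y)"

section \<open>Continuous logic\<close>

typedef unit_rat = "{q :: rat. 0 \<le> q \<and> q \<le> 1}"
  by (rule exI[of _ 0]) simp

datatype metric_term = Var nat | Mult metric_term metric_term | Inv metric_term

datatype metric_formula =
    Dist metric_term metric_term
  | Const unit_rat
  | Half metric_formula
  | Monus metric_formula metric_formula
  | FMin metric_formula metric_formula
  | FMax metric_formula metric_formula
  | AbsDiff metric_formula metric_formula
  | Compl metric_formula
  | TruncPlus metric_formula metric_formula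
  | Times metric_formula metric_formula
  | Sqrt metric_formula
  | FSup nat metric_formula
  | FInf nat metric_formula

primrec term_value :: "('a, 'm) monoid_scheme \<Rightarrow> (nat \<Rightarrow> 'a) \<Rightarrow> metric_term \<Rightarrow> 'a" where
  "term_value G v (Var n) = v n"
| "term_value G v (Mult s t) = term_value G v s \<otimes>\<^bsub>G\<^esub> term_value G v t"
| "term_value G v (Inv t) = inv\<^bsub>G\<^esub> (term_value G v t)"

primrec formula_value ::
    "('a, 'm) monoid_scheme \<Rightarrow> ('a \<Rightarrow> 'a \<Rightarrow> real) \<Rightarrow> (nat \<Rightarrow> 'a) \<Rightarrow> metric_formula \<Rightarrow> real" where
  "formula_value G d v (Dist s t) = d (term_value G v s) (term_value G v t)"
| "formula_value G d v (Const q) = of_rat (Rep_unit_rat q)"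
| "formula_value G d v (Half \<phi>) = formula_value G d v \<phi> / 2"
| "formula_value G d v (Monus \<phi> \<psi>) = max (formula_value G d v \<phi> - formula_value G d v \<psi>) 0"
| "formula_value G d v (FMin \<phi> \<psi>) = min (formula_value G d v \<phi>) (formula_value G d v \<psi>)"
| "formula_value G d v (FMax \<phi> \<psi>) = max (formula_value G d v \<phi>) (formula_value G d v \<psi>)"
| "formula_value G d v (AbsDiff \<phi> \<psi>) = \<bar>formula_value G d v \<phi> - formula_value G d v \<psi>\<bar>"
| "formula_value G d v (Compl \<phi>) = 1 - formula_value G d v \<phi>"
| "formula_value G d v (TruncPlus \<phi> \<psi>) = min (formula_value G d v \<phi> + formula_value G d v \<psi>) 1"
| "formula_value G d v (Times \<phi> \<psi>) = formula_value G d v \<phi> * formula_value G d v \<psi>"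
| "formula_value G d v (Sqrt \<phi>) = sqrt (formula_value G d v \<phi>)"
| "formula_value G d v (FSup n \<phi>) = (SUP a\<in>carrier G. formula_value G d (v(n := a)) \<phi>)"
| "formula_value G d v (FInf n \<phi>) = (INF a\<in>carrier G. formula_value G d (v(n := a)) \<phi>)"

primrec term_vars :: "metric_term \<Rightarrow> nat set" where
  "term_vars (Var n) = {n}"
| "term_vars (Mult s t) = term_vars s \<union> term_vars t"
| "term_vars (Inv t) = term_vars t"

primrec free_vars :: "metric_formula \<Rightarrow> nat set" where
  "free_vars (Dist s t) = term_vars s \<union> term_vars t"
| "free_vars (Const q) = {}"
| "free_vars (Half \<phi>) = free_vars \<phi>"
| "free_vars (Monus \<phi> \<psi>) = free_vars \<phi> \<union> free_vars \<psi>"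
| "free_vars (FMin \<phi> \<psi>) = free_vars \<phi> \<union> free_vars \<psi>"
| "free_vars (FMax \<phi> \<psi>) = free_vars \<phi> \<union> free_vars \<psi>"
| "free_vars (AbsDiff \<phi> \<psi>) = free_vars \<phi> \<union> free_vars \<psi>"
| "free_vars (Compl \<phi>) = free_vars \<phi>"
| "free_vars (TruncPlus \<phi> \<psi>) = free_vars \<phi> \<union> free_vars \<psi>"
| "free_vars (Times \<phi> \<psi>) = free_vars \<phi> \<union> free_vars \<psi>"
| "free_vars (Sqrt \<phi>) = free_vars \<phi>"
| "free_vars (FSup n \<phi>) = free_vars \<phi> - {n}"
| "free_vars (FInf n \<phi>) = free_vars \<phi> - {n}"

text \<open>The condition \<open>\<phi> = 0\<close> is represented by \<open>\<phi>\<close>, so a theory is a set of sentences.\<close>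

definition condition_holds ::
    "('a, 'm) monoid_scheme \<Rightarrow> ('a \<Rightarrow> 'a \<Rightarrow> real) \<Rightarrow> metric_formula \<Rightarrow> bool" where
  "condition_holds G d \<phi> \<longleftrightarrow> (\<forall>v \<in> UNIV \<rightarrow> carrier G. formula_value G d v \<phi> = 0)"

definition continuous_theory ::
    "('a, 'm) monoid_scheme \<Rightarrow> ('a \<Rightarrow> 'a \<Rightarrow> real) \<Rightarrow> metric_formula set" where
  "continuous_theory G d = {\<phi>. free_vars \<phi> = {} \<and> condition_holds G d \<phi>}"

definition continuous_model ::
    "metric_formula set \<Rightarrow> ('a, 'm) monoid_scheme \<Rightarrow> ('a \<Rightarrow> 'a \<Rightarrow> real) \<Rightarrow> bool" where
  "continuous_model T M d \<longleftrightarrow>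
     metric_group_structure M d \<and> (\<forall>\<phi>\<in>T. condition_holds M d \<phi>)"

definition isometric_isomorphic ::
    "('a, 'm) monoid_scheme \<Rightarrow> ('a \<Rightarrow> 'a \<Rightarrow> real) \<Rightarrow>
     ('b, 'n) monoid_scheme \<Rightarrow> ('b \<Rightarrow> 'b \<Rightarrow> real) \<Rightarrow> bool" where
  "isometric_isomorphic M d N e \<longleftrightarrow>
     (\<exists>h\<in>iso M N. \<forall>x\<in>carrier M. \<forall>y\<in>carrier M. e (h x) (h y) = d x y)"

text \<open>A separable metric space has at most continuum many points, so every separable model has an
  isomorphic copy whose carrier is a set of reals; restricting the models to the carrier type
  \<^typ>\<open>real\<close> therefore loses nothing.\<close>

definition separably_categorical_theory :: "metric_formula set \<Rightarrow> bool" where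
  "separably_categorical_theory T \<longleftrightarrow>
     (\<forall>(M :: real monoid) d (N :: real monoid) e.
        continuous_model T M d \<and> separable_space (Metric_space.mtopology (carrier M) d) \<and>
        continuous_model T N e \<and> separable_space (Metric_space.mtopology (carrier N) e) \<longrightarrow>
        isometric_isomorphic M d N e)"

definition separably_categorical ::
    "('a, 'm) monoid_scheme \<Rightarrow> ('a \<Rightarrow> 'a \<Rightarrow> real) \<Rightarrow> bool" where
  "separably_categorical G d \<longleftrightarrow> separably_categorical_theory (continuous_theory G d)"

definition separably_categorically_presentable ::
    "('a, 'm) monoid_scheme \<Rightarrow> 'a topology \<Rightarrow> bool" where
  "separably_categorically_presentable G X \<longleftrightarrow>
     (\<exists>d'. metric_group_structure G d' \<and> Metric_space.mtopology (carrier G) d' = X \<and>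
           separably_categorical G d')"

text \<open>A formula \<open>\<psi>(x\<^sub>0, \<dots>, x\<^sub>n\<^sub>-\<^sub>1)\<close> is a formula whose free variables are among \<open>0, \<dots>, n - 1\<close>. For a
  formula \<open>\<psi>(x, y)\<close> in two \<open>k\<close>-tuples, \<open>x\<close> consists of the variables \<open>0, \<dots>, k - 1\<close> and \<open>y\<close> of
  \<open>k, \<dots>, 2k - 1\<close>.\<close>

definition value_at ::
    "('a, 'm) monoid_scheme \<Rightarrow> ('a \<Rightarrow> 'a \<Rightarrow> real) \<Rightarrow> metric_formula \<Rightarrow> 'a list \<Rightarrow> real" where
  "value_at G d \<psi> bs = formula_value G d (\<lambda>i. bs ! i) \<psi>"

definition slow ::
    "real \<Rightarrow> ('a, 'm) monoid_scheme \<Rightarrow> ('a \<Rightarrow> 'a \<Rightarrow> real) \<Rightarrow> nat \<Rightarrow> metric_formula \<Rightarrow> bool" where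
  "slow r G d n \<psi> \<longleftrightarrow>
     \<not> (\<exists>b \<in> tuples n (carrier G). \<exists>b' \<in> tuples n (carrier G).
          (\<forall>i<n. d (b ! i) (b' ! i) \<le> r) \<and> value_at G d \<psi> b = 0 \<and> value_at G d \<psi> b' = 1)"

text \<open>The type argument is the type from which the elements of the models are taken (a predicate cannot
  quantify over types). By downward Loewenheim-Skolem the value does not depend on it as long as it
  has at least continuum many elements.\<close>

definition has_order_property ::
    "'u itself \<Rightarrow> metric_formula set \<Rightarrow> nat \<Rightarrow> metric_formula \<Rightarrow> bool" where
  "has_order_property U T k \<psi> \<longleftrightarrow>
     (\<exists>(M :: 'u monoid) d (a :: nat \<Rightarrow> 'u list).
        continuous_model T M d \<and> (\<forall>i. a i \<in> tuples k (carrier M)) \<and>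
        (\<forall>i j. (value_at M d \<psi> (a i @ a j) = 0 \<longleftrightarrow> i < j) \<and>
               (value_at M d \<psi> (a i @ a j) = 1 \<longleftrightarrow> i \<ge> j)))"

definition has_slow_order_property ::
    "'u itself \<Rightarrow> real \<Rightarrow> ('a, 'm) monoid_scheme \<Rightarrow> ('a \<Rightarrow> 'a \<Rightarrow> real) \<Rightarrow> bool" where
  "has_slow_order_property U r G d \<longleftrightarrow>
     (\<exists>k \<psi>. free_vars \<psi> \<subseteq> {..<2 * k} \<and> slow r G d (2 * k) \<psi> \<and>
            has_order_property U (continuous_theory G d) k \<psi>)"

section \<open>First-order logic\<close>

text \<open>A relational signature is given by a set \<open>S\<close> of relation symbols with an arity function.\<close>

datatype 'r fo_formula =
    FOEq nat nat
  | FORel 'r "nat list"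
  | FONot "'r fo_formula"
  | FOAnd "'r fo_formula" "'r fo_formula"
  | FOEx nat "'r fo_formula"

primrec fo_wf :: "'r set \<Rightarrow> ('r \<Rightarrow> nat) \<Rightarrow> 'r fo_formula \<Rightarrow> bool" where
  "fo_wf S ar (FOEq m n) \<longleftrightarrow> True"
| "fo_wf S ar (FORel r xs) \<longleftrightarrow> r \<in> S \<and> length xs = ar r"
| "fo_wf S ar (FONot \<phi>) \<longleftrightarrow> fo_wf S ar \<phi>"
| "fo_wf S ar (FOAnd \<phi> \<psi>) \<longleftrightarrow> fo_wf S ar \<phi> \<and> fo_wf S ar \<psi>"
| "fo_wf S ar (FOEx n \<phi>) \<longleftrightarrow> fo_wf S ar \<phi>"

primrec fo_free_vars :: "'r fo_formula \<Rightarrow> nat set" where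
  "fo_free_vars (FOEq m n) = {m, n}"
| "fo_free_vars (FORel r xs) = set xs"
| "fo_free_vars (FONot \<phi>) = fo_free_vars \<phi>"
| "fo_free_vars (FOAnd \<phi> \<psi>) = fo_free_vars \<phi> \<union> fo_free_vars \<psi>"
| "fo_free_vars (FOEx n \<phi>) = fo_free_vars \<phi> - {n}"

primrec fo_sat :: "'a set \<Rightarrow> ('r \<Rightarrow> 'a list set) \<Rightarrow> (nat \<Rightarrow> 'a) \<Rightarrow> 'r fo_formula \<Rightarrow> bool" where
  "fo_sat A I v (FOEq m n) \<longleftrightarrow> v m = v n"
| "fo_sat A I v (FORel r xs) \<longleftrightarrow> map v xs \<in> I r"
| "fo_sat A I v (FONot \<phi>) \<longleftrightarrow> \<not> fo_sat A I v \<phi>"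
| "fo_sat A I v (FOAnd \<phi> \<psi>) \<longleftrightarrow> fo_sat A I v \<phi> \<and> fo_sat A I v \<psi>"
| "fo_sat A I v (FOEx n \<phi>) \<longleftrightarrow> (\<exists>a\<in>A. fo_sat A I (v(n := a)) \<phi>)"

definition fo_structure :: "'r set \<Rightarrow> ('r \<Rightarrow> nat) \<Rightarrow> 'a set \<Rightarrow> ('r \<Rightarrow> 'a list set) \<Rightarrow> bool" where
  "fo_structure S ar A I \<longleftrightarrow> A \<noteq> {} \<and> (\<forall>r\<in>S. I r \<subseteq> tuples (ar r) A)"

definition fo_valid :: "'a set \<Rightarrow> ('r \<Rightarrow> 'a list set) \<Rightarrow> 'r fo_formula \<Rightarrow> bool" where
  "fo_valid A I \<phi> \<longleftrightarrow> (\<forall>v \<in> UNIV \<rightarrow> A. fo_sat A I v \<phi>)"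

definition fo_theory ::
    "'r set \<Rightarrow> ('r \<Rightarrow> nat) \<Rightarrow> 'a set \<Rightarrow> ('r \<Rightarrow> 'a list set) \<Rightarrow> 'r fo_formula set" where
  "fo_theory S ar A I = {\<phi>. fo_wf S ar \<phi> \<and> fo_free_vars \<phi> = {} \<and> fo_valid A I \<phi>}"

definition fo_model ::
    "'r set \<Rightarrow> ('r \<Rightarrow> nat) \<Rightarrow> 'r fo_formula set \<Rightarrow> 'a set \<Rightarrow> ('r \<Rightarrow> 'a list set) \<Rightarrow> bool" where
  "fo_model S ar T A I \<longleftrightarrow> fo_structure S ar A I \<and> (\<forall>\<phi>\<in>T. fo_valid A I \<phi>)"

text \<open>As for \<open>has_order_property\<close>, the type argument supplies the elements of the models. For a
  countable signature, such as that of an oligomorphic action, its size does not matter if it is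
  infinite.\<close>

definition fo_stable ::
    "'u itself \<Rightarrow> 'r set \<Rightarrow> ('r \<Rightarrow> nat) \<Rightarrow> 'r fo_formula set \<Rightarrow> bool" where
  "fo_stable U S ar T \<longleftrightarrow>
     \<not> (\<exists>k \<theta>. fo_wf S ar \<theta> \<and> fo_free_vars \<theta> \<subseteq> {..<2 * k} \<and>
          (\<exists>(A :: 'u set) I (a :: nat \<Rightarrow> 'u list).
             fo_model S ar T A I \<and> (\<forall>i. a i \<in> tuples k A) \<and>
             (\<forall>i j. fo_sat A I (\<lambda>m. (a i @ a j) ! m) \<theta> \<longleftrightarrow> i < j)))"

section \<open>Group actions and induced structures\<close>

text \<open>\<open>\<phi>\<close> is the action of the group \<open>A\<close> on \<open>\<Omega>\<close>.\<close>

definition oligomorphic ::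
    "('g, 'm) monoid_scheme \<Rightarrow> 'b set \<Rightarrow> ('g \<Rightarrow> 'b \<Rightarrow> 'b) \<Rightarrow> bool" where
  "oligomorphic A \<Omega> \<phi> \<longleftrightarrow> (\<forall>n\<ge>1. finite (orbits A (tuples n \<Omega>) (\<lambda>g. map (\<phi> g))))"

text \<open>The structure induced on \<open>\<Omega>\<close> has one symbol for each invariant relation \<open>R \<subseteq> \<Omega>\<^sup>n\<close>, namely
  \<open>(n, R)\<close>, of arity \<open>n\<close> and interpreted as \<open>R\<close>; the arity is part of the symbol because the empty
  relation is invariant in every arity.\<close>

definition invariant_relations ::
    "('g, 'm) monoid_scheme \<Rightarrow> 'b set \<Rightarrow> ('g \<Rightarrow> 'b \<Rightarrow> 'b) \<Rightarrow> (nat \<times> 'b list set) set" where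
  "invariant_relations A \<Omega> \<phi> =
     {(n, R). R \<subseteq> tuples n \<Omega> \<and>
        (\<forall>g\<in>carrier A. \<forall>xs\<in>tuples n \<Omega>. map (\<phi> g) xs \<in> R \<longleftrightarrow> xs \<in> R)}"

definition induced_structure_stable ::
    "'u itself \<Rightarrow> ('g, 'm) monoid_scheme \<Rightarrow> 'b set \<Rightarrow> ('g \<Rightarrow> 'b \<Rightarrow> 'b) \<Rightarrow> bool" where
  "induced_structure_stable U A \<Omega> \<phi> \<longleftrightarrow>
     fo_stable U (invariant_relations A \<Omega> \<phi>) fst
       (fo_theory (invariant_relations A \<Omega> \<phi>) fst \<Omega> snd)"

section \<open>Automorphisms and the metric extended from a clopen subgroup\<close>

definition automorphisms_preserving ::
    "('a, 'm) monoid_scheme \<Rightarrow> 'a set \<Rightarrow> ('a \<Rightarrow> 'a \<Rightarrow> real) \<Rightarrow> ('a \<Rightarrow> 'a) monoid" where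
  "automorphisms_preserving G H d =
     AutoGroup G \<lparr>carrier :=
       {\<alpha> \<in> auto G. \<alpha> ` H = H \<and> (\<forall>x\<in>H. \<forall>y\<in>H. d (\<alpha> x) (\<alpha> y) = d x y)}\<rparr>"

definition isometric_automorphisms ::
    "('a, 'm) monoid_scheme \<Rightarrow> ('a \<Rightarrow> 'a \<Rightarrow> real) \<Rightarrow> ('a \<Rightarrow> 'a) monoid" where
  "isometric_automorphisms G d =
     AutoGroup G \<lparr>carrier :=
       {\<alpha> \<in> auto G. \<forall>x\<in>carrier G. \<forall>y\<in>carrier G. d (\<alpha> x) (\<alpha> y) = d x y}\<rparr>"

text \<open>For normal \<open>H\<close> the right cosets used here, and as elements of \<open>G Mod H\<close>, are also the left
  cosets. The guards on \<open>carrier G\<close> make the function symmetric and nonnegative on the whole type, as the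
  locale \<^locale>\<open>Metric_space\<close> demands.\<close>

definition coset_metric ::
    "('a, 'm) monoid_scheme \<Rightarrow> 'a set \<Rightarrow> ('a \<Rightarrow> 'a \<Rightarrow> real) \<Rightarrow> 'a \<Rightarrow> 'a \<Rightarrow> real" where
  "coset_metric G H d x\<^sub>1 x\<^sub>2 =
     (if x\<^sub>1 \<in> carrier G \<and> x\<^sub>2 \<in> carrier G \<and> H #>\<^bsub>G\<^esub> x\<^sub>1 = H #>\<^bsub>G\<^esub> x\<^sub>2
      then d \<one>\<^bsub>G\<^esub> (inv\<^bsub>G\<^esub> x\<^sub>1 \<otimes>\<^bsub>G\<^esub> x\<^sub>2) else 1)"

end

theory Submission
  imports Defs "HOL-Analysis.Analysis"
begin

text \<open>
  Both properties in the theorem say that some relation on tuples of cosets, invariant under the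
  isometric automorphisms of \<open>(G, d\<^sup>*)\<close>, orders an infinite sequence of tuples of \<open>G/H\<close>. The bridge between
  metric formulas on \<open>G\<close> and relations on \<open>G/H\<close> is that two elements lie in one coset if and only if their
  \<open>d\<^sup>*\<close>-distance is at most \<open>1/2\<close>. A \<open>1/2\<close>-slow formula \<open>\<psi>\<close> with the order property yields the relation
  ``some representatives satisfy \<open>\<psi> = 0\<close>'', which slowness keeps disjoint from the tuples with
  \<open>\<psi> = 1\<close> (\<open>slow_order_property_imp_orders\<close>). Conversely, an invariant relation on cosets is defined by a
  formula with values in \<open>{0, 1}\<close>, and such a formula is automatically slow
  (\<open>orders_imp_slow_order_property\<close>). For first-order formulas the translation is immediate, as
  every invariant relation is a symbol of the language.

  The substance lies in two consequences of having compact cosets and finitely many orbits on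
  tuples of cosets. The first is \<open>saturation\<close>: a set of conditions on finitely many variables that is
  approximately satisfiable in \<open>G\<close> is exactly satisfiable, because automorphisms move approximate solutions
  into finitely many compact products of cosets. The second is homogeneity,
  \<open>same_type_imp_conjugate\<close>: tuples of the same continuous type lie in cosets that are conjugate under an
  automorphism. Here a back-and-forth construction is carried out on cosets, where one side of the
  partial maps may move inside its cosets at each step, and the automorphism is then found inside a
  product of cosets by Tychonoff's theorem. Homogeneity and saturation give the definability of
  invariant relations, \<open>invariant_relation_definable\<close>.

  Models are easily dealt with. An order property in some model yields finite orders of every length
  in \<open>G\<close> or \<open>G/H\<close>, since these are expressed by sentences, and finiteness of the number of orbits turns them into
  one infinite order of \<open>G/H\<close> (\<open>infinite_order\<close>), so the converse needs no model other than a copy of \<open>G\<close> or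
  \<open>G/H\<close> on the given type.
\<close>

section \<open>Formulas of continuous logic\<close>

lemma term_value_cong:
  "(\<And>i. i \<in> term_vars t \<Longrightarrow> v i = w i) \<Longrightarrow> term_value G v t = term_value G w t"
  by (induction t) auto

lemma formula_value_cong:
  "(\<And>i. i \<in> free_vars \<phi> \<Longrightarrow> v i = w i) \<Longrightarrow> formula_value G D v \<phi> = formula_value G D w \<phi>"
proof (induction \<phi> arbitrary: v w)
  case (Dist s t)
  then show ?case
    using term_value_cong[of s v w G] term_value_cong[of t v w G] by simp
next
  case (FSup n \<phi>)
  have "formula_value G D (v(n := a)) \<phi> = formula_value G D (w(n := a)) \<phi>" for a
    by (rule FSup.IH) (use FSup.prems in auto)
  then show ?case by simp
next
  case (FInf n \<phi>)
  have "formula_value G D (v(n := a)) \<phi> = formula_value G D (w(n := a)) \<phi>" for a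
    by (rule FInf.IH) (use FInf.prems in auto)
  then show ?case by simp
next
  case (Monus \<phi>1 \<phi>2)
  show ?case by (simp add: Monus.IH[of v w] Monus.prems)
next
  case (FMin \<phi>1 \<phi>2)
  show ?case by (simp add: FMin.IH[of v w] FMin.prems)
next
  case (FMax \<phi>1 \<phi>2)
  show ?case by (simp add: FMax.IH[of v w] FMax.prems)
next
  case (AbsDiff \<phi>1 \<phi>2)
  show ?case by (simp add: AbsDiff.IH[of v w] AbsDiff.prems)
next
  case (TruncPlus \<phi>1 \<phi>2)
  show ?case by (simp add: TruncPlus.IH[of v w] TruncPlus.prems)
next
  case (Times \<phi>1 \<phi>2)
  show ?case by (simp add: Times.IH[of v w] Times.prems)
next
  case (Half \<phi>)
  show ?case by (simp add: Half.IH[of v w] Half.prems)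
next
  case (Compl \<phi>)
  show ?case by (simp add: Compl.IH[of v w] Compl.prems)
next
  case (Sqrt \<phi>)
  show ?case by (simp add: Sqrt.IH[of v w] Sqrt.prems)
qed simp

lemma finite_term_vars: "finite (term_vars t)"
  by (induction t) auto

lemma finite_free_vars: "finite (free_vars \<phi>)"
  by (induction \<phi>) (auto simp: finite_term_vars)

text \<open>A variable that is safe to bind when a formula is renamed along \<open>r\<close>: capture is avoided because
  it lies above all images of the variables in \<open>S\<close>.\<close>

definition fresh :: "(nat \<Rightarrow> nat) \<Rightarrow> nat set \<Rightarrow> nat" where
  "fresh r S = Suc (Max (insert 0 (r ` S)))"

lemma fresh: "finite S \<Longrightarrow> i \<in> S \<Longrightarrow> r i \<noteq> fresh r S"
proof -
  assume "finite S" "i \<in> S"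
  then have "r i \<le> Max (insert 0 (r ` S))"
    by (intro Max_ge) auto
  then show ?thesis
    unfolding fresh_def by linarith
qed

primrec rename_term :: "(nat \<Rightarrow> nat) \<Rightarrow> metric_term \<Rightarrow> metric_term" where
  "rename_term r (Var n) = Var (r n)"
| "rename_term r (Mult s t) = Mult (rename_term r s) (rename_term r t)"
| "rename_term r (Inv t) = Inv (rename_term r t)"

primrec rename :: "metric_formula \<Rightarrow> (nat \<Rightarrow> nat) \<Rightarrow> metric_formula" where
  "rename (Dist s t) r = Dist (rename_term r s) (rename_term r t)"
| "rename (Const q) r = Const q"
| "rename (Half \<phi>) r = Half (rename \<phi> r)"
| "rename (Monus \<phi> \<psi>) r = Monus (rename \<phi> r) (rename \<psi> r)"
| "rename (FMin \<phi> \<psi>) r = FMin (rename \<phi> r) (rename \<psi> r)"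
| "rename (FMax \<phi> \<psi>) r = FMax (rename \<phi> r) (rename \<psi> r)"
| "rename (AbsDiff \<phi> \<psi>) r = AbsDiff (rename \<phi> r) (rename \<psi> r)"
| "rename (Compl \<phi>) r = Compl (rename \<phi> r)"
| "rename (TruncPlus \<phi> \<psi>) r = TruncPlus (rename \<phi> r) (rename \<psi> r)"
| "rename (Times \<phi> \<psi>) r = Times (rename \<phi> r) (rename \<psi> r)"
| "rename (Sqrt \<phi>) r = Sqrt (rename \<phi> r)"
| "rename (FSup n \<phi>) r = (let m = fresh r (free_vars \<phi> - {n}) in FSup m (rename \<phi> (r(n := m))))"
| "rename (FInf n \<phi>) r = (let m = fresh r (free_vars \<phi> - {n}) in FInf m (rename \<phi> (r(n := m))))"

lemma term_value_rename: "term_value G v (rename_term r t) = term_value G (v \<circ> r) t"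
  by (induction t) auto

text \<open>Renamings need not be injective. This matters for the order property, where one compares
  \<open>\<psi>(a\<^sub>i, a\<^sub>j)\<close> for all pairs \<open>i, j\<close>, including \<open>i = j\<close>, inside a single formula.\<close>

lemma formula_value_rename: "formula_value G D v (rename \<phi> r) = formula_value G D (v \<circ> r) \<phi>"
proof (induction \<phi> arbitrary: v r)
  case (FSup n \<phi>)
  let ?m = "fresh r (free_vars \<phi> - {n})"
  have "formula_value G D (v(?m := a) \<circ> r(n := ?m)) \<phi> = formula_value G D ((v \<circ> r)(n := a)) \<phi>" for a
    by (rule formula_value_cong) (use fresh[of "free_vars \<phi> - {n}" _ r] finite_free_vars in auto)
  then show ?case by (simp only: rename.simps Let_def formula_value.simps FSup.IH)
next
  case (FInf n \<phi>)
  let ?m = "fresh r (free_vars \<phi> - {n})"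
  have "formula_value G D (v(?m := a) \<circ> r(n := ?m)) \<phi> = formula_value G D ((v \<circ> r)(n := a)) \<phi>" for a
    by (rule formula_value_cong) (use fresh[of "free_vars \<phi> - {n}" _ r] finite_free_vars in auto)
  then show ?case by (simp only: rename.simps Let_def formula_value.simps FInf.IH)
qed (simp_all add: term_value_rename)

lemma image_rename_bound:
  "finite S \<Longrightarrow> r(n := fresh r (S - {n})) ` S - {fresh r (S - {n})} = r ` (S - {n})"
  using fresh[of "S - {n}" _ r] by (auto simp: image_iff split: if_splits)

lemma free_vars_rename: "free_vars (rename \<phi> r) = r ` free_vars \<phi>"
proof (induction \<phi> arbitrary: r)
  case (Dist s t)
  have "term_vars (rename_term r u) = r ` term_vars u" for u
    by (induction u) auto
  then show ?case by auto
next
  case (FSup n \<phi>)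
  then show ?case by (simp add: Let_def image_rename_bound finite_free_vars del: fun_upd_apply)
next
  case (FInf n \<phi>)
  then show ?case by (simp add: Let_def image_rename_bound finite_free_vars del: fun_upd_apply)
qed (auto)

definition const :: "rat \<Rightarrow> metric_formula" where
  "const q = Const (Abs_unit_rat q)"

definition formula_max :: "metric_formula list \<Rightarrow> metric_formula" where
  "formula_max \<phi>s = foldr FMax \<phi>s (const 0)"

definition formula_min :: "metric_formula list \<Rightarrow> metric_formula" where
  "formula_min \<phi>s = foldr FMin \<phi>s (const 1)"

primrec inf_vars :: "nat \<Rightarrow> metric_formula \<Rightarrow> metric_formula" where
  "inf_vars 0 \<phi> = \<phi>"
| "inf_vars (Suc n) \<phi> = inf_vars n (FInf n \<phi>)"

lemma formula_value_const: "0 \<le> q \<Longrightarrow> q \<le> 1 \<Longrightarrow> formula_value G D v (const q) = of_rat q"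
  by (simp add: const_def Abs_unit_rat_inverse)

lemma free_vars_const: "free_vars (const q) = {}"
  by (simp add: const_def)

lemma formula_max_le_iff:
  "formula_value G D v (formula_max \<phi>s) \<le> r \<longleftrightarrow> 0 \<le> r \<and> (\<forall>\<phi>\<in>set \<phi>s. formula_value G D v \<phi> \<le> r)"
  by (induction \<phi>s) (auto simp: formula_max_def formula_value_const)

lemma formula_min_ge_iff:
  "formula_value G D v (formula_min \<phi>s) \<ge> r \<longleftrightarrow> r \<le> 1 \<and> (\<forall>\<phi>\<in>set \<phi>s. formula_value G D v \<phi> \<ge> r)"
  by (induction \<phi>s) (auto simp: formula_min_def formula_value_const)

lemma free_vars_formula_max: "free_vars (formula_max \<phi>s) = (\<Union>\<phi>\<in>set \<phi>s. free_vars \<phi>)"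
  by (induction \<phi>s) (auto simp: formula_max_def free_vars_const)

lemma free_vars_formula_min: "free_vars (formula_min \<phi>s) = (\<Union>\<phi>\<in>set \<phi>s. free_vars \<phi>)"
  by (induction \<phi>s) (auto simp: formula_min_def free_vars_const)

lemma free_vars_inf_vars: "free_vars (inf_vars n \<phi>) = free_vars \<phi> - {..<n}"
  by (induction n arbitrary: \<phi>) (auto simp: lessThan_Suc)

section \<open>Values in bounded metric groups\<close>

locale bounded_metric_group = group G + Metric_space "carrier G" D
  for G :: "('a, 'm) monoid_scheme" (structure) and D :: "'a \<Rightarrow> 'a \<Rightarrow> real" +
  assumes dist_le_1: "\<lbrakk>x \<in> carrier G; y \<in> carrier G\<rbrakk> \<Longrightarrow> D x y \<le> 1"

lemma bounded_metric_groupI: "metric_group_structure M e \<Longrightarrow> bounded_metric_group M e"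
  by (simp add: metric_group_structure_def bounded_metric_group_def bounded_metric_group_axioms_def)

context bounded_metric_group
begin

abbreviation val :: "(nat \<Rightarrow> 'a) \<Rightarrow> metric_formula \<Rightarrow> real" where
  "val \<equiv> formula_value G D"

abbreviation assignments :: "(nat \<Rightarrow> 'a) set" where
  "assignments \<equiv> UNIV \<rightarrow> carrier G"

lemma assignment_upd: "v \<in> assignments \<Longrightarrow> a \<in> carrier G \<Longrightarrow> v(n := a) \<in> assignments"
  by auto

lemma term_value_closed: "v \<in> assignments \<Longrightarrow> term_value G v t \<in> carrier G"
  by (induction t) auto

lemma val_bounds: "v \<in> assignments \<Longrightarrow> 0 \<le> val v \<phi> \<and> val v \<phi> \<le> 1"
proof (induction \<phi> arbitrary: v)
  case (Dist s t)
  then show ?case by (simp add: dist_le_1 term_value_closed)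
next
  case (Const q)
  have "0 \<le> Rep_unit_rat q" "Rep_unit_rat q \<le> 1"
    using Rep_unit_rat[of q] by auto
  then show ?case by (simp add: zero_le_of_rat_iff of_rat_le_1_iff)
next
  case (Half \<phi>)
  from Half.IH[OF Half.prems] show ?case by auto
next
  case (Monus \<phi>1 \<phi>2)
  from Monus.IH[OF Monus.prems] show ?case by simp
next
  case (FMin \<phi>1 \<phi>2)
  from FMin.IH[OF FMin.prems] show ?case by (simp add: min_le_iff_disj)
next
  case (FMax \<phi>1 \<phi>2)
  from FMax.IH[OF FMax.prems] show ?case by (simp add: le_max_iff_disj)
next
  case (AbsDiff \<phi>1 \<phi>2)
  from AbsDiff.IH[OF AbsDiff.prems] have "\<bar>val v \<phi>1 - val v \<phi>2\<bar> \<le> 1" by linarith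
  then show ?case by simp
next
  case (Compl \<phi>)
  from Compl.IH[OF Compl.prems] show ?case by auto
next
  case (TruncPlus \<phi>1 \<phi>2)
  from TruncPlus.IH[OF TruncPlus.prems] show ?case by simp
next
  case (Times \<phi>1 \<phi>2)
  from Times.IH[OF Times.prems] show ?case by (simp add: mult_le_one)
next
  case (Sqrt \<phi>)
  from Sqrt.IH[OF Sqrt.prems] show ?case by auto
next
  case (FSup n \<phi>)
  have *: "0 \<le> val (v(n := a)) \<phi> \<and> val (v(n := a)) \<phi> \<le> 1" if "a \<in> carrier G" for a
    using FSup.IH[OF assignment_upd[OF FSup.prems that]] .
  have "val (v(n := \<one>)) \<phi> \<le> (SUP a\<in>carrier G. val (v(n := a)) \<phi>)"
    by (rule cSUP_upper) (use * in \<open>auto simp: bdd_above_def\<close>)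
  moreover have "(SUP a\<in>carrier G. val (v(n := a)) \<phi>) \<le> 1"
    by (rule cSUP_least) (use * in auto)
  ultimately show ?case
    using *[OF one_closed] by simp
next
  case (FInf n \<phi>)
  have *: "0 \<le> val (v(n := a)) \<phi> \<and> val (v(n := a)) \<phi> \<le> 1" if "a \<in> carrier G" for a
    using FInf.IH[OF assignment_upd[OF FInf.prems that]] .
  have "(INF a\<in>carrier G. val (v(n := a)) \<phi>) \<le> val (v(n := \<one>)) \<phi>"
    by (rule cINF_lower) (use * in \<open>auto simp: bdd_below_def\<close>)
  moreover have "(INF a\<in>carrier G. val (v(n := a)) \<phi>) \<ge> 0"
    by (rule cINF_greatest) (use * in auto)
  ultimately show ?case
    using *[OF one_closed] by simp
qed

lemma val_nonneg: "v \<in> assignments \<Longrightarrow> 0 \<le> val v \<phi>"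
  using val_bounds by blast

lemma val_le_1: "v \<in> assignments \<Longrightarrow> val v \<phi> \<le> 1"
  using val_bounds by blast

lemma val_FInf_le: "v \<in> assignments \<Longrightarrow> a \<in> carrier G \<Longrightarrow> val v (FInf n \<phi>) \<le> val (v(n := a)) \<phi>"
  unfolding formula_value.simps
  by (rule cINF_lower) (auto simp: bdd_below_def intro!: exI[of _ 0] val_nonneg)

lemma val_FSup_ge: "v \<in> assignments \<Longrightarrow> a \<in> carrier G \<Longrightarrow> val (v(n := a)) \<phi> \<le> val v (FSup n \<phi>)"
  unfolding formula_value.simps
  by (rule cSUP_upper) (auto simp: bdd_above_def intro!: exI[of _ 1] val_le_1)

lemma val_FInf_less: "val v (FInf n \<phi>) < r \<Longrightarrow> \<exists>a\<in>carrier G. val (v(n := a)) \<phi> < r"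
  unfolding formula_value.simps
  by (metis (no_types, lifting) cINF_greatest leI not_less one_closed empty_iff)

lemma val_inf_vars_le: "v \<in> assignments \<Longrightarrow> val v (inf_vars n \<phi>) \<le> val v \<phi>"
proof (induction n arbitrary: \<phi>)
  case (Suc n)
  then show ?case
    using Suc.IH[of "FInf n \<phi>"] val_FInf_le[of v "v n" n \<phi>] by (force simp: Pi_iff)
qed simp

text \<open>Being an infimum, the value of an existential closure need not be attained; its instances only come
  arbitrarily close to it. Exact witnesses in \<open>G\<close> are obtained later from compactness.\<close>

lemma val_inf_vars_less:
  "v \<in> assignments \<Longrightarrow> val v (inf_vars n \<phi>) < r \<Longrightarrow> \<exists>w\<in>assignments. val w \<phi> < r"
proof (induction n arbitrary: \<phi>)
  case (Suc n)
  then obtain w where "w \<in> assignments" "val w (FInf n \<phi>) < r"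
    using Suc.IH[of "FInf n \<phi>"] by (metis inf_vars.simps(2))
  then show ?case
    using val_FInf_less[of w n \<phi> r] assignment_upd[of w] by blast
qed auto

text \<open>Repeated truncated doubling of \<open>\<phi> - r\<close> pushes every value that is at least \<open>s\<close> up to \<open>1\<close>
  and leaves the values that are at most \<open>r\<close> at \<open>0\<close>.\<close>

lemma threshold_formula:
  fixes r s :: real
  assumes "0 \<le> r" "r < s" "s \<le> 1"
  shows "\<exists>\<psi>. free_vars \<psi> = free_vars \<phi> \<and>
           (\<forall>v\<in>assignments. (val v \<phi> \<le> r \<longrightarrow> val v \<psi> = 0) \<and> (val v \<phi> \<ge> s \<longrightarrow> val v \<psi> = 1))"
proof -
  obtain q where q: "r < of_rat q" "of_rat q < s"
    using of_rat_dense assms(2) by blast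
  have q01: "0 \<le> q" "q \<le> 1"
    using q assms by (metis less_eq_real_def not_less of_rat_less_0_iff order_trans)
      (metis q(2) assms(3) less_eq_real_def of_rat_le_1_iff order_trans)
  define \<kappa> where "\<kappa> m = ((\<lambda>\<psi>. TruncPlus \<psi> \<psi>) ^^ m) (Monus \<phi> (const q))" for m
  have \<kappa>: "val v (\<kappa> m) = min (2 ^ m * max (val v \<phi> - of_rat q) 0) 1" if "v \<in> assignments" for v m
  proof (induction m)
    case 0
    have "0 \<le> (of_rat q :: real)"
      using q01 by simp
    then have "max (val v \<phi> - of_rat q) 0 \<le> 1"
      using val_le_1[OF that, of \<phi>] by linarith
    then show ?case
      using q01 by (simp add: \<kappa>_def formula_value_const)
  next
    case (Suc m)
    have "val v (\<kappa> (Suc m)) = min (val v (\<kappa> m) + val v (\<kappa> m)) 1"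
      by (simp add: \<kappa>_def)
    then show ?case
      using Suc by (auto simp: min_def)
  qed
  have fv: "free_vars (\<kappa> m) = free_vars \<phi>" for m
    by (induction m) (auto simp: \<kappa>_def free_vars_const)
  obtain m :: nat where m: "1 / (s - of_rat q) < 2 ^ m"
    using real_arch_pow by force
  then have m1: "1 < 2 ^ m * (s - of_rat q)"
    using q by (simp add: field_simps)
  have "val v (\<kappa> m) = 1" if "v \<in> assignments" "val v \<phi> \<ge> s" for v
  proof -
    have "2 ^ m * (s - of_rat q) \<le> 2 ^ m * max (val v \<phi> - of_rat q) 0"
      by (rule mult_left_mono) (use that in auto)
    then show ?thesis
      using \<kappa>[OF that(1), of m] m1 by linarith
  qed
  moreover have "val v (\<kappa> m) = 0" if "v \<in> assignments" "val v \<phi> \<le> r" for v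
    using \<kappa>[OF that(1), of m] that q by simp
  ultimately show ?thesis
    using fv by blast
qed

text \<open>A formula measuring how far finitely many formulas are from prescribed values; the prescribed
  values have to be approximated by rational constants.\<close>

lemma closeness_formula:
  fixes r :: "metric_formula \<Rightarrow> real"
  assumes "finite \<Delta>" "\<epsilon> > 0" and r: "\<And>\<phi>. \<phi> \<in> \<Delta> \<Longrightarrow> 0 \<le> r \<phi> \<and> r \<phi> \<le> 1"
  obtains \<kappa> where "free_vars \<kappa> = (\<Union>\<phi>\<in>\<Delta>. free_vars \<phi>)"
    and "\<And>v \<phi>. \<lbrakk>val v \<kappa> \<le> \<epsilon>; \<phi> \<in> \<Delta>\<rbrakk> \<Longrightarrow> \<bar>val v \<phi> - r \<phi>\<bar> \<le> 2 * \<epsilon>"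
    and "\<And>v. \<forall>\<phi>\<in>\<Delta>. val v \<phi> = r \<phi> \<Longrightarrow> val v \<kappa> \<le> \<epsilon> / 2"
proof -
  obtain l where l: "set l = \<Delta>"
    using finite_list assms by blast
  have "\<exists>q. 0 \<le> q \<and> q \<le> 1 \<and> \<bar>of_rat q - r \<phi>\<bar> \<le> \<epsilon> / 2" if "\<phi> \<in> \<Delta>" for \<phi>
  proof (cases "r \<phi> = 0 \<or> r \<phi> = 1")
    case True
    then show ?thesis
      using assms(2) by (auto intro: exI[of _ 0] exI[of _ 1])
  next
    case False
    then have "0 < r \<phi>" "r \<phi> < 1"
      using r[OF that] by auto
    then have "r \<phi> < min 1 (r \<phi> + \<epsilon> / 2)"
      using assms(2) by auto
    then obtain q where q: "r \<phi> < of_rat q" "of_rat q < min 1 (r \<phi> + \<epsilon> / 2)"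
      using of_rat_dense by blast
    then have "0 < (of_rat q :: real)" "(of_rat q :: real) < 1"
      using \<open>0 < r \<phi>\<close> by linarith+
    then have "0 < q" "q < 1"
      by simp_all
    moreover have "\<bar>of_rat q - r \<phi>\<bar> \<le> \<epsilon> / 2"
      using q by linarith
    ultimately show ?thesis
      by (intro exI[of _ q]) simp
  qed
  then obtain q where q: "\<And>\<phi>. \<phi> \<in> \<Delta> \<Longrightarrow> 0 \<le> q \<phi> \<and> q \<phi> \<le> 1 \<and> \<bar>of_rat (q \<phi>) - r \<phi>\<bar> \<le> \<epsilon> / 2"
    by metis
  define \<kappa> where "\<kappa> = formula_max (map (\<lambda>\<phi>. AbsDiff \<phi> (const (q \<phi>))) l)"
  have fv: "free_vars \<kappa> = (\<Union>\<phi>\<in>\<Delta>. free_vars \<phi>)"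
    by (auto simp: \<kappa>_def free_vars_formula_max l free_vars_const)
  have le: "val v \<kappa> \<le> t \<longleftrightarrow> 0 \<le> t \<and> (\<forall>\<phi>\<in>\<Delta>. \<bar>val v \<phi> - of_rat (q \<phi>)\<bar> \<le> t)" for v t
    using q by (auto simp: \<kappa>_def formula_max_le_iff l formula_value_const)
  have near: "\<bar>val v \<phi> - r \<phi>\<bar> \<le> 2 * \<epsilon>" if "val v \<kappa> \<le> \<epsilon>" "\<phi> \<in> \<Delta>" for v \<phi>
  proof -
    have "\<bar>val v \<phi> - of_rat (q \<phi>)\<bar> \<le> \<epsilon>"
      using that unfolding le by blast
    then show ?thesis
      using q[OF that(2)] assms(2) by linarith
  qed
  have exact: "val v \<kappa> \<le> \<epsilon> / 2" if "\<forall>\<phi>\<in>\<Delta>. val v \<phi> = r \<phi>" for v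
    unfolding le using that q assms(2) by (auto simp: abs_minus_commute)
  from fv near exact show ?thesis by (rule that)
qed

end

lemma (in group) bi_invariant_inv:
  fixes e :: "'a \<Rightarrow> 'a \<Rightarrow> real"
  assumes left: "\<And>g x y. \<lbrakk>g \<in> carrier G; x \<in> carrier G; y \<in> carrier G\<rbrakk> \<Longrightarrow> e (g \<otimes> x) (g \<otimes> y) = e x y"
    and right: "\<And>g x y. \<lbrakk>g \<in> carrier G; x \<in> carrier G; y \<in> carrier G\<rbrakk> \<Longrightarrow> e (x \<otimes> g) (y \<otimes> g) = e x y"
    and xy: "x \<in> carrier G" "y \<in> carrier G"
  shows "e (inv x) (inv y) = e y x"
proof -
  have "e (inv x) (inv y) = e (x \<otimes> inv x) (x \<otimes> inv y)"
    by (rule left[symmetric]) (use xy in auto)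
  also have "\<dots> = e (x \<otimes> inv x \<otimes> y) (x \<otimes> inv y \<otimes> y)"
    by (rule right[symmetric]) (use xy in auto)
  also have "\<dots> = e y x"
    using xy by (simp add: m_assoc)
  finally show ?thesis .
qed

section \<open>Isomorphic copies\<close>

lemma formula_value_iso:
  assumes "bounded_metric_group M e" and h: "h \<in> iso M N" and N: "group N"
    and isom: "\<And>x y. \<lbrakk>x \<in> carrier M; y \<in> carrier M\<rbrakk> \<Longrightarrow> e' (h x) (h y) = e x y"
    and "v \<in> UNIV \<rightarrow> carrier M"
  shows "formula_value N e' (h \<circ> v) \<phi> = formula_value M e v \<phi>"
proof -
  interpret M: bounded_metric_group M e by fact
  interpret N: group N by fact
  interpret group_hom M N h
    using h by unfold_locales (auto simp: iso_def)
  have img: "carrier N = h ` carrier M"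
    using h by (auto simp: iso_def bij_betw_def)
  have t: "term_value N (h \<circ> v) t = h (term_value M v t)" if "v \<in> UNIV \<rightarrow> carrier M" for v t
    by (induction t) (use that M.term_value_closed in \<open>auto\<close>)
  have upd: "(h \<circ> v)(n := h a) = h \<circ> v(n := a)" for v n a
    by (auto simp: fun_eq_iff)
  show ?thesis using assms(5)
  proof (induction \<phi> arbitrary: v)
    case (Dist s t')
    then show ?case by (simp only: formula_value.simps t isom M.term_value_closed)
  next
    case (FSup n \<phi>)
    have "formula_value N e' ((h \<circ> v)(n := h a)) \<phi> = formula_value M e (v(n := a)) \<phi>"
      if "a \<in> carrier M" for a
      unfolding upd using FSup.IH[OF M.assignment_upd[OF FSup.prems that]] .
    then show ?case
      by (simp only: formula_value.simps img image_image cong: image_cong)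
  next
    case (FInf n \<phi>)
    have "formula_value N e' ((h \<circ> v)(n := h a)) \<phi> = formula_value M e (v(n := a)) \<phi>"
      if "a \<in> carrier M" for a
      unfolding upd using FInf.IH[OF M.assignment_upd[OF FInf.prems that]] .
    then show ?case
      by (simp only: formula_value.simps img image_image cong: image_cong)
  qed simp_all
qed

text \<open>The models in the order properties live on a prescribed type, so the structure has to be
  moved there.\<close>

lemma metric_group_copy:
  fixes f :: "'a \<Rightarrow> 'u" and M :: "('a, 'm) monoid_scheme"
  assumes M: "metric_group_structure M e" and inj: "inj_on f (carrier M)"
  shows "\<exists>(N :: 'u monoid) e'. metric_group_structure N e' \<and> f \<in> iso M N \<and>
           (\<forall>x\<in>carrier M. \<forall>y\<in>carrier M. e' (f x) (f y) = e x y)"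
proof -
  interpret M: bounded_metric_group M e
    using M by (rule bounded_metric_groupI)
  define g where "g = inv_into (carrier M) f"
  have gf [simp]: "g (f x) = x" if "x \<in> carrier M" for x
    using inj that by (simp add: g_def)
  define N :: "'u monoid" where
    "N = \<lparr>carrier = f ` carrier M, monoid.mult = (\<lambda>x y. f (g x \<otimes>\<^bsub>M\<^esub> g y)), one = f \<one>\<^bsub>M\<^esub>\<rparr>"
  define e' where "e' x y = e (g x) (g y)" for x y
  have [simp]: "carrier N = f ` carrier M" "\<one>\<^bsub>N\<^esub> = f \<one>\<^bsub>M\<^esub>" "x \<otimes>\<^bsub>N\<^esub> y = f (g x \<otimes>\<^bsub>M\<^esub> g y)" for x y
    by (auto simp: N_def)
  interpret N: group N
  proof (rule groupI)
    fix x assume "x \<in> carrier N"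
    then obtain a where a: "a \<in> carrier M" "x = f a" by auto
    then have "f (inv\<^bsub>M\<^esub> a) \<otimes>\<^bsub>N\<^esub> x = \<one>\<^bsub>N\<^esub>" by simp
    then show "\<exists>y\<in>carrier N. y \<otimes>\<^bsub>N\<^esub> x = \<one>\<^bsub>N\<^esub>"
      using a by (intro bexI[of _ "f (inv\<^bsub>M\<^esub> a)"]) auto
  qed (auto simp: M.m_assoc)
  have iso: "f \<in> iso M N"
    using inj by (auto simp: iso_def hom_def bij_betw_def)
  interpret group_hom M N f
    using iso by unfold_locales (auto simp: iso_def)
  note hom_one [simp del] hom_mult [simp del] hom_inv [simp del]
  have met: "Metric_space (carrier N) e'"
    by unfold_locales (auto simp: e'_def M.commute M.triangle)
  interpret N: Metric_space "carrier N" e'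
    by (fact met)
  have "N.mcomplete"
    unfolding N.mcomplete_def
  proof (intro allI impI)
    fix \<sigma> assume s: "N.MCauchy \<sigma>"
    have rg: "\<sigma> n \<in> f ` carrier M" for n
      using s unfolding N.MCauchy_def by auto
    have gs: "g (\<sigma> n) \<in> carrier M" "f (g (\<sigma> n)) = \<sigma> n" for n
      using rg[of n] by auto
    have "M.MCauchy (g \<circ> \<sigma>)"
      using s gs unfolding M.MCauchy_def N.MCauchy_def e'_def by auto
    then obtain x where x: "limitin M.mtopology (g \<circ> \<sigma>) x sequentially"
      using M by (auto simp: metric_group_structure_def M.mcomplete_def)
    then have "limitin N.mtopology \<sigma> (f x) sequentially"
      using gs rg unfolding M.limit_metric_sequentially N.limit_metric_sequentially e'_def by auto
    then show "\<exists>x. limitin N.mtopology \<sigma> x sequentially" by blast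
  qed
  moreover have "uniformly_continuous_operations N e'"
  proof -
    obtain \<gamma>1 \<gamma>2 where "\<forall>\<epsilon>>0. \<gamma>1 \<epsilon> > 0 \<and> \<gamma>2 \<epsilon> > 0 \<and>
        (\<forall>x1\<in>carrier M. \<forall>x2\<in>carrier M. e x1 x2 < \<gamma>1 \<epsilon> \<longrightarrow> e (inv\<^bsub>M\<^esub> x1) (inv\<^bsub>M\<^esub> x2) < \<epsilon>) \<and>
        (\<forall>x1\<in>carrier M. \<forall>x2\<in>carrier M. e x1 x2 < \<gamma>2 \<epsilon> \<longrightarrow>
           (\<forall>y\<in>carrier M. max (e (x1 \<otimes>\<^bsub>M\<^esub> y) (x2 \<otimes>\<^bsub>M\<^esub> y)) (e (y \<otimes>\<^bsub>M\<^esub> x1) (y \<otimes>\<^bsub>M\<^esub> x2)) < \<epsilon>))"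
      using M unfolding metric_group_structure_def uniformly_continuous_operations_def by blast
    then show ?thesis
      unfolding uniformly_continuous_operations_def
      by (intro exI[of _ \<gamma>1] exI[of _ \<gamma>2])
         (auto simp: e'_def hom_inv[symmetric])
  qed
  ultimately have "metric_group_structure N e'"
    using M met N.is_group by (auto simp: metric_group_structure_def e'_def)
  moreover have "\<forall>x\<in>carrier M. \<forall>y\<in>carrier M. e' (f x) (f y) = e x y"
    by (simp add: e'_def)
  ultimately show ?thesis
    using iso by blast
qed

section \<open>First-order formulas\<close>

lemma fo_sat_cong:
  "(\<And>i. i \<in> fo_free_vars \<theta> \<Longrightarrow> v i = w i) \<Longrightarrow> fo_sat A I v \<theta> \<longleftrightarrow> fo_sat A I w \<theta>"
proof (induction \<theta> arbitrary: v w)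
  case (FOEq m n)
  then show ?case by simp
next
  case (FORel r xs)
  then have "map v xs = map w xs" by simp
  then show ?case by (simp only: fo_sat.simps)
next
  case (FONot \<theta>)
  show ?case by (simp add: FONot.IH[of v w] FONot.prems)
next
  case (FOAnd \<theta>1 \<theta>2)
  show ?case by (simp add: FOAnd.IH[of v w] FOAnd.prems)
next
  case (FOEx n \<theta>)
  have "fo_sat A I (v(n := a)) \<theta> = fo_sat A I (w(n := a)) \<theta>" for a
    by (rule FOEx.IH) (use FOEx.prems in auto)
  then show ?case by simp
qed

lemma finite_fo_free_vars: "finite (fo_free_vars \<theta>)"
  by (induction \<theta>) auto

primrec fo_rename :: "'r fo_formula \<Rightarrow> (nat \<Rightarrow> nat) \<Rightarrow> 'r fo_formula" where
  "fo_rename (FOEq m n) r = FOEq (r m) (r n)"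
| "fo_rename (FORel R xs) r = FORel R (map r xs)"
| "fo_rename (FONot \<phi>) r = FONot (fo_rename \<phi> r)"
| "fo_rename (FOAnd \<phi> \<psi>) r = FOAnd (fo_rename \<phi> r) (fo_rename \<psi> r)"
| "fo_rename (FOEx n \<phi>) r =
     (let m = fresh r (fo_free_vars \<phi> - {n}) in FOEx m (fo_rename \<phi> (r(n := m))))"

lemma fo_sat_rename: "fo_sat A I v (fo_rename \<theta> r) \<longleftrightarrow> fo_sat A I (v \<circ> r) \<theta>"
proof (induction \<theta> arbitrary: v r)
  case (FOEx n \<phi>)
  let ?m = "fresh r (fo_free_vars \<phi> - {n})"
  have "fo_sat A I (v(?m := a) \<circ> r(n := ?m)) \<phi> = fo_sat A I ((v \<circ> r)(n := a)) \<phi>" for a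
    by (rule fo_sat_cong) (use fresh[of "fo_free_vars \<phi> - {n}" _ r] finite_fo_free_vars in auto)
  then show ?case by (simp only: fo_rename.simps Let_def fo_sat.simps FOEx.IH)
qed simp_all

lemma fo_free_vars_rename: "fo_free_vars (fo_rename \<theta> r) = r ` fo_free_vars \<theta>"
proof (induction \<theta> arbitrary: r)
  case (FOEx n \<phi>)
  then show ?case by (simp add: Let_def image_rename_bound finite_fo_free_vars del: fun_upd_apply)
qed auto

lemma fo_wf_rename: "fo_wf S ar (fo_rename \<theta> r) \<longleftrightarrow> fo_wf S ar \<theta>"
  by (induction \<theta> arbitrary: r) (auto simp: Let_def)

text \<open>A tautology in a bound variable serves as the empty conjunction, so that no free variable is
  introduced.\<close>

definition fo_conj :: "'r fo_formula list \<Rightarrow> 'r fo_formula" where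
  "fo_conj \<theta>s = foldr FOAnd \<theta>s (FOEx 0 (FOEq 0 0))"

primrec fo_exs :: "nat \<Rightarrow> 'r fo_formula \<Rightarrow> 'r fo_formula" where
  "fo_exs 0 \<phi> = \<phi>"
| "fo_exs (Suc n) \<phi> = fo_exs n (FOEx n \<phi>)"

lemma fo_sat_conj: "A \<noteq> {} \<Longrightarrow> fo_sat A I v (fo_conj \<theta>s) \<longleftrightarrow> (\<forall>\<theta>\<in>set \<theta>s. fo_sat A I v \<theta>)"
  by (induction \<theta>s) (auto simp: fo_conj_def)

lemma fo_free_vars_conj: "fo_free_vars (fo_conj \<theta>s) = (\<Union>\<theta>\<in>set \<theta>s. fo_free_vars \<theta>)"
  by (induction \<theta>s) (auto simp: fo_conj_def)

lemma fo_wf_conj: "fo_wf S ar (fo_conj \<theta>s) \<longleftrightarrow> (\<forall>\<theta>\<in>set \<theta>s. fo_wf S ar \<theta>)"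
  by (induction \<theta>s) (auto simp: fo_conj_def)

lemma fo_free_vars_exs: "fo_free_vars (fo_exs n \<theta>) = fo_free_vars \<theta> - {..<n}"
  by (induction n arbitrary: \<theta>) (auto simp: lessThan_Suc)

lemma fo_wf_exs: "fo_wf S ar (fo_exs n \<theta>) \<longleftrightarrow> fo_wf S ar \<theta>"
  by (induction n arbitrary: \<theta>) auto

lemma fo_sat_exsI: "v \<in> UNIV \<rightarrow> A \<Longrightarrow> fo_sat A I v \<theta> \<Longrightarrow> fo_sat A I v (fo_exs n \<theta>)"
proof (induction n arbitrary: \<theta>)
  case (Suc n)
  then have "fo_sat A I v (FOEx n \<theta>)"
    by (auto intro!: bexI[of _ "v n"])
  then show ?case using Suc by simp
qed simp

lemma fo_sat_exsD: "v \<in> UNIV \<rightarrow> A \<Longrightarrow> fo_sat A I v (fo_exs n \<theta>) \<Longrightarrow> \<exists>w\<in>UNIV \<rightarrow> A. fo_sat A I w \<theta>"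
proof (induction n arbitrary: \<theta>)
  case (Suc n)
  then obtain w where w: "w \<in> UNIV \<rightarrow> A" "fo_sat A I w (FOEx n \<theta>)"
    using Suc.IH[of "FOEx n \<theta>"] by (metis fo_exs.simps(2))
  then obtain a where "a \<in> A" "fo_sat A I (w(n := a)) \<theta>" by auto
  moreover have "w(n := a) \<in> UNIV \<rightarrow> A"
    using w \<open>a \<in> A\<close> by auto
  ultimately show ?case by blast
qed auto

lemma fo_sat_iso:
  assumes h: "bij_betw h A B"
    and I: "\<And>r xs. \<lbrakk>r \<in> S; xs \<in> tuples (ar r) A\<rbrakk> \<Longrightarrow> map h xs \<in> J r \<longleftrightarrow> xs \<in> I r"
    and "v \<in> UNIV \<rightarrow> A" "fo_wf S ar \<theta>"
  shows "fo_sat B J (h \<circ> v) \<theta> \<longleftrightarrow> fo_sat A I v \<theta>"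
  using assms(3,4)
proof (induction \<theta> arbitrary: v)
  case (FOEq m n)
  then show ?case
    using h by (auto simp: bij_betw_def inj_on_eq_iff Pi_iff)
next
  case (FORel r xs)
  then have "map v xs \<in> tuples (ar r) A" by (auto simp: tuples_def)
  then show ?case using I[of r "map v xs"] FORel.prems by (simp add: comp_def)
next
  case (FOEx n \<theta>)
  have upd: "(h \<circ> v)(n := h a) = h \<circ> v(n := a)" for a
    by (auto simp: fun_eq_iff)
  have "fo_sat B J ((h \<circ> v)(n := h a)) \<theta> \<longleftrightarrow> fo_sat A I (v(n := a)) \<theta>" if "a \<in> A" for a
    unfolding upd by (rule FOEx.IH) (use FOEx.prems that in auto)
  moreover have "B = h ` A" using h by (auto simp: bij_betw_def)
  ultimately show ?case by (simp only: fo_sat.simps bex_simps cong: bex_cong)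
qed auto

section \<open>Compactness\<close>

text \<open>The form in which compactness is used throughout: conditions that can be met approximately, finitely
  many at a time, can be met exactly and all at once. Each condition is the intersection of the closed
  sets on which it holds up to \<open>\<epsilon>\<close>.\<close>

lemma compact_common_zero:
  fixes F :: "('b \<Rightarrow> real) set"
  assumes K: "compactin T K" and cont: "\<And>f. f \<in> F \<Longrightarrow> continuous_map T euclideanreal f"
    and approx: "\<And>F0 \<epsilon>. \<lbrakk>finite F0; F0 \<subseteq> F; \<epsilon> > 0\<rbrakk> \<Longrightarrow> \<exists>x\<in>K. \<forall>f\<in>F0. \<bar>f x\<bar> \<le> \<epsilon>"
  shows "\<exists>x\<in>K. \<forall>f\<in>F. f x = 0"
proof -
  define Z where "Z = (\<lambda>(f, \<epsilon>). {x \<in> topspace T. f x \<in> {-\<epsilon>..(\<epsilon>::real)}})"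
  have closed: "closedin T C" if "C \<in> Z ` (F \<times> {0<..})" for C
  proof -
    from that obtain f \<epsilon> where "f \<in> F" "C = Z (f, \<epsilon>)"
      by blast
    then have "f \<in> F" "C = {x \<in> topspace T. f x \<in> {-\<epsilon>..\<epsilon>}}"
      by (simp_all add: Z_def)
    then show ?thesis
      using closedin_continuous_map_preimage[OF cont, of f "{-\<epsilon>..\<epsilon>}"] by simp
  qed
  \<comment> \<open>Finitely many pairs \<open>(f, \<epsilon>)\<close> are dominated by the single smallest \<open>\<epsilon>\<close>.\<close>
  have fip: "K \<inter> \<Inter>\<F> \<noteq> {}" if "finite \<F>" "\<F> \<subseteq> Z ` (F \<times> {0<..})" for \<F>
  proof -
    from finite_subset_image[OF that] obtain P where P: "P \<subseteq> F \<times> {0<..}" "finite P" "\<F> = Z ` P"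
      by blast
    define \<epsilon> where "\<epsilon> = Min (insert 1 (snd ` P))"
    have "\<epsilon> > 0" "\<And>p. p \<in> P \<Longrightarrow> \<epsilon> \<le> snd p"
      using P by (auto simp: \<epsilon>_def)
    moreover have "finite (fst ` P)" "fst ` P \<subseteq> F"
      using P by auto
    ultimately obtain x where x: "x \<in> K" "\<And>f. f \<in> fst ` P \<Longrightarrow> \<bar>f x\<bar> \<le> \<epsilon>"
      using approx by meson
    have "x \<in> Z p" if "p \<in> P" for p
    proof -
      have "\<bar>fst p x\<bar> \<le> snd p"
        using x(2)[of "fst p"] \<open>\<And>p. p \<in> P \<Longrightarrow> \<epsilon> \<le> snd p\<close>[OF that] that by force
      moreover have "x \<in> topspace T"
        using x(1) K by (auto simp: compactin_def)
      ultimately show ?thesis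
        by (auto simp: Z_def split: prod.splits)
    qed
    then show ?thesis
      using x(1) P(3) by auto
  qed
  have "K \<inter> \<Inter>(Z ` (F \<times> {0<..})) \<noteq> {}"
    using K closed fip unfolding compactin_fip by (metis (no_types, lifting))
  then obtain x where x: "x \<in> K" "\<And>p. p \<in> F \<times> {0<..} \<Longrightarrow> x \<in> Z p"
    by auto
  have "f x = 0" if "f \<in> F" for f
  proof (rule ccontr)
    assume "f x \<noteq> 0"
    then have "x \<in> Z (f, \<bar>f x\<bar> / 2)"
      using that by (intro x(2)) auto
    then show False
      using \<open>f x \<noteq> 0\<close> by (auto simp: Z_def)
  qed
  then show ?thesis
    using x(1) by blast
qed

lemma (in Metric_space) continuous_map_product_uniform:
  fixes f :: "('i \<Rightarrow> 'a) \<Rightarrow> real"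
  assumes "\<And>\<epsilon>. \<epsilon> > 0 \<Longrightarrow> \<exists>\<delta>>0. \<exists>J. finite J \<and> J \<subseteq> I \<and>
             (\<forall>v\<in>PiE I (\<lambda>_. M). \<forall>w\<in>PiE I (\<lambda>_. M). (\<forall>i\<in>J. d (v i) (w i) < \<delta>) \<longrightarrow> \<bar>f v - f w\<bar> \<le> \<epsilon>)"
  shows "continuous_map (product_topology (\<lambda>_. mtopology) I) euclideanreal f"
proof -
  have "\<exists>U. openin (product_topology (\<lambda>_. mtopology) I) U \<and> v \<in> U \<and> (\<forall>w\<in>U. f w \<in> Met_TC.mball (f v) \<epsilon>)"
    if v: "v \<in> topspace (product_topology (\<lambda>_. mtopology) I)" and "\<epsilon> > 0" for v \<epsilon>
  proof -
    obtain \<delta> J where \<delta>: "\<delta> > 0" and J: "finite J" "J \<subseteq> I"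
      and *: "\<And>v w. \<lbrakk>v \<in> PiE I (\<lambda>_. M); w \<in> PiE I (\<lambda>_. M); \<forall>i\<in>J. d (v i) (w i) < \<delta>\<rbrakk>
                \<Longrightarrow> \<bar>f v - f w\<bar> \<le> \<epsilon> / 2"
      using assms[of "\<epsilon> / 2"] \<open>\<epsilon> > 0\<close> by (metis half_gt_zero)
    have vM: "v \<in> PiE I (\<lambda>_. M)"
      using v by simp
    define U where "U = PiE I (\<lambda>i. if i \<in> J then mball (v i) \<delta> else M)"
    have "finite {i \<in> I. (if i \<in> J then mball (v i) \<delta> else M) \<noteq> M}"
      by (rule finite_subset[OF _ J(1)]) auto
    then have "openin (product_topology (\<lambda>_. mtopology) I) U"
      unfolding U_def openin_PiE_gen by auto
    moreover have "v \<in> U"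
      using vM \<delta> by (auto simp: U_def PiE_iff)
    moreover have "f w \<in> Met_TC.mball (f v) \<epsilon>" if "w \<in> U" for w
    proof -
      have "w i \<in> M" if "i \<in> I" for i
        using \<open>w \<in> U\<close> that by (auto simp: U_def PiE_iff split: if_splits)
      then have "w \<in> PiE I (\<lambda>_. M)"
        using \<open>w \<in> U\<close> by (auto simp: U_def PiE_iff)
      moreover have "\<forall>i\<in>J. d (v i) (w i) < \<delta>"
      proof
        fix i assume "i \<in> J"
        then have "w i \<in> (if i \<in> J then mball (v i) \<delta> else M)"
          using \<open>w \<in> U\<close> J(2) unfolding U_def by blast
        then show "d (v i) (w i) < \<delta>"
          using \<open>i \<in> J\<close> by simp
      qed
      ultimately have "\<bar>f v - f w\<bar> \<le> \<epsilon> / 2"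
        using * vM by blast
      then show ?thesis
        using \<open>\<epsilon> > 0\<close> by (simp add: dist_real_def)
    qed
    ultimately show ?thesis by blast
  qed
  then have "continuous_map (product_topology (\<lambda>_. mtopology) I) Met_TC.mtopology f"
    unfolding Met_TC.continuous_map_to_metric by blast
  then show ?thesis by simp
qed

text \<open>If \<open>h\<close> were missed, it would have distance at least \<open>r > 0\<close> from the compact image; then the iterates
  of \<open>h\<close> would be pairwise \<open>r\<close>-separated, which total boundedness excludes.\<close>

lemma (in Metric_space) isometry_of_compact_onto:
  assumes K: "compactin mtopology K" and f: "f ` K \<subseteq> K"
    and isom: "\<And>x y. \<lbrakk>x \<in> K; y \<in> K\<rbrakk> \<Longrightarrow> d (f x) (f y) = d x y"
  shows "f ` K = K"
proof (rule ccontr)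
  assume "f ` K \<noteq> K"
  then obtain h where h: "h \<in> K" "h \<notin> f ` K"
    using f by blast
  have KM: "K \<subseteq> M"
    using K compactin_subset_topspace by fastforce
  have "continuous_map (subtopology mtopology K) mtopology f"
    unfolding continuous_map_to_metric
  proof (intro ballI allI impI)
    fix x \<epsilon> assume x: "x \<in> topspace (subtopology mtopology K)" and "(0::real) < \<epsilon>"
    have "openin (subtopology mtopology K) (K \<inter> mball x \<epsilon>)"
      by (simp add: openin_subtopology_Int2)
    moreover have "x \<in> K \<inter> mball x \<epsilon>" "\<forall>y\<in>K \<inter> mball x \<epsilon>. f y \<in> mball (f x) \<epsilon>"
      using x \<open>0 < \<epsilon>\<close> f KM isom by auto
    ultimately show "\<exists>U. openin (subtopology mtopology K) U \<and> x \<in> U \<and> (\<forall>y\<in>U. f y \<in> mball (f x) \<epsilon>)"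
      by blast
  qed
  then have "compactin mtopology (f ` K)"
    using K by (metis compactin_subtopology image_compactin order_refl)
  then have "closedin mtopology (f ` K)"
    using Hausdorff_space_mtopology compactin_imp_closedin by blast
  then obtain r where r: "r > 0" "disjnt (f ` K) (mball h r)"
    using h KM unfolding closedin_metric by blast
  have sep: "d h y \<ge> r" if "y \<in> f ` K" for y
  proof -
    have "y \<notin> mball h r"
      using r(2) that by (auto simp: disjnt_iff)
    then show ?thesis
      using that f KM h(1) by (auto simp: subset_iff)
  qed
  define s where "s n = (f ^^ n) h" for n
  have sK: "s n \<in> K" for n
    by (induction n) (use h f in \<open>auto simp: s_def\<close>)
  \<comment> \<open>Every iteration is an isometry, so differences of indices determine distances.\<close>
  have shift: "d (s m) (s (m + n)) = d h (s n)" for m n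
    by (induction m) (use isom sK in \<open>auto simp: s_def\<close>)
  have far: "d (s m) (s n) \<ge> r" if "m < n" for m n
  proof -
    define k where "k = n - Suc m"
    have k: "n = m + Suc k"
      using that by (simp add: k_def)
    have "s (Suc k) \<in> f ` K"
      using sK[of k] by (auto simp: s_def)
    then show ?thesis
      using sep shift[of m "Suc k"] k by simp
  qed
  obtain C where C: "finite C" "C \<subseteq> K" "K \<subseteq> (\<Union>x\<in>C. mball x (r / 2))"
    using compactin_imp_mtotally_bounded[OF K, unfolded mtotally_bounded_def, rule_format, OF half_gt_zero[OF r(1)]]
    by (elim exE conjE)
  have "\<exists>c. c \<in> C \<and> s n \<in> mball c (r / 2)" for n
    using C(3) sK[of n] by blast
  then obtain c where c: "\<And>n. c n \<in> C \<and> s n \<in> mball (c n) (r / 2)"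
    by metis
  have "finite (range c)"
    by (rule finite_subset[OF _ C(1)]) (use c in auto)
  then have "\<not> inj c"
    using finite_imageD infinite_UNIV_nat by blast
  then obtain m n where mn: "m < n" "c m = c n"
    unfolding inj_def by (metis linorder_neqE_nat)
  have "d (s m) (s n) \<le> d (c m) (s m) + d (c m) (s n)"
    using triangle''[of "s m" "c m" "s n"] c sK KM C(2) by blast
  then show False
    using far[OF mn(1)] c[of m] c[of n] mn(2) by simp
qed

section \<open>Groups whose metric sees the cosets of a compact normal subgroup\<close>

text \<open>The properties of \<open>d\<^sup>*\<close> on which the argument rests: it is bi-invariant, the relation of being at
  distance at most \<open>1/2\<close> is the coset relation of \<open>H\<close>, and the cosets are compact. Consequently the coset
  relation is definable, automorphisms act on cosets, and the finitely many orbits on tuples of cosets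
  make tuples of \<open>G\<close> compact up to automorphisms.\<close>

locale coset_metric_group = bounded_metric_group +
  fixes H :: "'a set"
  assumes left_invariant: "\<lbrakk>g \<in> carrier G; x \<in> carrier G; y \<in> carrier G\<rbrakk> \<Longrightarrow> D (g \<otimes> x) (g \<otimes> y) = D x y"
    and right_invariant: "\<lbrakk>g \<in> carrier G; x \<in> carrier G; y \<in> carrier G\<rbrakk> \<Longrightarrow> D (x \<otimes> g) (y \<otimes> g) = D x y"
    and normal: "H \<lhd> G"
    and near_iff: "\<lbrakk>x \<in> carrier G; y \<in> carrier G\<rbrakk> \<Longrightarrow> D x y \<le> 1 / 2 \<longleftrightarrow> H #> x = H #> y"
    and compact_H: "compactin mtopology H"
    and countable_cosets: "countable (carrier (G Mod H))"
    and oligo: "oligomorphic (isometric_automorphisms G D) (carrier (G Mod H)) (`)"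
begin

abbreviation \<Omega> :: "'a set set" where "\<Omega> \<equiv> carrier (G Mod H)"
abbreviation cl :: "'a \<Rightarrow> 'a set" where "cl x \<equiv> H #> x"
abbreviation Aut :: "('a \<Rightarrow> 'a) set" where "Aut \<equiv> carrier (isometric_automorphisms G D)"

lemma subgroup_H: "subgroup H G"
  using normal normal_imp_subgroup by blast

lemma \<Omega>_eq: "\<Omega> = cl ` carrier G"
  by (auto simp: FactGroup_def RCOSETS_def)

lemma cl_in: "x \<in> carrier G \<Longrightarrow> cl x \<in> \<Omega>"
  by (simp add: \<Omega>_eq)

lemma in_cl_iff: "x \<in> carrier G \<Longrightarrow> y \<in> cl x \<longleftrightarrow> y \<in> carrier G \<and> cl y = cl x"
  using subgroup_H rcos_self repr_independence r_coset_subset_G subgroup.subset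
  by (metis subsetD)

lemma Aut_iff: "\<alpha> \<in> Aut \<longleftrightarrow> \<alpha> \<in> hom G G \<and> \<alpha> \<in> extensional (carrier G) \<and>
    bij_betw \<alpha> (carrier G) (carrier G) \<and> (\<forall>x\<in>carrier G. \<forall>y\<in>carrier G. D (\<alpha> x) (\<alpha> y) = D x y)"
  by (auto simp: isometric_automorphisms_def auto_def Bij_def)

lemma Aut_closed: "\<alpha> \<in> Aut \<Longrightarrow> x \<in> carrier G \<Longrightarrow> \<alpha> x \<in> carrier G"
  by (auto simp: Aut_iff hom_def)

lemma Aut_id: "(\<lambda>x\<in>carrier G. x) \<in> Aut"
  by (auto simp: Aut_iff hom_def bij_betw_def inj_on_def)

lemma Aut_cl: "\<alpha> \<in> Aut \<Longrightarrow> x \<in> carrier G \<Longrightarrow> \<alpha> ` cl x = cl (\<alpha> x)"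
proof -
  assume a: "\<alpha> \<in> Aut" and x: "x \<in> carrier G"
  have surj: "\<alpha> ` carrier G = carrier G"
    using a by (auto simp: Aut_iff bij_betw_def)
  have iff: "cl (\<alpha> y) = cl (\<alpha> x) \<longleftrightarrow> cl y = cl x" if "y \<in> carrier G" for y
    using near_iff[of y x] near_iff[of "\<alpha> y" "\<alpha> x"] a x that Aut_closed by (simp add: Aut_iff)
  show ?thesis
  proof (intro equalityI subsetI)
    fix z assume "z \<in> \<alpha> ` cl x"
    then obtain y where "z = \<alpha> y" "y \<in> cl x" by auto
    then show "z \<in> cl (\<alpha> x)"
      using iff a x by (simp add: in_cl_iff Aut_closed)
  next
    fix z assume z: "z \<in> cl (\<alpha> x)"
    then have "z \<in> carrier G"
      using a x by (simp add: in_cl_iff Aut_closed)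
    then obtain y where "z = \<alpha> y" "y \<in> carrier G"
      using surj by (metis imageE)
    then show "z \<in> \<alpha> ` cl x"
      using z iff a x by (simp add: in_cl_iff Aut_closed)
  qed
qed

lemma Aut_\<Omega>: "\<alpha> \<in> Aut \<Longrightarrow> C \<in> \<Omega> \<Longrightarrow> \<alpha> ` C \<in> \<Omega>"
  by (auto simp: \<Omega>_eq Aut_cl Aut_closed)

lemma Aut_val: "\<alpha> \<in> Aut \<Longrightarrow> v \<in> assignments \<Longrightarrow> val (\<alpha> \<circ> v) \<phi> = val v \<phi>"
  by (rule formula_value_iso) (auto simp: Aut_iff iso_def bounded_metric_group_axioms is_group)

lemma assignment_Aut: "\<alpha> \<in> Aut \<Longrightarrow> v \<in> assignments \<Longrightarrow> \<alpha> \<circ> v \<in> assignments"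
  by (simp add: Pi_iff Aut_closed)

lemma compact_cl:
  assumes "x \<in> carrier G"
  shows "compactin mtopology (cl x)"
proof -
  have "continuous_map mtopology mtopology (\<lambda>y. y \<otimes> x)"
    unfolding continuous_map_to_metric
  proof (intro ballI allI impI)
    fix y \<epsilon> assume "y \<in> topspace mtopology" "(0::real) < \<epsilon>"
    then show "\<exists>U. openin mtopology U \<and> y \<in> U \<and> (\<forall>z\<in>U. z \<otimes> x \<in> mball (y \<otimes> x) \<epsilon>)"
      using assms by (intro exI[of _ "mball y \<epsilon>"]) (auto simp: right_invariant)
  qed
  then have "compactin mtopology ((\<lambda>y. y \<otimes> x) ` H)"
    using compact_H image_compactin by blast
  moreover have "(\<lambda>y. y \<otimes> x) ` H = cl x"
    by (auto simp: r_coset_def)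
  ultimately show ?thesis by simp
qed

subsection \<open>Formulas are uniformly continuous\<close>

lemma dist_mult_le:
  assumes "x \<in> carrier G" "y \<in> carrier G" "x' \<in> carrier G" "y' \<in> carrier G"
  shows "D (x \<otimes> y) (x' \<otimes> y') \<le> D x x' + D y y'"
  using triangle[of "x \<otimes> y" "x' \<otimes> y" "x' \<otimes> y'"] assms by (simp add: left_invariant right_invariant)

lemma dist_inv: "\<lbrakk>x \<in> carrier G; y \<in> carrier G\<rbrakk> \<Longrightarrow> D (inv x) (inv y) = D x y"
  using bi_invariant_inv[of D x y] left_invariant right_invariant commute by metis

lemma dist_diff_le:
  assumes "x \<in> carrier G" "y \<in> carrier G" "x' \<in> carrier G" "y' \<in> carrier G"
  shows "\<bar>D x y - D x' y'\<bar> \<le> D x x' + D y y'"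
  using triangle[of x x' y] triangle[of x' y' y] triangle[of x' x y'] triangle[of x y y'] assms
  by (simp add: commute abs_le_iff)

lemma term_uniformly_continuous:
  "\<epsilon> > 0 \<Longrightarrow> \<exists>\<delta>>0. \<forall>v\<in>assignments. \<forall>w\<in>assignments.
     (\<forall>i\<in>term_vars t. D (v i) (w i) < \<delta>) \<longrightarrow> D (term_value G v t) (term_value G w t) \<le> \<epsilon>"
proof (induction t arbitrary: \<epsilon>)
  case (Var n)
  then show ?case by (auto intro!: exI[of _ \<epsilon>])
next
  case (Inv t)
  then show ?case by (auto simp: dist_inv term_value_closed)
next
  case (Mult s t)
  obtain \<delta>1 where 1: "\<delta>1 > 0" "\<And>v w. \<lbrakk>v \<in> assignments; w \<in> assignments; \<forall>i\<in>term_vars s. D (v i) (w i) < \<delta>1\<rbrakk>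
      \<Longrightarrow> D (term_value G v s) (term_value G w s) \<le> \<epsilon> / 2"
    using Mult.IH(1)[of "\<epsilon> / 2"] Mult.prems by (metis half_gt_zero)
  obtain \<delta>2 where 2: "\<delta>2 > 0" "\<And>v w. \<lbrakk>v \<in> assignments; w \<in> assignments; \<forall>i\<in>term_vars t. D (v i) (w i) < \<delta>2\<rbrakk>
      \<Longrightarrow> D (term_value G v t) (term_value G w t) \<le> \<epsilon> / 2"
    using Mult.IH(2)[of "\<epsilon> / 2"] Mult.prems by (metis half_gt_zero)
  have "D (term_value G v (Mult s t)) (term_value G w (Mult s t)) \<le> \<epsilon>"
    if vw: "v \<in> assignments" "w \<in> assignments" "\<forall>i\<in>term_vars (Mult s t). D (v i) (w i) < min \<delta>1 \<delta>2" for v w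
  proof -
    have "D (term_value G v s) (term_value G w s) \<le> \<epsilon> / 2" "D (term_value G v t) (term_value G w t) \<le> \<epsilon> / 2"
      using vw by (simp_all add: 1(2) 2(2) del: le_divide_eq_numeral1)
    then show ?thesis
      using dist_mult_le[of "term_value G v s" "term_value G v t" "term_value G w s" "term_value G w t"]
        term_value_closed vw by simp
  qed
  then show ?case
    using 1(1) 2(1) by (intro exI[of _ "min \<delta>1 \<delta>2"]) auto
qed

definition ucont :: "metric_formula \<Rightarrow> bool" where
  "ucont \<phi> \<longleftrightarrow> (\<forall>\<epsilon>>0. \<exists>\<delta>>0. \<forall>v\<in>assignments. \<forall>w\<in>assignments.
     (\<forall>i\<in>free_vars \<phi>. D (v i) (w i) < \<delta>) \<longrightarrow> \<bar>val v \<phi> - val w \<phi>\<bar> \<le> \<epsilon>)"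

lemma ucontE:
  assumes "ucont \<phi>" "\<epsilon> > 0"
  obtains \<delta> where "\<delta> > 0" "\<And>v w. \<lbrakk>v \<in> assignments; w \<in> assignments; \<And>i. i \<in> free_vars \<phi> \<Longrightarrow> D (v i) (w i) < \<delta>\<rbrakk>
      \<Longrightarrow> \<bar>val v \<phi> - val w \<phi>\<bar> \<le> \<epsilon>"
  using assms unfolding ucont_def by meson

lemma ucontI:
  assumes "\<And>\<epsilon>. \<epsilon> > 0 \<Longrightarrow> \<exists>\<delta>>0. \<forall>v\<in>assignments. \<forall>w\<in>assignments.
     (\<forall>i\<in>free_vars \<phi>. D (v i) (w i) < \<delta>) \<longrightarrow> val v \<phi> \<le> val w \<phi> + \<epsilon>"
  shows "ucont \<phi>"
  unfolding ucont_def
proof (intro allI impI)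
  fix \<epsilon> :: real assume "\<epsilon> > 0"
  from assms[OF this] obtain \<delta> where \<delta>: "\<delta> > 0" "\<forall>v\<in>assignments. \<forall>w\<in>assignments.
     (\<forall>i\<in>free_vars \<phi>. D (v i) (w i) < \<delta>) \<longrightarrow> val v \<phi> \<le> val w \<phi> + \<epsilon>"
    by (elim exE conjE)
  have "\<bar>val v \<phi> - val w \<phi>\<bar> \<le> \<epsilon>"
    if vw: "v \<in> assignments" "w \<in> assignments" "\<forall>i\<in>free_vars \<phi>. D (v i) (w i) < \<delta>" for v w
  proof -
    have "\<forall>i\<in>free_vars \<phi>. D (w i) (v i) < \<delta>"
      using vw(3) by (simp add: commute)
    then show ?thesis
      using \<delta>(2)[rule_format, OF vw(1,2)] \<delta>(2)[rule_format, OF vw(2,1)] vw(3) by fastforce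
  qed
  then show "\<exists>\<delta>>0. \<forall>v\<in>assignments. \<forall>w\<in>assignments.
     (\<forall>i\<in>free_vars \<phi>. D (v i) (w i) < \<delta>) \<longrightarrow> \<bar>val v \<phi> - val w \<phi>\<bar> \<le> \<epsilon>"
    using \<delta>(1) by blast
qed

lemma ucont_binary:
  assumes \<phi>: "ucont \<phi>" and \<psi>: "ucont \<psi>" and fv: "free_vars \<theta> = free_vars \<phi> \<union> free_vars \<psi>"
    and le: "\<And>v w. \<lbrakk>v \<in> assignments; w \<in> assignments\<rbrakk> \<Longrightarrow>
           \<bar>val v \<theta> - val w \<theta>\<bar> \<le> \<bar>val v \<phi> - val w \<phi>\<bar> + \<bar>val v \<psi> - val w \<psi>\<bar>"
  shows "ucont \<theta>"
proof (rule ucontI)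
  fix \<epsilon> :: real assume "\<epsilon> > 0"
  then have e: "\<epsilon> / 2 > 0" by simp
  obtain \<delta>1 where 1: "\<delta>1 > 0" "\<And>v w. \<lbrakk>v \<in> assignments; w \<in> assignments; \<And>i. i \<in> free_vars \<phi> \<Longrightarrow> D (v i) (w i) < \<delta>1\<rbrakk>
      \<Longrightarrow> \<bar>val v \<phi> - val w \<phi>\<bar> \<le> \<epsilon> / 2"
    using ucontE[OF \<phi> e] by blast
  obtain \<delta>2 where 2: "\<delta>2 > 0" "\<And>v w. \<lbrakk>v \<in> assignments; w \<in> assignments; \<And>i. i \<in> free_vars \<psi> \<Longrightarrow> D (v i) (w i) < \<delta>2\<rbrakk>
      \<Longrightarrow> \<bar>val v \<psi> - val w \<psi>\<bar> \<le> \<epsilon> / 2"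
    using ucontE[OF \<psi> e] by blast
  show "\<exists>\<delta>>0. \<forall>v\<in>assignments. \<forall>w\<in>assignments.
     (\<forall>i\<in>free_vars \<theta>. D (v i) (w i) < \<delta>) \<longrightarrow> val v \<theta> \<le> val w \<theta> + \<epsilon>"
  proof (intro exI[of _ "min \<delta>1 \<delta>2"] conjI ballI impI)
    fix v w assume vw: "v \<in> assignments" "w \<in> assignments" "\<forall>i\<in>free_vars \<theta>. D (v i) (w i) < min \<delta>1 \<delta>2"
    have "\<bar>val v \<phi> - val w \<phi>\<bar> \<le> \<epsilon> / 2"
      by (rule 1(2)) (use vw fv in auto)
    moreover have "\<bar>val v \<psi> - val w \<psi>\<bar> \<le> \<epsilon> / 2"
      by (rule 2(2)) (use vw fv in auto)
    ultimately show "val v \<theta> \<le> val w \<theta> + \<epsilon>"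
      using le[OF vw(1,2)] by linarith
  qed (use 1(1) 2(1) in simp)
qed

text \<open>Handles the connective \<open>\<surd>\<close>, which is uniformly continuous without being Lipschitz.\<close>

lemma sqrt_diff_le: "0 \<le> (a::real) \<Longrightarrow> 0 \<le> b \<Longrightarrow> sqrt a \<le> sqrt b + sqrt \<bar>a - b\<bar>"
proof -
  assume ab: "0 \<le> a" "0 \<le> b"
  have "sqrt a \<le> sqrt (b + \<bar>a - b\<bar>)" by simp
  also have "\<dots> \<le> sqrt b + sqrt \<bar>a - b\<bar>" using ab by (intro sqrt_add_le_add_sqrt) auto
  finally show ?thesis .
qed

lemma formula_ucont: "ucont \<phi>"
proof (induction \<phi>)
  case (Dist s t)
  show ?case
  proof (rule ucontI)
    fix \<epsilon> :: real assume "\<epsilon> > 0"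
    then have e: "\<epsilon> / 2 > 0" by simp
    obtain \<delta>1 where 1: "\<delta>1 > 0" "\<And>v w. \<lbrakk>v \<in> assignments; w \<in> assignments; \<forall>i\<in>term_vars s. D (v i) (w i) < \<delta>1\<rbrakk>
        \<Longrightarrow> D (term_value G v s) (term_value G w s) \<le> \<epsilon> / 2"
      using term_uniformly_continuous[OF e, of s] by metis
    obtain \<delta>2 where 2: "\<delta>2 > 0" "\<And>v w. \<lbrakk>v \<in> assignments; w \<in> assignments; \<forall>i\<in>term_vars t. D (v i) (w i) < \<delta>2\<rbrakk>
        \<Longrightarrow> D (term_value G v t) (term_value G w t) \<le> \<epsilon> / 2"
      using term_uniformly_continuous[OF e, of t] by metis
    show "\<exists>\<delta>>0. \<forall>v\<in>assignments. \<forall>w\<in>assignments. (\<forall>i\<in>free_vars (Dist s t). D (v i) (w i) < \<delta>) \<longrightarrow>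
        val v (Dist s t) \<le> val w (Dist s t) + \<epsilon>"
    proof (intro exI[of _ "min \<delta>1 \<delta>2"] conjI ballI impI)
      fix v w assume vw: "v \<in> assignments" "w \<in> assignments"
        "\<forall>i\<in>free_vars (Dist s t). D (v i) (w i) < min \<delta>1 \<delta>2"
      have "D (term_value G v s) (term_value G w s) \<le> \<epsilon> / 2" "D (term_value G v t) (term_value G w t) \<le> \<epsilon> / 2"
        using vw by (simp_all add: 1(2) 2(2) del: le_divide_eq_numeral1)
      then show "val v (Dist s t) \<le> val w (Dist s t) + \<epsilon>"
        using dist_diff_le[of "term_value G v s" "term_value G v t" "term_value G w s" "term_value G w t"]
          term_value_closed vw by simp
    qed (use 1(1) 2(1) in simp)
  qed
next
  case (Const q)
  show ?case by (auto simp: ucont_def intro: exI[of _ 1])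
next
  case (Half \<phi>)
  from this this show ?case by (rule ucont_binary) (auto simp: abs_if)
next
  case (Compl \<phi>)
  from this this show ?case by (rule ucont_binary) (simp_all add: abs_minus_commute)
next
  case (Monus \<phi> \<psi>)
  then show ?case by (rule ucont_binary) auto
next
  case (FMin \<phi> \<psi>)
  then show ?case by (rule ucont_binary) (auto simp: min_def)
next
  case (FMax \<phi> \<psi>)
  then show ?case by (rule ucont_binary) (auto simp: max_def)
next
  case (AbsDiff \<phi> \<psi>)
  then show ?case by (rule ucont_binary) auto
next
  case (TruncPlus \<phi> \<psi>)
  then show ?case by (rule ucont_binary) (auto simp: min_def)
next
  case (Times \<phi> \<psi>)
  then show ?case
  proof (rule ucont_binary)
    fix v w assume vw: "v \<in> assignments" "w \<in> assignments"
    have "val v (Times \<phi> \<psi>) - val w (Times \<phi> \<psi>) =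
        (val v \<phi> - val w \<phi>) * val v \<psi> + val w \<phi> * (val v \<psi> - val w \<psi>)"
      by (simp add: algebra_simps)
    then have "\<bar>val v (Times \<phi> \<psi>) - val w (Times \<phi> \<psi>)\<bar> \<le>
        \<bar>val v \<phi> - val w \<phi>\<bar> * \<bar>val v \<psi>\<bar> + \<bar>val w \<phi>\<bar> * \<bar>val v \<psi> - val w \<psi>\<bar>"
      by (metis abs_mult abs_triangle_ineq)
    also have "\<dots> \<le> \<bar>val v \<phi> - val w \<phi>\<bar> * 1 + 1 * \<bar>val v \<psi> - val w \<psi>\<bar>"
      by (intro add_mono mult_mono) (use val_bounds vw in auto)
    finally show "\<bar>val v (Times \<phi> \<psi>) - val w (Times \<phi> \<psi>)\<bar> \<le>
        \<bar>val v \<phi> - val w \<phi>\<bar> + \<bar>val v \<psi> - val w \<psi>\<bar>" by simp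
  qed simp
next
  case (Sqrt \<phi>)
  show ?case
  proof (rule ucontI)
    fix \<epsilon> :: real assume "\<epsilon> > 0"
    then have e: "\<epsilon>\<^sup>2 > 0" by simp
    obtain \<delta> where \<delta>: "\<delta> > 0" "\<And>v w. \<lbrakk>v \<in> assignments; w \<in> assignments; \<And>i. i \<in> free_vars \<phi> \<Longrightarrow> D (v i) (w i) < \<delta>\<rbrakk>
      \<Longrightarrow> \<bar>val v \<phi> - val w \<phi>\<bar> \<le> \<epsilon>\<^sup>2"
      using ucontE[OF Sqrt.IH e] by blast
    show "\<exists>\<delta>>0. \<forall>v\<in>assignments. \<forall>w\<in>assignments. (\<forall>i\<in>free_vars (Sqrt \<phi>). D (v i) (w i) < \<delta>) \<longrightarrow>
        val v (Sqrt \<phi>) \<le> val w (Sqrt \<phi>) + \<epsilon>"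
    proof (intro exI[of _ \<delta>] conjI ballI impI)
      fix v w assume vw: "v \<in> assignments" "w \<in> assignments" "\<forall>i\<in>free_vars (Sqrt \<phi>). D (v i) (w i) < \<delta>"
      have "sqrt \<bar>val v \<phi> - val w \<phi>\<bar> \<le> sqrt (\<epsilon>\<^sup>2)"
        unfolding real_sqrt_le_iff by (rule \<delta>(2)) (use vw in auto)
      then show "val v (Sqrt \<phi>) \<le> val w (Sqrt \<phi>) + \<epsilon>"
        using sqrt_diff_le[OF val_nonneg[OF vw(1)] val_nonneg[OF vw(2)], of \<phi> \<phi>] \<open>\<epsilon> > 0\<close> by simp
    qed (fact \<delta>(1))
  qed
next
  case (FSup n \<phi>)
  show ?case
  proof (rule ucontI)
    fix \<epsilon> :: real assume e: "\<epsilon> > 0"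
    obtain \<delta> where \<delta>: "\<delta> > 0" "\<And>v w. \<lbrakk>v \<in> assignments; w \<in> assignments; \<And>i. i \<in> free_vars \<phi> \<Longrightarrow> D (v i) (w i) < \<delta>\<rbrakk>
      \<Longrightarrow> \<bar>val v \<phi> - val w \<phi>\<bar> \<le> \<epsilon>"
      using ucontE[OF FSup.IH e] by blast
    show "\<exists>\<delta>>0. \<forall>v\<in>assignments. \<forall>w\<in>assignments. (\<forall>i\<in>free_vars (FSup n \<phi>). D (v i) (w i) < \<delta>) \<longrightarrow>
        val v (FSup n \<phi>) \<le> val w (FSup n \<phi>) + \<epsilon>"
    proof (intro exI[of _ \<delta>] conjI ballI impI)
      fix v w assume vw: "v \<in> assignments" "w \<in> assignments" "\<forall>i\<in>free_vars (FSup n \<phi>). D (v i) (w i) < \<delta>"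
      have close: "\<bar>val (v(n := a)) \<phi> - val (w(n := a)) \<phi>\<bar> \<le> \<epsilon>" if a: "a \<in> carrier G" for a
        by (rule \<delta>(2)) (use vw a \<delta>(1) in auto)
      have "val (v(n := a)) \<phi> \<le> val w (FSup n \<phi>) + \<epsilon>" if a: "a \<in> carrier G" for a
        using close[OF a] val_FSup_ge[OF vw(2) a, of n \<phi>] by linarith
      then show "val v (FSup n \<phi>) \<le> val w (FSup n \<phi>) + \<epsilon>"
        unfolding formula_value.simps(12)[of G D v] by (intro cSUP_least) auto
    qed (fact \<delta>(1))
  qed
next
  case (FInf n \<phi>)
  show ?case
  proof (rule ucontI)
    fix \<epsilon> :: real assume e: "\<epsilon> > 0"
    obtain \<delta> where \<delta>: "\<delta> > 0" "\<And>v w. \<lbrakk>v \<in> assignments; w \<in> assignments; \<And>i. i \<in> free_vars \<phi> \<Longrightarrow> D (v i) (w i) < \<delta>\<rbrakk>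
      \<Longrightarrow> \<bar>val v \<phi> - val w \<phi>\<bar> \<le> \<epsilon>"
      using ucontE[OF FInf.IH e] by blast
    show "\<exists>\<delta>>0. \<forall>v\<in>assignments. \<forall>w\<in>assignments. (\<forall>i\<in>free_vars (FInf n \<phi>). D (v i) (w i) < \<delta>) \<longrightarrow>
        val v (FInf n \<phi>) \<le> val w (FInf n \<phi>) + \<epsilon>"
    proof (intro exI[of _ \<delta>] conjI ballI impI)
      fix v w assume vw: "v \<in> assignments" "w \<in> assignments" "\<forall>i\<in>free_vars (FInf n \<phi>). D (v i) (w i) < \<delta>"
      have close: "\<bar>val (v(n := a)) \<phi> - val (w(n := a)) \<phi>\<bar> \<le> \<epsilon>" if a: "a \<in> carrier G" for a
        by (rule \<delta>(2)) (use vw a \<delta>(1) in auto)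
      have "val v (FInf n \<phi>) - \<epsilon> \<le> val (w(n := a)) \<phi>" if a: "a \<in> carrier G" for a
        using close[OF a] val_FInf_le[OF vw(1) a, of n \<phi>] by linarith
      then have "val v (FInf n \<phi>) - \<epsilon> \<le> val w (FInf n \<phi>)"
        unfolding formula_value.simps(13)[of G D w] by (intro cINF_greatest) auto
      then show "val v (FInf n \<phi>) \<le> val w (FInf n \<phi>) + \<epsilon>" by simp
    qed (fact \<delta>(1))
  qed
qed

lemma continuous_val: "continuous_map (product_topology (\<lambda>_. mtopology) UNIV) euclideanreal (\<lambda>v. val v \<phi>)"
proof (rule continuous_map_product_uniform)
  fix \<epsilon> :: real assume e: "\<epsilon> > 0"
  obtain \<delta> where \<delta>: "\<delta> > 0" "\<And>v w. \<lbrakk>v \<in> assignments; w \<in> assignments; \<And>i. i \<in> free_vars \<phi> \<Longrightarrow> D (v i) (w i) < \<delta>\<rbrakk>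
      \<Longrightarrow> \<bar>val v \<phi> - val w \<phi>\<bar> \<le> \<epsilon>"
    using ucontE[OF formula_ucont e] by blast
  then show "\<exists>\<delta>>0. \<exists>J. finite J \<and> J \<subseteq> UNIV \<and> (\<forall>v\<in>PiE UNIV (\<lambda>_. carrier G). \<forall>w\<in>PiE UNIV (\<lambda>_. carrier G).
      (\<forall>i\<in>J. D (v i) (w i) < \<delta>) \<longrightarrow> \<bar>val v \<phi> - val w \<phi>\<bar> \<le> \<epsilon>)"
    by (intro exI[of _ \<delta>] conjI exI[of _ "free_vars \<phi>"])
       (auto simp: finite_free_vars PiE_UNIV_domain)
qed


section \<open>Exact solutions from approximate ones\<close>

text \<open>Choosing one tuple per orbit, but only among the orbits that meet \<open>C\<close>, keeps the representatives in
  \<open>C\<close> even when \<open>C\<close> is not invariant. Sequences are used in place of tuples, with only the first \<open>N\<close>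
  entries being controlled.\<close>

lemma finite_orbit_representatives:
  fixes N :: nat
  assumes C: "C \<subseteq> UNIV \<rightarrow> \<Omega>"
  shows "\<exists>U. finite U \<and> U \<subseteq> C \<and> (\<forall>u\<in>C. \<exists>y\<in>U. \<exists>\<alpha>\<in>Aut. \<forall>i<N. \<alpha> ` u i = y i)"
proof -
  let ?A = "isometric_automorphisms G D"
  define orb where "orb u = orbit ?A (\<lambda>g. map ((`) g)) (map u [0..<N])" for u :: "nat \<Rightarrow> 'a set"
  have tup: "map u [0..<N] \<in> tuples N \<Omega>" if "u \<in> C" for u
    using that C by (auto simp: tuples_def)
  have "finite (orbits ?A (tuples N \<Omega>) (\<lambda>g. map ((`) g)))"
  proof (cases "N = 0")
    case True
    then have "tuples N \<Omega> = {[]}" by (auto simp: tuples_def)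
    then show ?thesis by (simp add: orbits_def)
  next
    case False
    then show ?thesis using oligo by (simp add: oligomorphic_def)
  qed
  moreover have "orb ` C \<subseteq> orbits ?A (tuples N \<Omega>) (\<lambda>g. map ((`) g))"
    using tup by (auto simp: orbits_def orb_def)
  ultimately have "finite (orb ` C)"
    using finite_subset by blast
  then obtain U where U: "U \<subseteq> C" "finite U" "orb ` C = orb ` U"
    using finite_subset_image[of "orb ` C" orb C] by blast
  have "\<exists>y\<in>U. \<exists>\<alpha>\<in>Aut. \<forall>i<N. \<alpha> ` u i = y i" if u: "u \<in> C" for u
  proof -
    have "orb u \<in> orb ` U" using u U(3) by blast
    then obtain y where y: "y \<in> U" "orb u = orb y" by auto
    define idG where "idG = (\<lambda>x\<in>carrier G. x)"
    have id_y: "idG ` y i = y i" for i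
    proof -
      have "y i \<in> \<Omega>" using y(1) U(1) C by auto
      then have "y i \<subseteq> carrier G" by (auto simp: \<Omega>_eq in_cl_iff)
      then show ?thesis by (auto simp: idG_def image_iff subset_iff)
    qed
    have "map y [0..<N] = map ((`) idG) (map y [0..<N])"
      using id_y by simp
    moreover have "idG \<in> Aut" using Aut_id by (simp add: idG_def)
    ultimately have "map y [0..<N] \<in> orb y"
      unfolding orb_def orbit_def by blast
    then have "map y [0..<N] \<in> orb u" using y(2) by simp
    then obtain \<alpha> where \<alpha>: "\<alpha> \<in> Aut" "map y [0..<N] = map ((`) \<alpha>) (map u [0..<N])"
      by (auto simp: orb_def orbit_def)
    have "\<alpha> ` u i = y i" if "i < N" for i
    proof -
      have "map y [0..<N] ! i = map ((`) \<alpha>) (map u [0..<N]) ! i"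
        by (rule arg_cong[OF \<alpha>(2)])
      then show ?thesis using that by simp
    qed
    then show ?thesis using y(1) \<alpha>(1) by blast
  qed
  then show ?thesis using U by blast
qed

text \<open>An approximate solution \<open>v\<close> can be moved by an automorphism, without changing the value of any formula,
  into one of finitely many products of cosets. These products are compact, so approximate solutions
  yield an exact one. The price is that the solution satisfies \<open>C\<close> only up to cosets: it lies in the
  cosets of some \<open>u\<close> with \<open>C u\<close>.\<close>

lemma saturation:
  fixes r :: "metric_formula \<Rightarrow> real" and C :: "(nat \<Rightarrow> 'a) \<Rightarrow> bool"
  assumes fv: "\<And>\<phi>. \<phi> \<in> \<Gamma> \<Longrightarrow> free_vars \<phi> \<subseteq> {..<N}"
    and approx: "\<And>\<Delta> \<epsilon>. \<lbrakk>finite \<Delta>; \<Delta> \<subseteq> \<Gamma>; \<epsilon> > 0\<rbrakk> \<Longrightarrow>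
          \<exists>v\<in>assignments. C v \<and> (\<forall>\<phi>\<in>\<Delta>. \<bar>val v \<phi> - r \<phi>\<bar> \<le> \<epsilon>)"
  shows "\<exists>w\<in>assignments. \<exists>u\<in>assignments. C u \<and> (\<forall>i<N. cl (w i) = cl (u i)) \<and> (\<forall>\<phi>\<in>\<Gamma>. val w \<phi> = r \<phi>)"
proof -
  define \<C> where "\<C> = (\<lambda>v. cl \<circ> v) ` {v \<in> assignments. C v}"
  have C\<Omega>: "\<C> \<subseteq> UNIV \<rightarrow> \<Omega>"
    by (auto simp: \<C>_def Pi_iff cl_in)
  obtain U where U: "finite U" "U \<subseteq> \<C>" and rep: "\<forall>u\<in>\<C>. \<exists>y\<in>U. \<exists>\<alpha>\<in>Aut. \<forall>i<N. \<alpha> ` u i = y i"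
    using finite_orbit_representatives[OF C\<Omega>, of N] by (elim exE conjE)
  \<comment> \<open>Coordinates from \<open>N\<close> on do not affect the formulas and are set to the neutral element, which keeps the product compact.\<close>
  define K where "K y = PiE UNIV (\<lambda>i. if i < N then y i else {\<one>})" for y :: "nat \<Rightarrow> 'a set"
  have yK: "compactin mtopology (if i < N then y i else {\<one>})" if "y \<in> U" for y i
  proof -
    have "y i \<in> \<Omega>" using that U(2) C\<Omega> by auto
    then show ?thesis by (auto simp: \<Omega>_eq compact_cl)
  qed
  have K: "compactin (product_topology (\<lambda>_. mtopology) UNIV) (K y)" if "y \<in> U" for y
    unfolding K_def compactin_PiE using yK[OF that] by blast
  have "\<exists>y\<in>U. \<exists>w\<in>K y. \<forall>\<phi>\<in>\<Gamma>. val w \<phi> = r \<phi>"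
  proof (rule ccontr)
    assume neg: "\<not> (\<exists>y\<in>U. \<exists>w\<in>K y. \<forall>\<phi>\<in>\<Gamma>. val w \<phi> = r \<phi>)"
    \<comment> \<open>If a product contains no exact solution, finitely many conditions and one \<open>\<epsilon>\<close> already exclude it.\<close>
    have "\<exists>\<Delta> \<epsilon>. finite \<Delta> \<and> \<Delta> \<subseteq> \<Gamma> \<and> \<epsilon> > 0 \<and> \<not> (\<exists>w\<in>K y. \<forall>\<phi>\<in>\<Delta>. \<bar>val w \<phi> - r \<phi>\<bar> \<le> \<epsilon>)" if y: "y \<in> U" for y
    proof (rule ccontr)
      assume neg': "\<not> ?thesis"
      define h where "h \<phi> = (\<lambda>w. val w \<phi> - r \<phi>)" for \<phi>
      have "\<exists>w\<in>K y. \<forall>f\<in>h ` \<Gamma>. f w = 0"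
      proof (rule compact_common_zero[OF K[OF y]])
        fix f assume "f \<in> h ` \<Gamma>"
        then show "continuous_map (product_topology (\<lambda>_. mtopology) UNIV) euclideanreal f"
          by (auto simp: h_def intro!: continuous_map_diff continuous_val)
      next
        fix F0 and \<epsilon> :: real assume F0: "finite F0" "F0 \<subseteq> h ` \<Gamma>" "\<epsilon> > 0"
        from finite_subset_image[OF F0(1,2)] obtain \<Delta> where "\<Delta> \<subseteq> \<Gamma>" "finite \<Delta>" "F0 = h ` \<Delta>"
          by blast
        then show "\<exists>w\<in>K y. \<forall>f\<in>F0. \<bar>f w\<bar> \<le> \<epsilon>"
          using neg' F0(3) unfolding h_def by auto
      qed
      then show False
        using neg y unfolding h_def by auto
    qed
    then obtain \<Delta> \<epsilon> where *: "\<And>y. y \<in> U \<Longrightarrow> finite (\<Delta> y) \<and> \<Delta> y \<subseteq> \<Gamma> \<and> \<epsilon> y > 0 \<and>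
        \<not> (\<exists>w\<in>K y. \<forall>\<phi>\<in>\<Delta> y. \<bar>val w \<phi> - r \<phi>\<bar> \<le> \<epsilon> y)"
      by metis
    define \<epsilon>0 where "\<epsilon>0 = Min (insert 1 (\<epsilon> ` U))"
    have \<epsilon>0: "\<epsilon>0 > 0" "\<And>y. y \<in> U \<Longrightarrow> \<epsilon>0 \<le> \<epsilon> y"
      using U(1) * by (auto simp: \<epsilon>0_def)
    have "finite (\<Union>y\<in>U. \<Delta> y)" "(\<Union>y\<in>U. \<Delta> y) \<subseteq> \<Gamma>"
      using U(1) * by auto
    from approx[OF this \<epsilon>0(1)] obtain v where v: "v \<in> assignments" "C v"
      "\<And>\<phi>. \<phi> \<in> (\<Union>y\<in>U. \<Delta> y) \<Longrightarrow> \<bar>val v \<phi> - r \<phi>\<bar> \<le> \<epsilon>0"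
      by blast
    have "cl \<circ> v \<in> \<C>" using v by (auto simp: \<C>_def)
    from bspec[OF rep this] obtain y \<alpha> where y: "y \<in> U" and \<alpha>: "\<alpha> \<in> Aut" "\<And>i. i < N \<Longrightarrow> \<alpha> ` cl (v i) = y i"
      by auto
    define w where "w i = (if i < N then \<alpha> (v i) else \<one>)" for i
    have vG: "v i \<in> carrier G" for i using v(1) by auto
    have "w i \<in> (if i < N then y i else {\<one>})" for i
      using \<alpha> Aut_cl[OF \<alpha>(1) vG[of i]] Aut_closed[OF \<alpha>(1) vG[of i]]
      by (auto simp: w_def in_cl_iff)
    then have "w \<in> K y"
      by (auto simp: K_def PiE_UNIV_domain)
    moreover have "\<bar>val w \<phi> - r \<phi>\<bar> \<le> \<epsilon> y" if \<phi>: "\<phi> \<in> \<Delta> y" for \<phi>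
    proof -
      have "\<phi> \<in> \<Gamma>" using * y \<phi> by blast
      then have "val w \<phi> = val (\<alpha> \<circ> v) \<phi>"
        using fv by (intro formula_value_cong) (auto simp: w_def)
      also have "\<dots> = val v \<phi>" by (rule Aut_val[OF \<alpha>(1) v(1)])
      finally show ?thesis
        using v(3)[of \<phi>] \<epsilon>0(2)[OF y] \<phi> y by force
    qed
    ultimately show False using * y by blast
  qed
  then obtain y w where y: "y \<in> U" and w: "w \<in> K y" "\<And>\<phi>. \<phi> \<in> \<Gamma> \<Longrightarrow> val w \<phi> = r \<phi>"
    by blast
  obtain u where u: "u \<in> assignments" "C u" "y = cl \<circ> u"
    using y U(2) by (auto simp: \<C>_def)
  have uG: "u i \<in> carrier G" for i using u(1) by auto
  have wi: "w i \<in> (if i < N then y i else {\<one>})" for i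
    using w(1) unfolding K_def PiE_UNIV_domain by (rule PiE) simp_all
  have "w i \<in> carrier G" for i
    using wi[of i] u(3) uG by (auto simp: in_cl_iff split: if_splits)
  then have "w \<in> assignments" by auto
  moreover have "cl (w i) = cl (u i)" if "i < N" for i
    using wi[of i] that u(3) uG by (auto simp: in_cl_iff)
  ultimately show ?thesis
    using u w(2) by blast
qed

section \<open>Tuples of the same type\<close>

definition same_type :: "nat \<Rightarrow> (nat \<Rightarrow> 'a) \<Rightarrow> (nat \<Rightarrow> 'a) \<Rightarrow> bool" where
  "same_type n v w \<longleftrightarrow> (\<forall>\<phi>. free_vars \<phi> \<subseteq> {..<n} \<longrightarrow> val v \<phi> = val w \<phi>)"

lemma same_type_sym: "same_type n v w \<Longrightarrow> same_type n w v"
  by (simp add: same_type_def)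

lemma same_type_mono: "same_type n v w \<Longrightarrow> m \<le> n \<Longrightarrow> same_type m v w"
  unfolding same_type_def by (meson lessThan_subset_iff order_trans)

lemma same_type_cong:
  "(\<And>i. i < n \<Longrightarrow> v i = v' i) \<Longrightarrow> (\<And>i. i < n \<Longrightarrow> w i = w' i) \<Longrightarrow> same_type n v w \<longleftrightarrow> same_type n v' w'"
  unfolding same_type_def
  by (intro all_cong1 imp_cong refl arg_cong2[where f = "(=)"] formula_value_cong) auto

lemma same_type_rename:
  assumes "same_type m v w" "\<And>i. i < n \<Longrightarrow> \<rho> i < m"
  shows "same_type n (v \<circ> \<rho>) (w \<circ> \<rho>)"
  unfolding same_type_def
proof (intro allI impI)
  fix \<phi> assume "free_vars \<phi> \<subseteq> {..<n}"
  then have "free_vars (rename \<phi> \<rho>) \<subseteq> {..<m}"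
    using assms(2) by (auto simp: free_vars_rename)
  then have "val v (rename \<phi> \<rho>) = val w (rename \<phi> \<rho>)"
    using assms(1) by (simp add: same_type_def)
  then show "val (v \<circ> \<rho>) \<phi> = val (w \<circ> \<rho>) \<phi>"
    by (simp only: formula_value_rename)
qed

lemma same_type_cl:
  assumes "same_type n v w" "v \<in> assignments" "w \<in> assignments" "i < n" "j < n"
  shows "cl (w i) = cl (w j) \<longleftrightarrow> cl (v i) = cl (v j)"
proof -
  have "val v (Dist (Var i) (Var j)) = val w (Dist (Var i) (Var j))"
    using assms(1)[unfolded same_type_def, rule_format, of "Dist (Var i) (Var j)"] assms(4,5) by simp
  moreover have "v i \<in> carrier G" "v j \<in> carrier G" "w i \<in> carrier G" "w j \<in> carrier G"
    using assms(2,3) by auto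
  ultimately show ?thesis
    using near_iff by (simp flip: near_iff)
qed

text \<open>If \<open>c\<close> realises certain values over \<open>v\<close>, then an infimum shows that they are realised approximately
  over \<open>w\<close>, and saturation makes them exact. In this step \<open>w\<close> may move inside its cosets. This is
  harmless, because the back-and-forth keeps exact elements on the side of \<open>v\<close> only.\<close>

lemma forth_step:
  assumes vw: "v \<in> assignments" "w \<in> assignments" "same_type n v w" and c: "c \<in> carrier G"
  shows "\<exists>w'\<in>assignments. same_type (Suc n) (v(n := c)) w' \<and> (\<forall>i<n. cl (w' i) = cl (w i))"
proof -
  define \<Gamma> where "\<Gamma> = {\<phi>. free_vars \<phi> \<subseteq> {..<Suc n}}"
  have vc: "v(n := c) \<in> assignments" using vw c by auto
  have "\<exists>w'\<in>assignments. \<exists>u\<in>assignments. (\<forall>i<n. u i = w i) \<and> (\<forall>i<Suc n. cl (w' i) = cl (u i)) \<and>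
          (\<forall>\<phi>\<in>\<Gamma>. val w' \<phi> = val (v(n := c)) \<phi>)"
  proof (rule saturation)
    show "free_vars \<phi> \<subseteq> {..<Suc n}" if "\<phi> \<in> \<Gamma>" for \<phi>
      using that by (simp add: \<Gamma>_def)
  next
    fix \<Delta> and \<epsilon> :: real assume \<Delta>: "finite \<Delta>" "\<Delta> \<subseteq> \<Gamma>" "\<epsilon> > 0"
    have e: "\<epsilon> / 2 > 0" using \<Delta>(3) by simp
    obtain \<kappa> where fv: "free_vars \<kappa> = (\<Union>\<phi>\<in>\<Delta>. free_vars \<phi>)"
      and close: "\<And>u \<phi>. \<lbrakk>val u \<kappa> \<le> \<epsilon> / 2; \<phi> \<in> \<Delta>\<rbrakk> \<Longrightarrow> \<bar>val u \<phi> - val (v(n := c)) \<phi>\<bar> \<le> 2 * (\<epsilon> / 2)"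
      and exact: "\<And>u. \<forall>\<phi>\<in>\<Delta>. val u \<phi> = val (v(n := c)) \<phi> \<Longrightarrow> val u \<kappa> \<le> \<epsilon> / 2 / 2"
      by (rule closeness_formula[OF \<Delta>(1) e val_bounds[OF vc]]) (rule that)
    have "free_vars (FInf n \<kappa>) \<subseteq> {..<n}"
      using fv \<Delta>(2) by (fastforce simp: \<Gamma>_def less_Suc_eq)
    then have "val w (FInf n \<kappa>) = val v (FInf n \<kappa>)"
      using vw(3) unfolding same_type_def by metis
    also have "\<dots> \<le> val (v(n := c)) \<kappa>" by (rule val_FInf_le[OF vw(1) c])
    also have "\<dots> \<le> \<epsilon> / 2 / 2" by (rule exact) simp
    also have "\<dots> < \<epsilon> / 2" using e by simp
    finally obtain a where a: "a \<in> carrier G" "val (w(n := a)) \<kappa> < \<epsilon> / 2"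
      using val_FInf_less by blast
    have "w(n := a) \<in> assignments" using a vw by auto
    moreover have "\<forall>\<phi>\<in>\<Delta>. \<bar>val (w(n := a)) \<phi> - val (v(n := c)) \<phi>\<bar> \<le> \<epsilon>"
      using close[of "w(n := a)"] a(2) by simp
    moreover have "\<forall>i<n. (w(n := a)) i = w i" by simp
    ultimately show "\<exists>u\<in>assignments. (\<forall>i<n. u i = w i) \<and> (\<forall>\<phi>\<in>\<Delta>. \<bar>val u \<phi> - val (v(n := c)) \<phi>\<bar> \<le> \<epsilon>)"
      by blast
  qed
  then obtain w' u where w': "w' \<in> assignments" "\<forall>i<n. u i = w i" "\<forall>i<Suc n. cl (w' i) = cl (u i)"
    "\<forall>\<phi>\<in>\<Gamma>. val w' \<phi> = val (v(n := c)) \<phi>"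
    by blast
  have "same_type (Suc n) (v(n := c)) w'"
    unfolding same_type_def using w'(4) by (simp add: \<Gamma>_def)
  moreover have "\<forall>i<n. cl (w' i) = cl (w i)" using w'(2,3) by simp
  ultimately show ?thesis using w'(1) by blast
qed

lemma forth_many:
  assumes vw: "v \<in> assignments" "w \<in> assignments" "same_type n v w"
    and v': "v' \<in> assignments" "\<And>i. i < n \<Longrightarrow> v' i = v i" and "n \<le> m"
  shows "\<exists>w'\<in>assignments. same_type m v' w' \<and> (\<forall>i<n. cl (w' i) = cl (w i))"
  using \<open>n \<le> m\<close>
proof (induction m rule: dec_induct)
  case base
  have "same_type n v' w" using same_type_cong[of n v' v w w] v'(2) vw(3) by simp
  then show ?case using vw(2) by blast
next
  case (step m)
  then obtain w' where w': "w' \<in> assignments" "same_type m v' w'" "\<forall>i<n. cl (w' i) = cl (w i)"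
    by blast
  have "v' m \<in> carrier G" using v'(1) by auto
  from forth_step[OF v'(1) w'(1,2) this] obtain w'' where
    "w'' \<in> assignments" "same_type (Suc m) v' w''" "\<forall>i<m. cl (w'' i) = cl (w' i)"
    by (auto simp: fun_upd_triv)
  then show ?case using w'(3) step.hyps(1) by (intro bexI[of _ w'']) auto
qed

text \<open>Going forth in the opposite direction provides a partner \<open>c\<close> for \<open>e\<close>, but disturbs \<open>v\<close> inside its
  cosets. A second round, which adjoins the original \<open>v\<close> to the disturbed tuple as further coordinates,
  restores \<open>v\<close> exactly; the formula expressing distance at most \<open>1/2\<close> transports the information that the
  old and the new copy lie in the same cosets.\<close>

lemma back_step:
  assumes vw: "v \<in> assignments" "w \<in> assignments" "same_type n v w" and e: "e \<in> carrier G"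
  shows "\<exists>c\<in>carrier G. \<exists>w'\<in>assignments. same_type (Suc n) (v(n := c)) w' \<and>
           (\<forall>i<n. cl (w' i) = cl (w i)) \<and> cl (w' n) = cl e"
proof -
  have we: "w(n := e) \<in> assignments" using vw e by auto
  from forth_step[OF vw(2,1) same_type_sym[OF vw(3)] e] obtain v' where
    v': "v' \<in> assignments" "same_type (Suc n) (w(n := e)) v'" "\<forall>i<n. cl (v' i) = cl (v i)"
    by blast
  define u where "u i = (if i \<le> n then v' i else v (i - Suc n))" for i
  have u: "u \<in> assignments" using v'(1) vw(1) by (auto simp: u_def Pi_iff)
  have "\<exists>w''\<in>assignments. same_type (Suc (2 * n)) u w'' \<and> (\<forall>i<Suc n. cl (w'' i) = cl ((w(n := e)) i))"
    by (rule forth_many[OF v'(1) we same_type_sym[OF v'(2)] u]) (auto simp: u_def)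
  then obtain w'' where w'': "w'' \<in> assignments" "same_type (Suc (2 * n)) u w''"
    "\<forall>i<Suc n. cl (w'' i) = cl ((w(n := e)) i)"
    by blast
  \<comment> \<open>Keep the original coordinates and \<open>c\<close>, and forget the disturbed copy.\<close>
  define \<rho> where "\<rho> i = (if i < n then Suc n + i else n)" for i
  have "same_type (Suc n) (u \<circ> \<rho>) (w'' \<circ> \<rho>)"
    by (rule same_type_rename[OF w''(2)]) (auto simp: \<rho>_def)
  moreover have "(u \<circ> \<rho>) i = (v(n := v' n)) i" if "i < Suc n" for i
    using that by (auto simp: u_def \<rho>_def less_Suc_eq)
  ultimately have "same_type (Suc n) (v(n := v' n)) (w'' \<circ> \<rho>)"
    using same_type_cong[of "Suc n" "u \<circ> \<rho>" "v(n := v' n)" "w'' \<circ> \<rho>" "w'' \<circ> \<rho>"] by simp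
  moreover have "cl ((w'' \<circ> \<rho>) i) = cl (w i)" if i: "i < n" for i
  proof -
    have "cl (u (Suc n + i)) = cl (u i)"
      using i v'(3) by (simp add: u_def)
    then have "cl (w'' (Suc n + i)) = cl (w'' i)"
      using same_type_cl[OF w''(2) u w''(1), of "Suc n + i" i] i by simp
    then show ?thesis
      using w''(3) i by (simp add: \<rho>_def)
  qed
  moreover have "cl ((w'' \<circ> \<rho>) n) = cl e"
    using w''(3) by (simp add: \<rho>_def)
  moreover have "v' n \<in> carrier G" "w'' \<circ> \<rho> \<in> assignments" using v'(1) w''(1) by auto
  ultimately show ?thesis by blast
qed

lemma coset_enumeration: "\<exists>g :: nat \<Rightarrow> 'a. (\<forall>k. g k \<in> carrier G) \<and> (\<forall>x\<in>carrier G. \<exists>k. cl (g k) = cl x)"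
proof -
  have ne: "\<Omega> \<noteq> {}" using cl_in one_closed by blast
  define f where "f = from_nat_into \<Omega>"
  have "\<exists>x. x \<in> carrier G \<and> cl x = f k" for k
    using from_nat_into[OF ne, of k] by (auto simp: f_def \<Omega>_eq)
  then obtain g where g: "\<And>k. g k \<in> carrier G \<and> cl (g k) = f k" by metis
  have "\<exists>k. cl (g k) = cl x" if "x \<in> carrier G" for x
    using from_nat_into_surj[OF countable_cosets cl_in[OF that]] g by (auto simp: f_def)
  then show ?thesis using g by blast
qed

text \<open>The sequence \<open>V\<close> consists of fixed elements, whereas \<open>W\<close> only represents cosets: a sequence of the
  same type as an initial segment of \<open>V\<close> has to be chosen anew in these cosets for every length. Even steps
  make \<open>V\<close> exhaust the cosets, odd steps \<open>W\<close>.\<close>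

lemma back_and_forth:
  assumes vw: "v \<in> assignments" "w \<in> assignments" "same_type N v w"
  shows "\<exists>V\<in>assignments. \<exists>W\<in>assignments. (\<forall>i<N. V i = v i \<and> cl (W i) = cl (w i)) \<and>
           (\<forall>n. \<exists>w'\<in>assignments. same_type n V w' \<and> (\<forall>i<n. cl (w' i) = cl (W i))) \<and>
           (\<forall>x\<in>carrier G. \<exists>i. cl (V i) = cl x) \<and> (\<forall>x\<in>carrier G. \<exists>i. cl (W i) = cl x)"
proof -
  from coset_enumeration obtain g :: "nat \<Rightarrow> 'a" where
    g: "\<And>k. g k \<in> carrier G" "\<And>x. x \<in> carrier G \<Longrightarrow> \<exists>k. cl (g k) = cl x"
    by blast
  define P where "P k p \<longleftrightarrow> fst p \<in> assignments \<and> snd p \<in> assignments \<and> same_type (N + k) (fst p) (snd p) \<and>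
      (k = 0 \<longrightarrow> p = (v, w))" for k and p :: "(nat \<Rightarrow> 'a) \<times> (nat \<Rightarrow> 'a)"
  define Q where "Q k p q \<longleftrightarrow> (\<forall>i<N + k. fst q i = fst p i \<and> cl (snd q i) = cl (snd p i)) \<and>
      (if even k then fst q (N + k) = g (k div 2) else cl (snd q (N + k)) = cl (g (k div 2)))"
    for k and p q :: "(nat \<Rightarrow> 'a) \<times> (nat \<Rightarrow> 'a)"
  have step: "\<exists>q. P (Suc k) q \<and> Q k p q" if "P k p" for k p
  proof -
    have p: "fst p \<in> assignments" "snd p \<in> assignments" "same_type (N + k) (fst p) (snd p)"
      using that by (auto simp: P_def)
    show ?thesis
    proof (cases "even k")
      case True
      from forth_step[OF p g(1)[of "k div 2"]] obtain w' where w': "w' \<in> assignments"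
        "same_type (Suc (N + k)) ((fst p)(N + k := g (k div 2))) w'" "\<forall>i<N + k. cl (w' i) = cl (snd p i)"
        by blast
      have "(fst p)(N + k := g (k div 2)) \<in> assignments"
        using p(1) g(1) by auto
      then show ?thesis
        using w' True by (intro exI[of _ "((fst p)(N + k := g (k div 2)), w')"]) (auto simp: P_def Q_def)
    next
      case False
      from back_step[OF p g(1)[of "k div 2"]] obtain c w' where w': "w' \<in> assignments" "c \<in> carrier G"
        "same_type (Suc (N + k)) ((fst p)(N + k := c)) w'" "\<forall>i<N + k. cl (w' i) = cl (snd p i)"
        "cl (w' (N + k)) = cl (g (k div 2))"
        by blast
      have "(fst p)(N + k := c) \<in> assignments"
        using p(1) w'(2) by auto
      then show ?thesis
        using w' False by (intro exI[of _ "((fst p)(N + k := c), w')"]) (auto simp: P_def Q_def)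
    qed
  qed
  have "\<exists>p. P 0 p" using vw by (auto simp: P_def)
  then have "\<exists>f. \<forall>k. P k (f k) \<and> Q k (f k) (f (Suc k))"
    by (rule dependent_nat_choice) (rule step)
  then obtain f where f: "\<And>k. P k (f k)" "\<And>k. Q k (f k) (f (Suc k))"
    by auto
  have stable: "fst (f l) i = fst (f k) i \<and> cl (snd (f l) i) = cl (snd (f k) i)" if "k \<le> l" "i < N + k" for k l i
    using that(1)
  proof (induction l rule: dec_induct)
    case (step l)
    then show ?case using f(2)[of l] that(2) unfolding Q_def by auto
  qed simp
  define V where "V i = fst (f (Suc i)) i" for i
  define W where "W i = snd (f (Suc i)) i" for i
  have VW: "V i = fst (f k) i \<and> cl (W i) = cl (snd (f k) i)" if "i < N + k" for i k
    using stable[of k "Suc i" i] stable[of "Suc i" k i] that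
    by (cases "k \<le> Suc i") (auto simp: V_def W_def)
  have fP: "fst (f k) \<in> assignments" "snd (f k) \<in> assignments" "same_type (N + k) (fst (f k)) (snd (f k))" for k
    using f(1)[of k] by (auto simp: P_def)
  have Vas: "V \<in> assignments" and Was: "W \<in> assignments"
    using fP by (auto simp: V_def W_def Pi_iff)
  have ext: "\<forall>i<N. V i = v i \<and> cl (W i) = cl (w i)"
    using VW[of _ 0] f(1)[of 0] by (simp add: P_def)
  have types: "\<forall>n. \<exists>w'\<in>assignments. same_type n V w' \<and> (\<forall>i<n. cl (w' i) = cl (W i))"
  proof (intro allI, rule bexI, intro conjI allI impI)
    fix n
    have "same_type n (fst (f n)) (snd (f n))"
      using same_type_mono[OF fP(3)] by simp
    then show "same_type n V (snd (f n))"
      using same_type_cong[of n V "fst (f n)" "snd (f n)" "snd (f n)"] VW[of _ n] by simp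
    fix i assume "i < n"
    then show "cl (snd (f n) i) = cl (W i)"
      using VW[of i n] by simp
  next
    fix n
    show "snd (f n) \<in> assignments" by (fact fP)
  qed
  have V_onto: "\<forall>x\<in>carrier G. \<exists>i. cl (V i) = cl x"
  proof
    fix x assume x: "x \<in> carrier G"
    from g(2)[OF x] obtain k where k: "cl (g k) = cl x" by blast
    have "V (N + 2 * k) = g k"
      using VW[of "N + 2 * k" "Suc (2 * k)"] f(2)[of "2 * k"] by (simp add: Q_def)
    then have "cl (V (N + 2 * k)) = cl (g k)" by simp
    then show "\<exists>i. cl (V i) = cl x" using k by (intro exI) (rule trans)
  qed
  have W_onto: "\<forall>x\<in>carrier G. \<exists>i. cl (W i) = cl x"
  proof
    fix x assume x: "x \<in> carrier G"
    from g(2)[OF x] obtain k where k: "cl (g k) = cl x" by blast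
    have "cl (W (N + Suc (2 * k))) = cl (g k)"
      using VW[of "N + Suc (2 * k)" "Suc (Suc (2 * k))"] f(2)[of "Suc (2 * k)"] by (simp add: Q_def)
    then show "\<exists>i. cl (W i) = cl x" using k by (intro exI) (rule trans)
  qed
  show ?thesis
    by (rule bexI[OF bexI[OF _ Was] Vas], intro conjI) (fact ext types V_onto W_onto)+
qed


section \<open>Tuples of the same type are conjugate up to cosets\<close>

text \<open>A finite set \<open>S\<close> of further elements can be adjoined to an initial segment of \<open>V\<close> that is long enough
  to meet the cosets of all elements of \<open>S\<close>. Distances and products in \<open>S\<close> are preserved because atomic
  formulas are; the images stay in the prescribed cosets because the coset relation is a formula.\<close>

lemma finite_partial_isomorphism:
  assumes V: "V \<in> assignments" and W: "W \<in> assignments"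
    and types: "\<And>n. \<exists>w\<in>assignments. same_type n V w \<and> (\<forall>i<n. cl (w i) = cl (W i))"
    and j: "\<forall>x\<in>carrier G. cl (V (j x)) = cl x"
    and S: "finite S" "S \<subseteq> carrier G"
  shows "\<exists>F\<in>PiE (carrier G) (\<lambda>x. cl (W (j x))).
           \<forall>x\<in>S. \<forall>y\<in>S. D (F x) (F y) = D x y \<and> (x \<otimes> y \<in> S \<longrightarrow> F (x \<otimes> y) = F x \<otimes> F y)"
proof -
  obtain cs where cs: "set cs = S" using finite_list[OF S(1)] by blast
  define n where "n = Suc (Max (insert 0 (j ` S)))"
  have jn: "j x < n" if "x \<in> S" for x
  proof -
    have "j x \<le> Max (insert 0 (j ` S))"
      by (rule Max_ge) (use S that in auto)
    then show ?thesis by (simp add: n_def)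
  qed
  obtain w where w: "w \<in> assignments" "same_type n V w" "\<forall>i<n. cl (w i) = cl (W i)"
    using types by blast
  define m where "m = n + length cs"
  \<comment> \<open>The elements of \<open>S\<close> follow the initial segment of length \<open>n\<close>.\<close>
  define v where "v i = (if i < n then V i else if i < m then cs ! (i - n) else \<one>)" for i
  have "v i \<in> carrier G" for i
  proof (cases "n \<le> i \<and> i < m")
    case True
    then have "cs ! (i - n) \<in> set cs" by (intro nth_mem) (auto simp: m_def)
    then show ?thesis using True cs S(2) by (auto simp: v_def)
  next
    case False
    then show ?thesis using V by (auto simp: v_def)
  qed
  then have v: "v \<in> assignments" by auto
  have "\<exists>w'\<in>assignments. same_type m v w' \<and> (\<forall>i<n. cl (w' i) = cl (w i))"
    by (rule forth_many[OF V w(1,2) v]) (auto simp: v_def m_def)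
  then obtain w' where w': "w' \<in> assignments" "same_type m v w'" "\<forall>i<n. cl (w' i) = cl (w i)"
    by blast
  have "\<exists>k. k < length cs \<and> cs ! k = x" if "x \<in> S" for x
    using that cs by (auto simp: in_set_conv_nth)
  then obtain pos where pos: "\<And>x. x \<in> S \<Longrightarrow> pos x < length cs \<and> cs ! pos x = x"
    by metis
  define idx where "idx x = n + pos x" for x
  have idx_m: "idx x < m" and v_idx: "v (idx x) = x" if "x \<in> S" for x
    using pos[OF that] by (auto simp: idx_def m_def v_def)
  define F where "F = (\<lambda>x\<in>carrier G. if x \<in> S then w' (idx x) else W (j x))"
  have FS: "F x = w' (idx x)" if "x \<in> S" for x
    using that S(2) by (auto simp: F_def)
  have w'G: "w' i \<in> carrier G" for i using w'(1) by auto
  have WG: "W i \<in> carrier G" for i using W by auto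
  have "F x \<in> cl (W (j x))" if x: "x \<in> carrier G" for x
  proof (cases "x \<in> S")
    case True
    have "cl (v (idx x)) = cl (v (j x))"
      using v_idx[OF True] bspec[OF j x] jn[OF True] by (simp add: v_def)
    then have "cl (w' (idx x)) = cl (w' (j x))"
      using same_type_cl[OF w'(2) v w'(1), of "idx x" "j x"] idx_m[OF True] jn[OF True] by (simp add: m_def)
    also have "\<dots> = cl (W (j x))"
      using w'(3) w(3) jn[OF True] by simp
    finally show ?thesis
      using FS[OF True] by (simp add: in_cl_iff WG w'G)
  next
    case False
    then show ?thesis using x by (simp add: F_def in_cl_iff WG)
  qed
  then have "F \<in> PiE (carrier G) (\<lambda>x. cl (W (j x)))"
    by (auto simp: PiE_iff F_def extensional_def)
  moreover have "D (F x) (F y) = D x y" if "x \<in> S" "y \<in> S" for x y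
    using w'(2)[unfolded same_type_def, rule_format, of "Dist (Var (idx x)) (Var (idx y))"] that
    by (simp add: FS idx_m v_idx)
  moreover have "F (x \<otimes> y) = F x \<otimes> F y" if "x \<in> S" "y \<in> S" "x \<otimes> y \<in> S" for x y
  proof -
    have "val v (Dist (Var (idx (x \<otimes> y))) (Mult (Var (idx x)) (Var (idx y)))) =
        val w' (Dist (Var (idx (x \<otimes> y))) (Mult (Var (idx x)) (Var (idx y))))"
      by (rule w'(2)[unfolded same_type_def, rule_format]) (simp add: idx_m that)
    then have "D (w' (idx (x \<otimes> y))) (w' (idx x) \<otimes> w' (idx y)) = 0"
      using that S(2) by (simp add: v_idx subset_iff)
    then show ?thesis
      using that w'G by (simp add: FS)
  qed
  ultimately show ?thesis by blast
qed

text \<open>Finite partial isomorphisms with values in prescribed cosets are points of a product of compact sets, so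
  by Tychonoff they have a common extension to all of \<open>G\<close>.\<close>

lemma global_isomorphism:
  assumes V: "V \<in> assignments" and W: "W \<in> assignments"
    and types: "\<And>n. \<exists>w\<in>assignments. same_type n V w \<and> (\<forall>i<n. cl (w i) = cl (W i))"
    and j: "\<forall>x\<in>carrier G. cl (V (j x)) = cl x"
  shows "\<exists>F\<in>PiE (carrier G) (\<lambda>x. cl (W (j x))).
           \<forall>x\<in>carrier G. \<forall>y\<in>carrier G. D (F x) (F y) = D x y \<and> F (x \<otimes> y) = F x \<otimes> F y"
proof -
  define B where "B = PiE (carrier G) (\<lambda>x. cl (W (j x)))"
  have WG: "W i \<in> carrier G" for i using W by auto
  have B: "compactin (product_topology (\<lambda>_. mtopology) (carrier G)) B"
    unfolding B_def compactin_PiE using compact_cl WG by blast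
  have BG: "F x \<in> carrier G" if "F \<in> B" "x \<in> carrier G" for F x
    using that WG by (auto simp: B_def in_cl_iff PiE_iff)
  define h where "h = (\<lambda>(x, y) F. D (F x) (F y) - D x y)"
  define k where "k = (\<lambda>(x, y) F. D (F (x \<otimes> y)) (F x \<otimes> F y))"
  let ?G2 = "carrier G \<times> carrier G"
  let ?E = "PiE (carrier G) (\<lambda>_. carrier G)"
  have cont_h: "continuous_map (product_topology (\<lambda>_. mtopology) (carrier G)) euclideanreal (h p)"
    if p: "p \<in> ?G2" for p
  proof (rule continuous_map_product_uniform)
    fix \<epsilon> :: real assume "\<epsilon> > 0"
    obtain x y where xy: "p = (x, y)" "x \<in> carrier G" "y \<in> carrier G" using p by auto
    have "\<bar>h p F - h p F'\<bar> \<le> \<epsilon>" if F: "F \<in> ?E" "F' \<in> ?E" "\<forall>i\<in>{x, y}. D (F i) (F' i) < \<epsilon> / 2" for F F'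
    proof -
      have "F x \<in> carrier G" "F y \<in> carrier G" "F' x \<in> carrier G" "F' y \<in> carrier G"
        using F(1,2) xy(2,3) by (auto simp: PiE_iff)
      from dist_diff_le[OF this] show ?thesis
        using F(3) xy(1) by (simp add: h_def)
    qed
    then show "\<exists>\<delta>>0. \<exists>J. finite J \<and> J \<subseteq> carrier G \<and> (\<forall>F\<in>?E. \<forall>F'\<in>?E.
        (\<forall>i\<in>J. D (F i) (F' i) < \<delta>) \<longrightarrow> \<bar>h p F - h p F'\<bar> \<le> \<epsilon>)"
      using xy \<open>\<epsilon> > 0\<close> by (intro exI[of _ "\<epsilon> / 2"] conjI exI[of _ "{x, y}"] ballI impI) auto
  qed
  have cont_k: "continuous_map (product_topology (\<lambda>_. mtopology) (carrier G)) euclideanreal (k p)"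
    if p: "p \<in> ?G2" for p
  proof (rule continuous_map_product_uniform)
    fix \<epsilon> :: real assume "\<epsilon> > 0"
    obtain x y where xy: "p = (x, y)" "x \<in> carrier G" "y \<in> carrier G" using p by auto
    have "\<bar>k p F - k p F'\<bar> \<le> \<epsilon>"
      if F: "F \<in> ?E" "F' \<in> ?E" "\<forall>i\<in>{x, y, x \<otimes> y}. D (F i) (F' i) < \<epsilon> / 3" for F F'
    proof -
      have c: "F x \<in> carrier G" "F y \<in> carrier G" "F' x \<in> carrier G" "F' y \<in> carrier G"
        "F (x \<otimes> y) \<in> carrier G" "F' (x \<otimes> y) \<in> carrier G"
        using F(1,2) xy(2,3) by (auto simp: PiE_iff)
      have "\<bar>k p F - k p F'\<bar> \<le> D (F (x \<otimes> y)) (F' (x \<otimes> y)) + D (F x \<otimes> F y) (F' x \<otimes> F' y)"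
        unfolding xy(1) k_def prod.case by (rule dist_diff_le) (use c in auto)
      then show ?thesis
        using dist_mult_le[of "F x" "F y" "F' x" "F' y"] c F(3) by simp
    qed
    then show "\<exists>\<delta>>0. \<exists>J. finite J \<and> J \<subseteq> carrier G \<and> (\<forall>F\<in>?E. \<forall>F'\<in>?E.
        (\<forall>i\<in>J. D (F i) (F' i) < \<delta>) \<longrightarrow> \<bar>k p F - k p F'\<bar> \<le> \<epsilon>)"
      using xy \<open>\<epsilon> > 0\<close> by (intro exI[of _ "\<epsilon> / 3"] conjI exI[of _ "{x, y, x \<otimes> y}"] ballI impI) auto
  qed
  have "\<exists>F\<in>B. \<forall>f\<in>h ` ?G2 \<union> k ` ?G2. f F = 0"
  proof (rule compact_common_zero[OF B])
    show "continuous_map (product_topology (\<lambda>_. mtopology) (carrier G)) euclideanreal f"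
      if "f \<in> h ` ?G2 \<union> k ` ?G2" for f
      using that cont_h cont_k by blast
  next
    fix F0 and \<epsilon> :: real assume F0: "finite F0" "F0 \<subseteq> h ` ?G2 \<union> k ` ?G2" "\<epsilon> > 0"
    have "finite (F0 \<inter> h ` ?G2)" "F0 \<inter> h ` ?G2 \<subseteq> h ` ?G2" using F0 by auto
    from finite_subset_image[OF this] obtain P where P: "P \<subseteq> ?G2" "finite P" "F0 \<inter> h ` ?G2 = h ` P"
      by blast
    have "finite (F0 \<inter> k ` ?G2)" "F0 \<inter> k ` ?G2 \<subseteq> k ` ?G2" using F0 by auto
    from finite_subset_image[OF this] obtain Q where Q: "Q \<subseteq> ?G2" "finite Q" "F0 \<inter> k ` ?G2 = k ` Q"
      by blast
    have F0_eq: "F0 = h ` P \<union> k ` Q"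
    proof -
      have "F0 = (F0 \<inter> h ` ?G2) \<union> (F0 \<inter> k ` ?G2)" using F0(2) by (auto simp only: Int_Un_distrib[symmetric] Int_absorb2)
      then show ?thesis by (simp only: P(3) Q(3))
    qed
    define S where "S = (\<Union>(x, y)\<in>P \<union> Q. {x, y, x \<otimes> y})"
    have S: "finite S" "S \<subseteq> carrier G"
      using P(1,2) Q(1,2) by (auto simp: S_def)
    from finite_partial_isomorphism[OF V W types j S] obtain F where F: "F \<in> B"
      "\<forall>x\<in>S. \<forall>y\<in>S. D (F x) (F y) = D x y \<and> (x \<otimes> y \<in> S \<longrightarrow> F (x \<otimes> y) = F x \<otimes> F y)"
      unfolding B_def by (elim bexE)
    have zero: "f F = 0" if f: "f \<in> F0" for f
    proof -
      from f F0_eq consider (h) p where "p \<in> P" "f = h p" | (k) p where "p \<in> Q" "f = k p" by blast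
      then show ?thesis
      proof cases
        case h
        obtain x y where xy: "p = (x, y)" by (cases p)
        then have "x \<in> S" "y \<in> S" using h(1) by (auto simp: S_def)
        then show ?thesis using F(2) h(2) xy by (simp add: h_def)
      next
        case k
        obtain x y where xy: "p = (x, y)" by (cases p)
        then have xyS: "x \<in> S" "y \<in> S" "x \<otimes> y \<in> S" using k(1) by (auto simp: S_def)
        then have "F (x \<otimes> y) = F x \<otimes> F y" using F(2) by blast
        moreover have "F (x \<otimes> y) \<in> carrier G" using BG[OF F(1)] xyS S(2) by blast
        ultimately show ?thesis using k(2) xy by (simp add: k_def)
      qed
    qed
    show "\<exists>F\<in>B. \<forall>f\<in>F0. \<bar>f F\<bar> \<le> \<epsilon>"
    proof (intro bexI[of _ F] ballI)
      fix f assume "f \<in> F0"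
      from zero[OF this] show "\<bar>f F\<bar> \<le> \<epsilon>" using F0(3) by simp
    qed (fact F(1))
  qed
  then obtain F where F: "F \<in> B" "\<And>f. f \<in> h ` ?G2 \<union> k ` ?G2 \<Longrightarrow> f F = 0"
    by blast
  have "D (F x) (F y) = D x y \<and> F (x \<otimes> y) = F x \<otimes> F y" if "x \<in> carrier G" "y \<in> carrier G" for x y
  proof -
    have "h (x, y) F = 0" "k (x, y) F = 0" using that by (intro F(2); blast)+
    then show ?thesis
      using BG[OF F(1)] that by (simp add: h_def k_def)
  qed
  then show ?thesis using F(1) unfolding B_def by blast
qed

text \<open>The homogeneity of \<open>(G, d\<^sup>*)\<close> at the level of cosets. The isometric homomorphism given by compactness
  is onto: it reaches every coset since \<open>W\<close> does, and it maps the compact group \<open>H\<close> isometrically into,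
  hence onto, itself.\<close>

lemma same_type_imp_conjugate:
  assumes "v \<in> assignments" "w \<in> assignments" "same_type N v w"
  shows "\<exists>\<alpha>\<in>Aut. \<forall>i<N. cl (\<alpha> (v i)) = cl (w i)"
proof -
  from back_and_forth[OF assms] obtain V W where V: "V \<in> assignments" and W: "W \<in> assignments"
    and ext: "\<forall>i<N. V i = v i \<and> cl (W i) = cl (w i)"
    and types: "\<forall>n. \<exists>w'\<in>assignments. same_type n V w' \<and> (\<forall>i<n. cl (w' i) = cl (W i))"
    and V_onto: "\<forall>x\<in>carrier G. \<exists>i. cl (V i) = cl x" and W_onto: "\<forall>x\<in>carrier G. \<exists>i. cl (W i) = cl x"
    by (elim bexE conjE)
  obtain j where j: "\<forall>x\<in>carrier G. cl (V (j x)) = cl x"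
    using bchoice[OF V_onto] by (elim exE)
  from global_isomorphism[OF V W types[rule_format] j] obtain F
    where F: "F \<in> PiE (carrier G) (\<lambda>x. cl (W (j x)))"
    and iso: "\<forall>x\<in>carrier G. \<forall>y\<in>carrier G. D (F x) (F y) = D x y \<and> F (x \<otimes> y) = F x \<otimes> F y"
    by (elim bexE)
  have VG: "V i \<in> carrier G" and WG: "W i \<in> carrier G" for i using V W by auto
  have FG: "F x \<in> carrier G" and Fcl: "cl (F x) = cl (W (j x))" if "x \<in> carrier G" for x
  proof -
    have "F x \<in> cl (W (j x))" using PiE_mem[OF F that] .
    then show "F x \<in> carrier G" "cl (F x) = cl (W (j x))" by (simp_all add: in_cl_iff WG)
  qed
  have VW: "cl (W i) = cl (W k)" if eq: "cl (V i) = cl (V k)" for i k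
  proof -
    from types obtain w' where w': "w' \<in> assignments" "same_type (Suc (max i k)) V w'"
      "\<forall>l<Suc (max i k). cl (w' l) = cl (W l)" by blast
    have "cl (w' i) = cl (w' k)"
      using same_type_cl[OF w'(2) V w'(1), of i k] eq by simp
    then show ?thesis using w'(3) by simp
  qed
  have FV: "cl (F (V i)) = cl (W i)" for i
    using Fcl[OF VG] VW[OF bspec[OF j VG]] by simp
  have one: "F \<one> = \<one>"
  proof -
    have "F \<one> \<otimes> F \<one> = F \<one>" using iso[rule_format, of \<one> \<one>] by simp
    then show ?thesis using FG[of \<one>] by (simp add: l_cancel_one')
  qed
  have H_iff: "x \<in> H \<longleftrightarrow> x \<in> carrier G \<and> D \<one> x \<le> 1 / 2" for x
    using near_iff[of \<one> x] in_cl_iff[of \<one> x] subgroup.subset[OF subgroup_H] coset_mult_one[of H]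
    by (auto simp: subset_iff)
  have HG: "H \<subseteq> carrier G" by (rule subgroup.subset[OF subgroup_H])
  have "F ` H = H"
  proof (rule isometry_of_compact_onto[OF compact_H])
    show "F ` H \<subseteq> H"
    proof
      fix z assume "z \<in> F ` H"
      then obtain x where x: "x \<in> H" "z = F x" by blast
      have "D (F \<one>) (F x) = D \<one> x" using iso x HG by blast
      then show "z \<in> H" using x one FG H_iff by auto
    qed
    show "D (F x) (F y) = D x y" if "x \<in> H" "y \<in> H" for x y
      using iso that HG by blast
  qed
  have "F ` carrier G = carrier G"
  proof (intro equalityI subsetI)
    fix y assume y: "y \<in> carrier G"
    obtain i where "cl (W i) = cl y" using W_onto y by blast
    then have "cl y = cl (F (V i))" using FV by simp
    then have "y \<in> cl (F (V i))" using y by (simp add: in_cl_iff FG VG)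
    then obtain h where h: "h \<in> H" "y = h \<otimes> F (V i)" by (auto simp: r_coset_def)
    then obtain h' where h': "h' \<in> H" "h = F h'" using \<open>F ` H = H\<close> by blast
    have "y = F (h' \<otimes> V i)" using iso h h' HG VG by (metis subsetD)
    then show "y \<in> F ` carrier G" using h'(1) HG VG by blast
  qed (use FG in auto)
  moreover have "inj_on F (carrier G)"
  proof (rule inj_onI)
    fix x y assume xy: "x \<in> carrier G" "y \<in> carrier G" "F x = F y"
    then have "D x y = 0" using iso FG by (metis mdist_zero)
    then show "x = y" using xy by simp
  qed
  ultimately have "F \<in> Aut"
    unfolding Aut_iff using iso FG F by (auto simp: hom_def bij_betw_def PiE_iff)
  moreover have "cl (F (v i)) = cl (w i)" if "i < N" for i
    using FV[of i] ext that by simp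
  ultimately show ?thesis by blast
qed

section \<open>Invariant relations are definable\<close>

abbreviation invariants :: "(nat \<times> 'a set list set) set" where
  "invariants \<equiv> invariant_relations (isometric_automorphisms G D) \<Omega> (`)"

lemma invariant_relation_conjugate:
  assumes R: "(n, R) \<in> invariants"
    and "\<alpha> \<in> Aut" "u \<in> UNIV \<rightarrow> \<Omega>" "set xs \<subseteq> {..<m}" "length xs = n" "\<And>i. i < m \<Longrightarrow> y i = \<alpha> ` u i"
  shows "map y xs \<in> R \<longleftrightarrow> map u xs \<in> R"
proof -
  have *: "map y xs = map ((`) \<alpha>) (map u xs)"
    using assms(4,6) by auto
  have "map u xs \<in> tuples n \<Omega>"
    using assms(3,5) by (auto simp: tuples_def)
  then show ?thesis
    unfolding * using R assms(2) unfolding invariant_relations_def by blast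
qed

text \<open>An invariant relation of cosets is the zero set of a two-valued formula. Two tuples on different sides of
  the relation have different types by homogeneity. Saturation, applied first to the tuples
  off \<open>R\<close> and then to those on \<open>R\<close>, turns the pointwise separation into a single formula, as in the usual
  separation of two disjoint compact sets.\<close>

lemma invariant_relation_definable:
  assumes R: "(n, R) \<in> invariants"
  shows "\<exists>\<psi>. free_vars \<psi> \<subseteq> {..<n} \<and>
           (\<forall>v\<in>assignments. val v \<psi> = (if map (cl \<circ> v) [0..<n] \<in> R then 0 else 1))"
proof -
  define inR where "inR v \<longleftrightarrow> map (cl \<circ> v) [0..<n] \<in> R" for v :: "nat \<Rightarrow> 'a"
  have inR_cong: "inR v \<longleftrightarrow> inR w" if "\<And>i. i < n \<Longrightarrow> cl (v i) = cl (w i)" for v w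
  proof -
    have "map (cl \<circ> v) [0..<n] = map (cl \<circ> w) [0..<n]" using that by simp
    then show ?thesis by (simp only: inR_def)
  qed
  have inR_type: "inR v \<longleftrightarrow> inR w"
    if vw: "v \<in> assignments" "w \<in> assignments" "same_type n v w" for v w
  proof -
    from same_type_imp_conjugate[OF vw] obtain \<alpha> where \<alpha>: "\<alpha> \<in> Aut" "\<forall>i<n. cl (\<alpha> (v i)) = cl (w i)"
      by blast
    have vG: "v i \<in> carrier G" for i using vw(1) by auto
    have "inR w \<longleftrightarrow> inR (\<alpha> \<circ> v)" by (rule inR_cong) (use \<alpha>(2) in simp)
    also have "\<dots> \<longleftrightarrow> inR v"
      unfolding inR_def
      by (rule invariant_relation_conjugate[OF R \<alpha>(1), of _ _ n])
         (use vG \<alpha>(1) in \<open>auto simp: cl_in Aut_cl\<close>)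
    finally show ?thesis by simp
  qed
  have separate: "\<exists>\<phi>. free_vars \<phi> \<subseteq> {..<n} \<and> val a \<phi> = 0 \<and> (\<forall>b\<in>assignments. \<not> inR b \<longrightarrow> val b \<phi> = 1)"
    if a: "a \<in> assignments" "inR a" for a
  proof -
    define \<Gamma> where "\<Gamma> = {\<phi>. free_vars \<phi> \<subseteq> {..<n}}"
    have "\<exists>\<Delta> \<epsilon>. finite \<Delta> \<and> \<Delta> \<subseteq> \<Gamma> \<and> \<epsilon> > 0 \<and>
        \<not> (\<exists>b\<in>assignments. \<not> inR b \<and> (\<forall>\<phi>\<in>\<Delta>. \<bar>val b \<phi> - val a \<phi>\<bar> \<le> \<epsilon>))"
    proof (rule ccontr)
      assume neg: "\<not> ?thesis"
      have "\<exists>w\<in>assignments. \<exists>u\<in>assignments. \<not> inR u \<and> (\<forall>i<n. cl (w i) = cl (u i)) \<and> (\<forall>\<phi>\<in>\<Gamma>. val w \<phi> = val a \<phi>)"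
        by (rule saturation) (use neg in \<open>auto simp: \<Gamma>_def\<close>)
      then obtain w u where wu: "w \<in> assignments" "\<not> inR u" "\<forall>i<n. cl (w i) = cl (u i)" "\<forall>\<phi>\<in>\<Gamma>. val w \<phi> = val a \<phi>"
        by (elim bexE conjE)
      have "same_type n a w" using wu(4) by (simp add: same_type_def \<Gamma>_def)
      then have "inR w" using inR_type[OF a(1) wu(1)] a(2) by simp
      then show False using inR_cong[of w u] wu(2,3) by simp
    qed
    then obtain \<Delta> \<epsilon> where \<Delta>: "finite \<Delta>" "\<Delta> \<subseteq> \<Gamma>" "\<epsilon> > 0"
      "\<not> (\<exists>b\<in>assignments. \<not> inR b \<and> (\<forall>\<phi>\<in>\<Delta>. \<bar>val b \<phi> - val a \<phi>\<bar> \<le> \<epsilon>))"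
      by (elim exE conjE)
    define \<delta> where "\<delta> = min (\<epsilon> / 2) 1"
    have \<delta>: "\<delta> > 0" "2 * \<delta> \<le> \<epsilon>" "\<delta> \<le> 1" using \<Delta>(3) by (auto simp: \<delta>_def)
    obtain \<kappa> where fv: "free_vars \<kappa> = (\<Union>\<phi>\<in>\<Delta>. free_vars \<phi>)"
      and close: "\<And>u \<phi>. \<lbrakk>val u \<kappa> \<le> \<delta>; \<phi> \<in> \<Delta>\<rbrakk> \<Longrightarrow> \<bar>val u \<phi> - val a \<phi>\<bar> \<le> 2 * \<delta>"
      and exact: "\<And>u. \<forall>\<phi>\<in>\<Delta>. val u \<phi> = val a \<phi> \<Longrightarrow> val u \<kappa> \<le> \<delta> / 2"
      by (rule closeness_formula[OF \<Delta>(1) \<delta>(1) val_bounds[OF a(1)]]) (rule that)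
    have far: "val b \<kappa> \<ge> \<delta>" if b: "b \<in> assignments" "\<not> inR b" for b
    proof (rule ccontr)
      assume "\<not> val b \<kappa> \<ge> \<delta>"
      then have "\<forall>\<phi>\<in>\<Delta>. \<bar>val b \<phi> - val a \<phi>\<bar> \<le> 2 * \<delta>"
        using close[of b] by simp
      then have "\<forall>\<phi>\<in>\<Delta>. \<bar>val b \<phi> - val a \<phi>\<bar> \<le> \<epsilon>"
        using \<delta>(2) by (meson order_trans)
      then show False using \<Delta>(4) b by blast
    qed
    have near: "val a \<kappa> \<le> \<delta> / 2" by (rule exact) simp
    from threshold_formula[of "\<delta> / 2" \<delta> \<kappa>] \<delta> obtain \<psi> where \<psi>: "free_vars \<psi> = free_vars \<kappa>"
      "\<forall>v\<in>assignments. (val v \<kappa> \<le> \<delta> / 2 \<longrightarrow> val v \<psi> = 0) \<and> (val v \<kappa> \<ge> \<delta> \<longrightarrow> val v \<psi> = 1)"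
      by auto
    have "free_vars \<psi> \<subseteq> {..<n}" using \<psi>(1) fv \<Delta>(2) by (auto simp: \<Gamma>_def)
    then show ?thesis using \<psi>(2) near far a(1) by blast
  qed
  define \<Phi> where "\<Phi> = {\<phi>. free_vars \<phi> \<subseteq> {..<n} \<and> (\<forall>b\<in>assignments. \<not> inR b \<longrightarrow> val b \<phi> = 1)}"
  have "\<exists>\<Delta> \<epsilon>. finite \<Delta> \<and> \<Delta> \<subseteq> \<Phi> \<and> \<epsilon> > 0 \<and> \<not> (\<exists>a\<in>assignments. inR a \<and> (\<forall>\<phi>\<in>\<Delta>. \<bar>val a \<phi> - 1\<bar> \<le> \<epsilon>))"
  proof (rule ccontr)
    assume neg: "\<not> ?thesis"
    have "\<exists>w\<in>assignments. \<exists>u\<in>assignments. inR u \<and> (\<forall>i<n. cl (w i) = cl (u i)) \<and> (\<forall>\<phi>\<in>\<Phi>. val w \<phi> = 1)"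
      by (rule saturation) (use neg in \<open>auto simp: \<Phi>_def\<close>)
    then obtain w u where wu: "w \<in> assignments" "inR u" "\<forall>i<n. cl (w i) = cl (u i)" "\<forall>\<phi>\<in>\<Phi>. val w \<phi> = 1"
      by (elim bexE conjE)
    have "inR w" using inR_cong[of w u] wu(2,3) by simp
    from separate[OF wu(1) this] show False using wu(4) by (auto simp: \<Phi>_def)
  qed
  then obtain \<Delta> \<epsilon> where \<Delta>: "finite \<Delta>" "\<Delta> \<subseteq> \<Phi>" "\<epsilon> > 0"
    "\<not> (\<exists>a\<in>assignments. inR a \<and> (\<forall>\<phi>\<in>\<Delta>. \<bar>val a \<phi> - 1\<bar> \<le> \<epsilon>))"
    by (elim exE conjE)
  obtain l where l: "set l = \<Delta>" using finite_list[OF \<Delta>(1)] by blast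
  define \<mu> where "\<mu> = formula_min l"
  define \<delta> where "\<delta> = min \<epsilon> 1"
  have \<delta>: "0 < \<delta>" "\<delta> \<le> \<epsilon>" "\<delta> \<le> 1" using \<Delta>(3) by (auto simp: \<delta>_def)
  have on_R: "val a \<mu> \<le> 1 - \<delta>" if a: "a \<in> assignments" "inR a" for a
  proof -
    obtain \<phi> where \<phi>: "\<phi> \<in> \<Delta>" "\<bar>val a \<phi> - 1\<bar> > \<epsilon>" using \<Delta>(4) a by (meson not_le)
    then have "val a \<phi> < 1 - \<delta>" using val_bounds[OF a(1), of \<phi>] \<delta>(2) by linarith
    moreover have "val a \<mu> \<le> val a \<phi>"
      using formula_min_ge_iff[of "val a \<mu>" G D a l] \<phi>(1) l by (simp add: \<mu>_def)
    ultimately show ?thesis by simp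
  qed
  have off_R: "val b \<mu> \<ge> 1" if "b \<in> assignments" "\<not> inR b" for b
    unfolding \<mu>_def formula_min_ge_iff using \<Delta>(2) l that by (auto simp: \<Phi>_def)
  from threshold_formula[of "1 - \<delta>" 1 \<mu>] \<delta> obtain \<psi> where \<psi>: "free_vars \<psi> = free_vars \<mu>"
    "\<forall>v\<in>assignments. (val v \<mu> \<le> 1 - \<delta> \<longrightarrow> val v \<psi> = 0) \<and> (val v \<mu> \<ge> 1 \<longrightarrow> val v \<psi> = 1)"
    by auto
  have "free_vars \<psi> \<subseteq> {..<n}"
    using \<psi>(1) \<Delta>(2) l by (auto simp: \<mu>_def free_vars_formula_min \<Phi>_def)
  moreover have "val v \<psi> = (if inR v then 0 else 1)" if "v \<in> assignments" for v
    using \<psi>(2) on_R off_R that by auto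
  ultimately show ?thesis unfolding inR_def by blast
qed

section \<open>Infinite orders from finite ones\<close>

text \<open>An \<open>n\<close>-sequence of \<open>k\<close>-tuples is stored as one sequence of variables, block \<open>i\<close> occupying the positions
  \<open>ki, \<dots>, ki + k - 1\<close>. The map sends the \<open>2k\<close> variables of a formula \<open>\<psi>(x, y)\<close> to the blocks \<open>i\<close> and \<open>j\<close>.\<close>

definition pair_index :: "nat \<Rightarrow> nat \<Rightarrow> nat \<Rightarrow> nat \<Rightarrow> nat" where
  "pair_index k i j m = (if m < k then k * i + m else k * j + (m - k))"

definition orders :: "nat \<Rightarrow> 'a set list set \<Rightarrow> nat \<Rightarrow> (nat \<Rightarrow> 'a set) \<Rightarrow> bool" where
  "orders k R n u \<longleftrightarrow> (\<forall>i<n. \<forall>j<n. map (u \<circ> pair_index k i j) [0..<2 * k] \<in> R \<longleftrightarrow> i < j)"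

lemma orders_mono: "orders k R n u \<Longrightarrow> m \<le> n \<Longrightarrow> orders k R m u"
  unfolding orders_def by (meson order_less_le_trans)

lemma pair_index_less: "i < n \<Longrightarrow> j < n \<Longrightarrow> m < 2 * k \<Longrightarrow> pair_index k i j m < k * n"
proof -
  assume a: "i < n" "j < n" "m < 2 * k"
  have "k * Suc i \<le> k * n" "k * Suc j \<le> k * n" using a by (intro mult_le_mono2; simp)+
  then show ?thesis using a by (auto simp: pair_index_def)
qed

lemma orders_cong:
  assumes "orders k R n u" "\<And>i. i < k * n \<Longrightarrow> y i = u i"
  shows "orders k R n y"
proof -
  have eq: "map (y \<circ> pair_index k i j) [0..<2 * k] = map (u \<circ> pair_index k i j) [0..<2 * k]"
    if "i < n" "j < n" for i j
    using assms(2) pair_index_less[OF that] by simp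
  show ?thesis
    unfolding orders_def
  proof (intro allI impI)
    fix i j assume "i < n" "j < n"
    then show "map (y \<circ> pair_index k i j) [0..<2 * k] \<in> R \<longleftrightarrow> i < j"
      using assms(1) unfolding orders_def by (simp only: eq)
  qed
qed

lemma orders_conjugate:
  assumes R: "(2 * k, R) \<in> invariants"
    and "\<alpha> \<in> Aut" and u: "u \<in> UNIV \<rightarrow> \<Omega>" and "orders k R n u"
  shows "orders k R n (\<lambda>i. \<alpha> ` u i)"
proof -
  have "map ((\<lambda>i. \<alpha> ` u i) \<circ> pair_index k i j) [0..<2 * k] \<in> R \<longleftrightarrow> map (u \<circ> pair_index k i j) [0..<2 * k] \<in> R"
    for i j
    by (rule invariant_relation_conjugate[OF R \<open>\<alpha> \<in> Aut\<close>, of _ _ "2 * k"]) (use u in auto)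
  then show ?thesis using assms(4) by (simp only: orders_def)
qed

text \<open>An argument as for Koenig's lemma: since there are only finitely many orbits of initial segments, some
  initial segment extends to arbitrarily long orders, and transitivity on its orbit lets one
  fix this segment before extending it. So already \<open>G/H\<close> itself, rather than some model of its theory,
  contains an infinite order.\<close>

lemma infinite_order:
  assumes R: "(2 * k, R) \<in> invariants"
    and finite_orders: "\<And>n. \<exists>u\<in>UNIV \<rightarrow> \<Omega>. orders k R n u"
  shows "\<exists>u\<in>UNIV \<rightarrow> \<Omega>. \<forall>n. orders k R n u"
proof -
  define E where "E N u \<longleftrightarrow> u \<in> UNIV \<rightarrow> \<Omega> \<and> (\<forall>n. \<exists>y\<in>UNIV \<rightarrow> \<Omega>. (\<forall>i<N. y i = u i) \<and> orders k R n y)" for N u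
  have step: "\<exists>y. E (Suc N) y \<and> (\<forall>i<N. y i = u i)" if "E N u" for N u
  proof -
    \<comment> \<open>Extensions of the segment fixed so far fall into finitely many orbits at the next length; one of these carries arbitrarily long orders.\<close>
    define C where "C = {y \<in> UNIV \<rightarrow> \<Omega>. \<forall>i<N. y i = u i}"
    have "C \<subseteq> UNIV \<rightarrow> \<Omega>" by (auto simp: C_def)
    from finite_orbit_representatives[OF this, of "Suc N"] obtain U where U: "finite U" "U \<subseteq> C"
      and rep: "\<forall>y\<in>C. \<exists>z\<in>U. \<exists>\<alpha>\<in>Aut. \<forall>i<Suc N. \<alpha> ` y i = z i"
      by (elim exE conjE)
    have "\<exists>z. z \<in> U \<and> (\<exists>y\<in>UNIV \<rightarrow> \<Omega>. (\<forall>i<Suc N. y i = z i) \<and> orders k R n y)" for n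
    proof -
      from \<open>E N u\<close> obtain y where y: "y \<in> UNIV \<rightarrow> \<Omega>" "\<forall>i<N. y i = u i" "orders k R n y"
        unfolding E_def by blast
      then have "y \<in> C" by (simp add: C_def)
      then obtain z \<alpha> where z: "z \<in> U" "\<alpha> \<in> Aut" "\<forall>i<Suc N. \<alpha> ` y i = z i"
        using bspec[OF rep \<open>y \<in> C\<close>] by (elim bexE)
      have "(\<lambda>i. \<alpha> ` y i) \<in> UNIV \<rightarrow> \<Omega>" using y(1) z(2) Aut_\<Omega> by auto
      moreover have "orders k R n (\<lambda>i. \<alpha> ` y i)" by (rule orders_conjugate[OF R z(2) y(1,3)])
      ultimately show ?thesis
        using z(1,3) by (intro exI[of _ z] conjI bexI[of _ "\<lambda>i. \<alpha> ` y i"]) auto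
    qed
    then have "\<exists>z. \<forall>n. z n \<in> U \<and> (\<exists>y\<in>UNIV \<rightarrow> \<Omega>. (\<forall>i<Suc N. y i = z n i) \<and> orders k R n y)"
      by (intro choice allI)
    then obtain z where z: "\<And>n. z n \<in> U" "\<And>n. \<exists>y\<in>UNIV \<rightarrow> \<Omega>. (\<forall>i<Suc N. y i = z n i) \<and> orders k R n y"
      by auto
    have "finite (range z)" by (rule finite_subset[OF _ U(1)]) (use z(1) in auto)
    then obtain n0 where n0: "infinite {n \<in> UNIV. z n = z n0}"
      using pigeonhole_infinite[of UNIV z] by auto
    have "\<exists>y\<in>UNIV \<rightarrow> \<Omega>. (\<forall>i<Suc N. y i = z n0 i) \<and> orders k R n y" for n
    proof -
      obtain m where m: "m > n" "z m = z n0"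
        using n0 unfolding infinite_nat_iff_unbounded by blast
      then obtain y where "y \<in> UNIV \<rightarrow> \<Omega>" "\<forall>i<Suc N. y i = z n0 i" "orders k R m y"
        using z(2)[of m] by (elim bexE conjE) simp
      then show ?thesis using orders_mono[of k R m y n] m(1) by (intro bexI[of _ y]) auto
    qed
    moreover have "z n0 \<in> C" using z(1) U(2) by blast
    ultimately have "E (Suc N) (z n0) \<and> (\<forall>i<N. z n0 i = u i)"
      by (simp add: E_def C_def)
    then show ?thesis by blast
  qed
  have "\<exists>u. E 0 u" 
  proof -
    obtain u :: "nat \<Rightarrow> 'a set" where "u \<in> UNIV \<rightarrow> \<Omega>" using finite_orders by blast
    then have "E 0 u" using finite_orders by (simp add: E_def)
    then show ?thesis by blast
  qed
  then have "\<exists>f. \<forall>N. E N (f N) \<and> (\<forall>i<N. f (Suc N) i = f N i)"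
    by (rule dependent_nat_choice) (rule step)
  then obtain f where f: "\<And>N. E N (f N)" "\<And>N i. i < N \<Longrightarrow> f (Suc N) i = f N i"
    by auto
  have stable: "f M i = f N i" if "N \<le> M" "i < N" for M N i
    using that(1) by (induction M rule: dec_induct) (use f(2) that(2) in auto)
  define y where "y i = f (Suc i) i" for i
  have y: "y i = f N i" if "i < N" for i N
    using stable[of "Suc i" N i] that by (simp add: y_def)
  have "f N \<in> UNIV \<rightarrow> \<Omega>" for N
    using f(1)[of N] unfolding E_def by (rule conjunct1)
  then have "y \<in> UNIV \<rightarrow> \<Omega>" by (auto simp: y_def Pi_iff)
  moreover have "orders k R n y" for n
  proof -
    obtain u where "\<forall>i<k * n. u i = f (k * n) i" "orders k R n u"
      using f(1)[of "k * n"] unfolding E_def by blast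
    then show ?thesis using y by (intro orders_cong[of k R n u y]) auto
  qed
  ultimately show ?thesis by blast
qed


section \<open>Formulas with the order property order the cosets\<close>

lemma Aut_inverse:
  assumes "\<alpha> \<in> Aut"
  shows "\<exists>\<beta>\<in>Aut. \<forall>C\<in>\<Omega>. \<beta> ` \<alpha> ` C = C"
proof -
  define \<beta> where "\<beta> = restrict (inv_into (carrier G) \<alpha>) (carrier G)"
  have \<alpha>: "\<alpha> \<in> hom G G" "\<alpha> \<in> Bij (carrier G)" "bij_betw \<alpha> (carrier G) (carrier G)"
    using assms by (auto simp: Aut_iff Bij_def)
  have inv: "\<beta> (\<alpha> x) = x" "\<alpha> (\<beta> x) = x" "\<beta> x \<in> carrier G" if "x \<in> carrier G" for x
    using that \<alpha>(3) Aut_closed[OF assms that]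
    by (auto simp: \<beta>_def bij_betw_def inv_into_into f_inv_into_f)
  have "D (\<beta> x) (\<beta> y) = D x y" if "x \<in> carrier G" "y \<in> carrier G" for x y
  proof -
    have "D (\<alpha> (\<beta> x)) (\<alpha> (\<beta> y)) = D (\<beta> x) (\<beta> y)"
      using assms inv(3) that by (simp add: Aut_iff)
    then show ?thesis using inv(2) that by simp
  qed
  then have "\<beta> \<in> Aut"
    using restrict_inv_into_hom[OF \<alpha>(1,2)] restrict_inv_into_Bij[OF \<alpha>(2)]
    by (simp add: Aut_iff Bij_def flip: \<beta>_def)
  moreover have "\<beta> ` \<alpha> ` C = C" if "C \<in> \<Omega>" for C
  proof -
    have "C \<subseteq> carrier G" using that by (auto simp: \<Omega>_eq in_cl_iff)
    then have "\<beta> (\<alpha> x) = x" if "x \<in> C" for x using inv(1) that by blast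
    then show ?thesis by (simp add: image_image)
  qed
  ultimately show ?thesis by blast
qed

lemma invariant_relationI:
  assumes R: "R \<subseteq> tuples n \<Omega>" and closed: "\<And>\<alpha> xs. \<lbrakk>\<alpha> \<in> Aut; xs \<in> R\<rbrakk> \<Longrightarrow> map ((`) \<alpha>) xs \<in> R"
  shows "(n, R) \<in> invariants"
proof -
  have "map ((`) \<alpha>) xs \<in> R \<longleftrightarrow> xs \<in> R" if \<alpha>: "\<alpha> \<in> Aut" and xs: "xs \<in> tuples n \<Omega>" for \<alpha> xs
  proof
    assume mR: "map ((`) \<alpha>) xs \<in> R"
    obtain \<beta> where \<beta>: "\<beta> \<in> Aut" "\<forall>C\<in>\<Omega>. \<beta> ` \<alpha> ` C = C" using Aut_inverse[OF \<alpha>] by blast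
    have "map ((`) \<beta>) (map ((`) \<alpha>) xs) = xs"
      using xs \<beta>(2) by (auto simp: tuples_def subset_iff intro!: map_idI)
    then show "xs \<in> R" using closed[OF \<beta>(1) mR] by simp
  qed (use closed \<alpha> in blast)
  then show ?thesis using R by (simp add: invariant_relations_def)
qed

lemma value_at_map:
  assumes "free_vars \<psi> \<subseteq> {..<n}"
  shows "value_at M e \<psi> (map v [0..<n]) = formula_value M e v \<psi>"
  unfolding value_at_def by (rule formula_value_cong) (use assms in auto)

lemma append_block_nth:
  assumes "length x = k" "length y = k" "m < 2 * k"
  shows "(x @ y) ! m = (if m < k then x ! m else y ! (m - k))"
  using assms by (simp add: nth_append)

lemma block_nth_pair_index:
  assumes "\<And>i. length (a i) = k" "m < 2 * k"
  shows "a (pair_index k i j m div k) ! (pair_index k i j m mod k) = (a i @ a j) ! m"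
proof (cases "m < k")
  case True
  then show ?thesis using assms by (simp add: pair_index_def append_block_nth)
next
  case False
  then obtain l where l: "m = k + l" using le_Suc_ex by (metis not_less)
  then have "l < k" using assms(2) by simp
  then show ?thesis using l assms(1) by (simp add: pair_index_def append_block_nth)
qed

text \<open>The model gives, for every \<open>n\<close>, an order of length \<open>n\<close> that \<open>G\<close> realises up to every \<open>\<epsilon>\<close>, hence exactly, by
  saturation. The relation on cosets is that of having representatives at which \<open>\<psi>\<close> vanishes. Slowness
  says exactly that it excludes all tuples at which \<open>\<psi>\<close> has the value \<open>1\<close>, so it orders the cosets.\<close>

lemma slow_order_property_imp_orders:
  assumes "has_slow_order_property TYPE('u) (1 / 2) G D"
  shows "\<exists>k R. (2 * k, R) \<in> invariants \<and> (\<exists>u\<in>UNIV \<rightarrow> \<Omega>. \<forall>n. orders k R n u)"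
proof -
  obtain k \<psi> and M :: "'u monoid" and e and a :: "nat \<Rightarrow> 'u list" where fv: "free_vars \<psi> \<subseteq> {..<2 * k}"
    and slow: "slow (1 / 2) G D (2 * k) \<psi>"
    and M: "continuous_model (continuous_theory G D) M e" and a: "\<forall>i. a i \<in> tuples k (carrier M)"
    and ord: "\<forall>i j. (value_at M e \<psi> (a i @ a j) = 0 \<longleftrightarrow> i < j) \<and> (value_at M e \<psi> (a i @ a j) = 1 \<longleftrightarrow> i \<ge> j)"
    using assms unfolding has_slow_order_property_def has_order_property_def by (elim exE conjE) (rule that)
  interpret M: bounded_metric_group M e
    using M by (intro bounded_metric_groupI) (simp add: continuous_model_def)
  define \<theta> where "\<theta> i j = (if i < j then rename \<psi> (pair_index k i j) else Compl (rename \<psi> (pair_index k i j)))" for i j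
  have \<theta>_val_M: "formula_value M e v (\<theta> i j) =
      (if i < j then formula_value M e (v \<circ> pair_index k i j) \<psi> else 1 - formula_value M e (v \<circ> pair_index k i j) \<psi>)"
    for v i j
    by (simp add: \<theta>_def formula_value_rename)
  have \<theta>_fv: "free_vars (\<theta> i j) \<subseteq> {..<k * n}" if "i < n" "j < n" for i j n
  proof -
    have "free_vars (\<theta> i j) = pair_index k i j ` free_vars \<psi>"
      by (simp add: \<theta>_def free_vars_rename)
    moreover have "pair_index k i j m < k * n" if "m < 2 * k" for m
      by (rule pair_index_less[OF \<open>i < n\<close> \<open>j < n\<close> that])
    ultimately show ?thesis using fv by (auto simp: subset_iff)
  qed
  have exact: "\<exists>w\<in>assignments. \<forall>i<n. \<forall>j<n. val w (\<theta> i j) = 0" for n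
  proof -
    define L where "L = map (\<lambda>(i, j). \<theta> i j) (List.product [0..<n] [0..<n])"
    have L: "set L = {\<theta> i j | i j. i < n \<and> j < n}"
      by (auto simp: L_def) blast
    define S where "S = inf_vars (k * n) (formula_max L)"
    have S_closed: "free_vars S = {}"
      using \<theta>_fv[of _ n] by (auto simp: S_def free_vars_inf_vars free_vars_formula_max L)
    have "\<exists>v\<in>M.assignments. M.val v S = 0"
    proof -
      define v where "v m = (if m < k * n then a (m div k) ! (m mod k) else \<one>\<^bsub>M\<^esub>)" for m
      have len: "length (a i) = k" for i using a by (simp add: tuples_def)
      have "v m \<in> carrier M" for m
      proof (cases "m < k * n")
        case True
        then have "m mod k < k" by (cases k) auto
        then have "a (m div k) ! (m mod k) \<in> set (a (m div k))" by (simp add: len)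
        then show ?thesis using True a by (auto simp: v_def tuples_def)
      qed (simp add: v_def)
      then have v: "v \<in> M.assignments" by auto
      have "M.val v (\<theta> i j) = 0" if "i < n" "j < n" for i j
      proof -
        have "M.val (v \<circ> pair_index k i j) \<psi> = value_at M e \<psi> (a i @ a j)"
          unfolding value_at_def
        proof (rule formula_value_cong)
          fix m assume "m \<in> free_vars \<psi>"
          then have m: "m < 2 * k" using fv by auto
          show "(v \<circ> pair_index k i j) m = (a i @ a j) ! m"
            using block_nth_pair_index[of a k m i j, OF len m] pair_index_less[OF that m] by (simp add: v_def)
        qed
        then show ?thesis using ord by (auto simp: \<theta>_val_M)
      qed
      then have "M.val v (formula_max L) \<le> 0"
        by (auto simp: formula_max_le_iff L)
      then have "M.val v S \<le> 0"
        using M.val_inf_vars_le[OF v, of "k * n" "formula_max L"] by (simp add: S_def)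
      then show ?thesis using M.val_nonneg[OF v, of S] v by force
    qed
    then obtain v where v: "v \<in> M.assignments" "M.val v S = 0" by blast
    obtain w where w: "w \<in> assignments" using one_closed by (metis Pi_I)
    have "val w S = 0"
    proof (rule ccontr)
      assume "val w S \<noteq> 0"
      then have "0 < val w S" using val_nonneg[OF w, of S] by simp
      then obtain q where q: "0 < (of_rat q :: real)" "of_rat q < val w S" using of_rat_dense by blast
      then have "(of_rat q :: real) < 1" using val_le_1[OF w, of S] by linarith
      then have q01: "0 \<le> q" "q \<le> 1" using q(1) by simp_all
      \<comment> \<open>A positive value of \<open>S\<close> in \<open>G\<close> would be recorded in the theory by a rational lower bound.\<close>
      have "condition_holds G D (Monus (const q) S)"
        unfolding condition_holds_def
      proof
        fix w' assume "w' \<in> assignments"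
        have "val w' S = val w S" by (rule formula_value_cong) (simp add: S_closed)
        then show "val w' (Monus (const q) S) = 0" using q q01 by (simp add: formula_value_const)
      qed
      then have "Monus (const q) S \<in> continuous_theory G D"
        by (simp add: continuous_theory_def S_closed free_vars_const)
      then have "condition_holds M e (Monus (const q) S)" using M by (simp add: continuous_model_def)
      then have "M.val v (Monus (const q) S) = 0" using v(1) by (simp add: condition_holds_def)
      then show False using v(2) q q01 by (simp add: formula_value_const)
    qed
    have "\<exists>w\<in>assignments. \<exists>u\<in>assignments. True \<and> (\<forall>i<k * n. cl (w i) = cl (u i)) \<and> (\<forall>\<phi>\<in>set L. val w \<phi> = 0)"
    proof (rule saturation)
      show "free_vars \<phi> \<subseteq> {..<k * n}" if "\<phi> \<in> set L" for \<phi>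
        using that \<theta>_fv by (auto simp: L)
    next
      fix \<Delta> and \<epsilon> :: real assume \<Delta>: "finite \<Delta>" "\<Delta> \<subseteq> set L" "\<epsilon> > 0"
      have "val w S < \<epsilon>" using \<open>val w S = 0\<close> \<Delta>(3) by simp
      then obtain w' where w': "w' \<in> assignments" "val w' (formula_max L) < \<epsilon>"
        using val_inf_vars_less[OF w] unfolding S_def by blast
      have "\<forall>\<phi>\<in>set L. val w' \<phi> \<le> \<epsilon>"
        using formula_max_le_iff[of G D w' L \<epsilon>] w'(2) by simp
      then show "\<exists>v\<in>assignments. True \<and> (\<forall>\<phi>\<in>\<Delta>. \<bar>val v \<phi> - 0\<bar> \<le> \<epsilon>)"
        using w'(1) \<Delta>(2) val_nonneg[OF w'(1)] by (intro bexI[of _ w']) auto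
    qed
    then obtain x where x: "x \<in> assignments" "\<forall>\<phi>\<in>set L. val x \<phi> = 0"
      by (elim bexE conjE)
    have "val x (\<theta> i j) = 0" if "i < n" "j < n" for i j
    proof (rule bspec[OF x(2)])
      show "\<theta> i j \<in> set L" unfolding L using that by blast
    qed
    then show ?thesis using x(1) by (intro bexI[of _ x]) auto
  qed
  define R where "R = (\<lambda>v. map (cl \<circ> v) [0..<2 * k]) ` {v \<in> assignments. val v \<psi> = 0}"
  have "(2 * k, R) \<in> invariants"
  proof (rule invariant_relationI)
    show "R \<subseteq> tuples (2 * k) \<Omega>" by (auto simp: R_def tuples_def cl_in Pi_iff)
  next
    fix \<alpha> xs assume \<alpha>: "\<alpha> \<in> Aut" and "xs \<in> R"
    then obtain v where v: "v \<in> assignments" "val v \<psi> = 0" "xs = map (cl \<circ> v) [0..<2 * k]"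
      by (auto simp: R_def)
    have "map ((`) \<alpha>) xs = map (cl \<circ> (\<alpha> \<circ> v)) [0..<2 * k]"
      using v(1,3) Aut_cl[OF \<alpha>] by auto
    moreover have "\<alpha> \<circ> v \<in> assignments" "val (\<alpha> \<circ> v) \<psi> = 0"
      using assignment_Aut[OF \<alpha> v(1)] Aut_val[OF \<alpha> v(1)] v(2) by auto
    ultimately show "map ((`) \<alpha>) xs \<in> R" unfolding R_def by blast
  qed
  moreover have "\<exists>u\<in>UNIV \<rightarrow> \<Omega>. orders k R n u" for n
  proof -
    obtain w where w: "w \<in> assignments" "\<forall>i<n. \<forall>j<n. val w (\<theta> i j) = 0" using exact by blast
    have "map ((cl \<circ> w) \<circ> pair_index k i j) [0..<2 * k] \<in> R \<longleftrightarrow> i < j" if ij: "i < n" "j < n" for i j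
    proof -
      let ?w = "w \<circ> pair_index k i j"
      have wa: "?w \<in> assignments" using w(1) by auto
      have \<theta>0: "val w (\<theta> i j) = 0" using w(2) ij by blast
      show ?thesis
      proof
        assume "i < j"
        then have "val ?w \<psi> = 0" using \<theta>0 by (simp add: \<theta>_def formula_value_rename)
        then show "map ((cl \<circ> w) \<circ> pair_index k i j) [0..<2 * k] \<in> R"
          unfolding R_def comp_assoc using wa by blast
      next
        assume "map ((cl \<circ> w) \<circ> pair_index k i j) [0..<2 * k] \<in> R"
        then obtain v where v: "v \<in> assignments" "val v \<psi> = 0" "map (cl \<circ> ?w) [0..<2 * k] = map (cl \<circ> v) [0..<2 * k]"
          unfolding R_def comp_assoc by blast
        show "i < j"
        proof (rule ccontr)
          assume "\<not> i < j"
          then have "val (w \<circ> pair_index k i j) \<psi> = 1"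
            using \<theta>0 by (simp add: \<theta>_def formula_value_rename)
          moreover have "D (v l) (?w l) \<le> 1 / 2" if l: "l < 2 * k" for l
          proof -
            have "map (cl \<circ> ?w) [0..<2 * k] ! l = map (cl \<circ> v) [0..<2 * k] ! l"
              by (rule arg_cong[OF v(3)])
            then have "cl (v l) = cl (?w l)" using l by simp
            moreover have "v l \<in> carrier G" "?w l \<in> carrier G" using v(1) wa by auto
            ultimately show ?thesis using near_iff by blast
          qed
          moreover have "map v [0..<2 * k] \<in> tuples (2 * k) (carrier G)" "map ?w [0..<2 * k] \<in> tuples (2 * k) (carrier G)"
            using v(1) wa by (auto simp: tuples_def)
          ultimately show False
            using slow v(2) unfolding slow_def
            by (elim notE) (intro bexI[of _ "map v [0..<2 * k]"] bexI[of _ "map ?w [0..<2 * k]"],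
              auto simp: value_at_map[OF fv])
        qed
      qed
    qed
    then have "orders k R n (cl \<circ> w)" by (simp only: orders_def) blast
    moreover have "cl \<circ> w \<in> UNIV \<rightarrow> \<Omega>" using w(1) by (simp add: cl_in Pi_iff)
    ultimately show ?thesis by blast
  qed
  ultimately show ?thesis using infinite_order by blast
qed

text \<open>A formula defining an invariant relation of cosets is constant on tuples of cosets, and therefore
  \<open>1/2\<close>-slow.\<close>

lemma orders_imp_slow_order_property:
  fixes f :: "'a \<Rightarrow> 'u"
  assumes G: "metric_group_structure G D" and f: "inj_on f (carrier G)"
    and R: "(2 * k, R) \<in> invariants" and u: "u \<in> UNIV \<rightarrow> \<Omega>" "\<And>n. orders k R n u"
  shows "has_slow_order_property TYPE('u) (1 / 2) G D"
proof -
  obtain \<psi> where \<psi>: "free_vars \<psi> \<subseteq> {..<2 * k}"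
    "\<forall>v\<in>assignments. val v \<psi> = (if map (cl \<circ> v) [0..<2 * k] \<in> R then 0 else 1)"
    using invariant_relation_definable[OF R] by blast
  have lists: "\<exists>v\<in>assignments. b = map v [0..<n]" if "b \<in> tuples n (carrier G)" for b n
  proof (intro bexI)
    let ?v = "\<lambda>i. if i < n then b ! i else \<one>"
    show "b = map ?v [0..<n]" using that by (auto simp: tuples_def intro: nth_equalityI)
    show "?v \<in> assignments" using that nth_mem[of _ b] by (auto simp: tuples_def subset_iff)
  qed
  have "slow (1 / 2) G D (2 * k) \<psi>"
    unfolding slow_def
  proof (rule notI, elim bexE conjE)
    fix b b' assume b: "b \<in> tuples (2 * k) (carrier G)" "b' \<in> tuples (2 * k) (carrier G)"
      and near: "\<forall>i<2 * k. D (b ! i) (b' ! i) \<le> 1 / 2"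
      and val0: "value_at G D \<psi> b = 0" and val1: "value_at G D \<psi> b' = 1"
    obtain v where v: "v \<in> assignments" "b = map v [0..<2 * k]" using lists[OF b(1)] by blast
    obtain v' where v': "v' \<in> assignments" "b' = map v' [0..<2 * k]" using lists[OF b(2)] by blast
    have "cl (v i) = cl (v' i)" if "i < 2 * k" for i
    proof -
      have "D (v i) (v' i) \<le> 1 / 2" using near that v(2) v'(2) by simp
      moreover have "v i \<in> carrier G" "v' i \<in> carrier G" using v(1) v'(1) by auto
      ultimately show ?thesis using near_iff by blast
    qed
    then have "map (cl \<circ> v) [0..<2 * k] = map (cl \<circ> v') [0..<2 * k]" by simp
    then have "val v \<psi> = val v' \<psi>" using bspec[OF \<psi>(2) v(1)] bspec[OF \<psi>(2) v'(1)] by metis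
    then show False using val0 val1 v(2) v'(2) by (simp add: value_at_map[OF \<psi>(1)])
  qed
  moreover have "has_order_property TYPE('u) (continuous_theory G D) k \<psi>"
  proof -
    obtain N :: "'u monoid" and e' where N: "metric_group_structure N e'" and iso: "f \<in> iso G N"
      and isom: "\<forall>x\<in>carrier G. \<forall>y\<in>carrier G. e' (f x) (f y) = D x y"
      using metric_group_copy[OF G f] by blast
    have N_group: "group N" using N by (simp add: metric_group_structure_def)
    have carrier_N: "carrier N = f ` carrier G" using iso by (auto simp: iso_def bij_betw_def)
    have iso_val: "formula_value N e' (f \<circ> v) \<phi> = val v \<phi>" if "v \<in> assignments" for v \<phi>
      by (rule formula_value_iso[OF bounded_metric_group_axioms iso N_group]) (use isom that in auto)
    have "condition_holds N e' \<phi>" if \<phi>: "\<phi> \<in> continuous_theory G D" for \<phi>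
      unfolding condition_holds_def
    proof
      fix v :: "nat \<Rightarrow> 'u" assume v: "v \<in> UNIV \<rightarrow> carrier N"
      define v' where "v' = inv_into (carrier G) f \<circ> v"
      have vi: "v i \<in> f ` carrier G" for i using v carrier_N by auto
      have "v' \<in> assignments" using vi by (auto simp: v'_def inv_into_into)
      moreover have "f \<circ> v' = v" using vi by (auto simp: v'_def f_inv_into_f)
      ultimately show "formula_value N e' v \<phi> = 0"
        using iso_val[of v' \<phi>] \<phi> by (simp add: continuous_theory_def condition_holds_def)
    qed
    then have model: "continuous_model (continuous_theory G D) N e'"
      using N by (simp add: continuous_model_def)
    have "\<exists>x. x \<in> carrier G \<and> cl x = u l" for l
    proof -
      have "u l \<in> \<Omega>" using u(1) by auto
      then show ?thesis by (auto simp: \<Omega>_eq)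
    qed
    then obtain x where x: "\<And>l. x l \<in> carrier G" "\<And>l. cl (x l) = u l" by metis
    have xa: "x \<in> assignments" using x(1) by auto
    define a where "a i = map (\<lambda>m. f (x (k * i + m))) [0..<k]" for i
    have a_tuples: "a i \<in> tuples k (carrier N)" for i
      using x(1) by (auto simp: a_def tuples_def carrier_N)
    have a_val: "value_at N e' \<psi> (a i @ a j) = (if i < j then 0 else 1)" for i j
    proof -
      have "value_at N e' \<psi> (a i @ a j) = formula_value N e' (f \<circ> (x \<circ> pair_index k i j)) \<psi>"
        unfolding value_at_def
      proof (rule formula_value_cong)
        fix m assume "m \<in> free_vars \<psi>"
        then have "m < 2 * k" using \<psi>(1) by auto
        then show "(a i @ a j) ! m = (f \<circ> (x \<circ> pair_index k i j)) m"
          by (auto simp: a_def nth_append pair_index_def)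
      qed
      also have "\<dots> = val (x \<circ> pair_index k i j) \<psi>" by (rule iso_val) (use x(1) in auto)
      also have "\<dots> = (if map (cl \<circ> (x \<circ> pair_index k i j)) [0..<2 * k] \<in> R then 0 else 1)"
        by (rule bspec[OF \<psi>(2)]) (use x(1) in auto)
      also have "cl \<circ> (x \<circ> pair_index k i j) = u \<circ> pair_index k i j"
        using x(2) by auto
      also have "map (u \<circ> pair_index k i j) [0..<2 * k] \<in> R \<longleftrightarrow> i < j"
        using u(2)[of "Suc (max i j)"] by (simp add: orders_def less_Suc_eq_le)
      finally show ?thesis .
    qed
    show ?thesis
      unfolding has_order_property_def
      by (intro exI[of _ N] exI[of _ e'] exI[of _ a] conjI allI model a_tuples) (auto simp: a_val)
  qed
  ultimately show ?thesis
    using \<psi>(1) unfolding has_slow_order_property_def by blast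
qed

section \<open>Instability of the structure on the cosets\<close>

text \<open>A formula of first-order logic defines an invariant relation on \<open>G/H\<close>. Orders of each finite length
  are expressed by a sentence, and so pass from the model to \<open>G/H\<close>.\<close>

lemma unstable_imp_orders:
  assumes "\<not> induced_structure_stable TYPE('u) (isometric_automorphisms G D) \<Omega> (`)"
  shows "\<exists>k R. (2 * k, R) \<in> invariants \<and> (\<exists>u\<in>UNIV \<rightarrow> \<Omega>. \<forall>n. orders k R n u)"
proof -
  obtain k \<theta> and A :: "'u set" and I and a :: "nat \<Rightarrow> 'u list" where wf: "fo_wf invariants fst \<theta>" and fv: "fo_free_vars \<theta> \<subseteq> {..<2 * k}"
    and A: "fo_model invariants fst (fo_theory invariants fst \<Omega> snd) A I"
    and a: "\<forall>i. a i \<in> tuples k A" and ord: "\<forall>i j. fo_sat A I (\<lambda>m. (a i @ a j) ! m) \<theta> \<longleftrightarrow> i < j"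
    using assms unfolding induced_structure_stable_def fo_stable_def not_not by (elim exE conjE) (rule that)
  have A_ne: "A \<noteq> {}" using A by (simp add: fo_model_def fo_structure_def)
  have \<Omega>_ne: "\<Omega> \<noteq> {}" using cl_in one_closed by blast
  define R where "R = (\<lambda>v. map v [0..<2 * k]) ` {v \<in> UNIV \<rightarrow> \<Omega>. fo_sat \<Omega> snd v \<theta>}"
  have "(2 * k, R) \<in> invariants"
  proof (rule invariant_relationI)
    show "R \<subseteq> tuples (2 * k) \<Omega>" by (auto simp: R_def tuples_def Pi_iff)
  next
    fix \<alpha> xs assume \<alpha>: "\<alpha> \<in> Aut" and "xs \<in> R"
    then obtain v where v: "v \<in> UNIV \<rightarrow> \<Omega>" "fo_sat \<Omega> snd v \<theta>" "xs = map v [0..<2 * k]"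
      by (auto simp: R_def)
    obtain \<beta> where \<beta>: "\<beta> \<in> Aut" "\<forall>C\<in>\<Omega>. \<beta> ` \<alpha> ` C = C" using Aut_inverse[OF \<alpha>] by blast
    obtain \<gamma> where \<gamma>: "\<gamma> \<in> Aut" "\<forall>C\<in>\<Omega>. \<gamma> ` \<beta> ` C = C" using Aut_inverse[OF \<beta>(1)] by blast
    have \<alpha>\<beta>: "\<alpha> ` \<beta> ` C = C" if C: "C \<in> \<Omega>" for C
    proof -
      have "\<alpha> ` \<beta> ` C \<in> \<Omega>" using \<alpha> \<beta>(1) C Aut_\<Omega> by blast
      then have "\<alpha> ` \<beta> ` C = \<gamma> ` \<beta> ` \<alpha> ` \<beta> ` C" using \<gamma>(2) by simp
      also have "\<dots> = \<gamma> ` \<beta> ` C" using \<beta>(2) Aut_\<Omega>[OF \<beta>(1) C] by simp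
      also have "\<dots> = C" using \<gamma>(2) C by simp
      finally show ?thesis .
    qed
    have bij: "bij_betw ((`) \<alpha>) \<Omega> \<Omega>"
      by (rule bij_betw_byWitness[where f' = "(`) \<beta>"]) (use \<alpha> \<beta> \<alpha>\<beta> Aut_\<Omega> in auto)
    have "fo_sat \<Omega> snd ((`) \<alpha> \<circ> v) \<theta> \<longleftrightarrow> fo_sat \<Omega> snd v \<theta>"
      by (rule fo_sat_iso[OF bij _ v(1) wf]) (use \<alpha> in \<open>auto simp: invariant_relations_def\<close>)
    moreover have "(`) \<alpha> \<circ> v \<in> UNIV \<rightarrow> \<Omega>" using v(1) \<alpha> Aut_\<Omega> by (auto simp: Pi_iff)
    moreover have "map ((`) \<alpha>) xs = map ((`) \<alpha> \<circ> v) [0..<2 * k]" using v(3) by simp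
    ultimately show "map ((`) \<alpha>) xs \<in> R" unfolding R_def using v(2) by blast
  qed
  moreover have "\<exists>u\<in>UNIV \<rightarrow> \<Omega>. orders k R n u" for n
  proof -
    define \<eta> where "\<eta> i j = (if i < j then fo_rename \<theta> (pair_index k i j) else FONot (fo_rename \<theta> (pair_index k i j)))" for i j
    define L where "L = map (\<lambda>(i, j). \<eta> i j) (List.product [0..<n] [0..<n])"
    have L: "set L = {\<eta> i j | i j. i < n \<and> j < n}" by (auto simp: L_def) blast
    define S where "S = fo_exs (k * n) (fo_conj L)"
    have \<eta>_fv: "fo_free_vars (\<eta> i j) \<subseteq> {..<k * n}" if "i < n" "j < n" for i j
    proof -
      have "fo_free_vars (\<eta> i j) = pair_index k i j ` fo_free_vars \<theta>"
        by (simp add: \<eta>_def fo_free_vars_rename)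
      moreover have "pair_index k i j m < k * n" if "m < 2 * k" for m
      by (rule pair_index_less[OF \<open>i < n\<close> \<open>j < n\<close> that])
    ultimately show ?thesis using fv by (auto simp: subset_iff)
    qed
    have S_closed: "fo_free_vars S = {}"
      using \<eta>_fv by (auto simp: S_def fo_free_vars_exs fo_free_vars_conj L)
    have S_wf: "fo_wf invariants fst S"
      using wf by (auto simp: S_def fo_wf_exs fo_wf_conj L \<eta>_def fo_wf_rename)
    have "\<exists>v\<in>UNIV \<rightarrow> A. fo_sat A I v S"
    proof -
      define v where "v m = (if m < k * n then a (m div k) ! (m mod k) else (SOME x. x \<in> A))" for m
      have len: "length (a i) = k" for i using a by (simp add: tuples_def)
      have "v m \<in> A" for m
      proof (cases "m < k * n")
        case True
        then have "m mod k < k" by (cases k) auto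
        then have "a (m div k) ! (m mod k) \<in> set (a (m div k))" by (simp add: len)
        then show ?thesis using True a by (auto simp: v_def tuples_def)
      qed (use A_ne in \<open>simp add: v_def some_in_eq\<close>)
      then have v: "v \<in> UNIV \<rightarrow> A" by auto
      have "fo_sat A I v (\<eta> i j)" if "i < n" "j < n" for i j
      proof -
        have "fo_sat A I (v \<circ> pair_index k i j) \<theta> \<longleftrightarrow> fo_sat A I (\<lambda>m. (a i @ a j) ! m) \<theta>"
        proof (rule fo_sat_cong)
          fix m assume "m \<in> fo_free_vars \<theta>"
          then have m: "m < 2 * k" using fv by auto
          show "(v \<circ> pair_index k i j) m = (a i @ a j) ! m"
            using block_nth_pair_index[of a k m i j, OF len m] pair_index_less[OF that m] by (simp add: v_def)
        qed
        then show ?thesis using ord by (simp add: \<eta>_def fo_sat_rename)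
      qed
      then have "fo_sat A I v (fo_conj L)" by (auto simp: fo_sat_conj[OF A_ne] L)
      then show ?thesis unfolding S_def using v fo_sat_exsI by blast
    qed
    then obtain v where v: "v \<in> UNIV \<rightarrow> A" "fo_sat A I v S" by blast
    have "fo_valid \<Omega> snd S"
    proof (rule ccontr)
      assume "\<not> fo_valid \<Omega> snd S"
      then obtain w where w: "\<not> fo_sat \<Omega> snd w S" by (auto simp: fo_valid_def)
      have "fo_sat \<Omega> snd w' S \<longleftrightarrow> fo_sat \<Omega> snd w S" for w'
        by (rule fo_sat_cong) (simp add: S_closed)
      then have "FONot S \<in> fo_theory invariants fst \<Omega> snd"
        using w S_wf S_closed by (simp add: fo_theory_def fo_valid_def)
      then have "fo_valid A I (FONot S)" using A by (simp add: fo_model_def)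
      then show False using v by (simp add: fo_valid_def)
    qed
    moreover obtain C where "C \<in> \<Omega>" using \<Omega>_ne by blast
    ultimately have "fo_sat \<Omega> snd (\<lambda>_. C) S" by (simp add: fo_valid_def)
    then obtain w where w: "w \<in> UNIV \<rightarrow> \<Omega>" "fo_sat \<Omega> snd w (fo_conj L)"
      unfolding S_def using fo_sat_exsD[of "\<lambda>_. C" \<Omega>] \<open>C \<in> \<Omega>\<close> by blast
    have "map (w \<circ> pair_index k i j) [0..<2 * k] \<in> R \<longleftrightarrow> i < j" if ij: "i < n" "j < n" for i j
    proof -
      let ?w = "w \<circ> pair_index k i j"
      have "fo_sat \<Omega> snd w (\<eta> i j)" using w(2) ij by (auto simp: fo_sat_conj[OF \<Omega>_ne] L)
      then have sat: "fo_sat \<Omega> snd ?w \<theta> \<longleftrightarrow> i < j" by (simp add: \<eta>_def fo_sat_rename split: if_splits)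
      have wa: "?w \<in> UNIV \<rightarrow> \<Omega>" using w(1) by auto
      have "map ?w [0..<2 * k] \<in> R \<longleftrightarrow> fo_sat \<Omega> snd ?w \<theta>"
      proof
        assume "map ?w [0..<2 * k] \<in> R"
        then obtain v where v: "fo_sat \<Omega> snd v \<theta>" "map ?w [0..<2 * k] = map v [0..<2 * k]"
          unfolding R_def by blast
        have "fo_sat \<Omega> snd ?w \<theta> \<longleftrightarrow> fo_sat \<Omega> snd v \<theta>"
        proof (rule fo_sat_cong)
          fix m assume "m \<in> fo_free_vars \<theta>"
          then have "m < 2 * k" using fv by auto
          moreover have "map ?w [0..<2 * k] ! m = map v [0..<2 * k] ! m"
            by (rule arg_cong[OF v(2)])
          ultimately show "?w m = v m" by simp
        qed
        then show "fo_sat \<Omega> snd ?w \<theta>" using v(1) by simp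
      next
        assume "fo_sat \<Omega> snd ?w \<theta>"
        then show "map ?w [0..<2 * k] \<in> R" unfolding R_def using wa by blast
      qed
      then show ?thesis using sat by simp
    qed
    then have "orders k R n w" by (simp only: orders_def) blast
    then show ?thesis using w(1) by blast
  qed
  ultimately show ?thesis using infinite_order by blast
qed

text \<open>The ordering relation is itself a symbol of the language, so \<open>G/H\<close> moved to the prescribed type is already an unstable model.\<close>

lemma orders_imp_unstable:
  fixes g :: "'a set \<Rightarrow> 'u"
  assumes g: "inj_on g \<Omega>" and R: "(2 * k, R) \<in> invariants" and u: "u \<in> UNIV \<rightarrow> \<Omega>" "\<And>n. orders k R n u"
  shows "\<not> induced_structure_stable TYPE('u) (isometric_automorphisms G D) \<Omega> (`)"
proof -
  define I where "I r = map g ` snd r" for r :: "nat \<times> 'a set list set"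
  have bij: "bij_betw g \<Omega> (g ` \<Omega>)" using g by (simp add: bij_betw_def)
  have sub: "snd r \<subseteq> tuples (fst r) \<Omega>" if "r \<in> invariants" for r
    using that by (auto simp: invariant_relations_def)
  have I_iff: "map g xs \<in> I r \<longleftrightarrow> xs \<in> snd r" if r: "r \<in> invariants" and xs: "xs \<in> tuples (fst r) \<Omega>" for r xs
  proof
    assume "map g xs \<in> I r"
    then obtain ys where ys: "ys \<in> snd r" "map g xs = map g ys" by (auto simp: I_def)
    have "set xs \<subseteq> \<Omega>" "set ys \<subseteq> \<Omega>" using xs sub[OF r] ys(1) by (auto simp: tuples_def)
    then have "inj_on g (set xs \<union> set ys)" using g by (meson Un_least inj_on_subset)
    then have "xs = ys" using ys(2) inj_on_map_eq_map by blast
    then show "xs \<in> snd r" using ys(1) by simp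
  qed (auto simp: I_def)
  have sat: "fo_sat (g ` \<Omega>) I (g \<circ> v) \<theta> \<longleftrightarrow> fo_sat \<Omega> snd v \<theta>"
    if "v \<in> UNIV \<rightarrow> \<Omega>" "fo_wf invariants fst \<theta>" for v \<theta>
    by (rule fo_sat_iso[OF bij _ that]) (rule I_iff)
  have "fo_structure invariants fst (g ` \<Omega>) I"
    unfolding fo_structure_def
  proof (intro conjI ballI)
    show "g ` \<Omega> \<noteq> {}" using cl_in one_closed by blast
    fix r assume "r \<in> invariants"
    then show "I r \<subseteq> tuples (fst r) (g ` \<Omega>)"
      using sub[of r] by (fastforce simp: I_def tuples_def)
  qed
  moreover have "fo_valid (g ` \<Omega>) I \<theta>" if \<theta>: "\<theta> \<in> fo_theory invariants fst \<Omega> snd" for \<theta>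
    unfolding fo_valid_def
  proof
    fix v :: "nat \<Rightarrow> 'u" assume v: "v \<in> UNIV \<rightarrow> g ` \<Omega>"
    define v' where "v' = inv_into \<Omega> g \<circ> v"
    have vi: "v i \<in> g ` \<Omega>" for i using v by auto
    have "v' i \<in> \<Omega>" for i unfolding v'_def comp_apply by (rule inv_into_into[OF vi])
    then have "v' \<in> UNIV \<rightarrow> \<Omega>" by blast
    moreover have "g \<circ> v' = v" using vi by (auto simp: v'_def f_inv_into_f fun_eq_iff simp del: FactGroup_def)
    ultimately show "fo_sat (g ` \<Omega>) I v \<theta>"
      using sat[of v' \<theta>] \<theta> by (simp add: fo_theory_def fo_valid_def)
  qed
  ultimately have model: "fo_model invariants fst (fo_theory invariants fst \<Omega> snd) (g ` \<Omega>) I"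
    by (simp add: fo_model_def)
  define \<theta> where "\<theta> = FORel (2 * k, R) [0..<2 * k]"
  have wf: "fo_wf invariants fst \<theta>" using R by (simp add: \<theta>_def)
  have fv: "fo_free_vars \<theta> \<subseteq> {..<2 * k}" by (auto simp: \<theta>_def)
  define a where "a i = map (\<lambda>m. g (u (k * i + m))) [0..<k]" for i
  have a_tuples: "a i \<in> tuples k (g ` \<Omega>)" for i using u(1) by (auto simp: a_def tuples_def)
  have a_sat: "fo_sat (g ` \<Omega>) I (\<lambda>m. (a i @ a j) ! m) \<theta> \<longleftrightarrow> i < j" for i j
  proof -
    have "fo_sat (g ` \<Omega>) I (\<lambda>m. (a i @ a j) ! m) \<theta> \<longleftrightarrow> fo_sat (g ` \<Omega>) I (g \<circ> (u \<circ> pair_index k i j)) \<theta>"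
    proof (rule fo_sat_cong)
      fix m assume "m \<in> fo_free_vars \<theta>"
      then have "m < 2 * k" using fv by auto
      then show "(a i @ a j) ! m = (g \<circ> (u \<circ> pair_index k i j)) m"
        by (auto simp: a_def nth_append pair_index_def)
    qed
    also have "\<dots> \<longleftrightarrow> fo_sat \<Omega> snd (u \<circ> pair_index k i j) \<theta>"
      by (rule sat[OF _ wf]) (use u(1) in auto)
    also have "\<dots> \<longleftrightarrow> map (u \<circ> pair_index k i j) [0..<2 * k] \<in> R"
      by (simp only: \<theta>_def fo_sat.simps snd_conv)
    also have "\<dots> \<longleftrightarrow> i < j"
      using u(2)[of "Suc (max i j)"] by (simp add: orders_def less_Suc_eq_le)
    finally show ?thesis .
  qed
  show ?thesis
    unfolding induced_structure_stable_def fo_stable_def not_not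
    using wf fv model a_tuples a_sat by blast
qed

text \<open>Both sides amount to the existence of an invariant relation that orders an infinite sequence of tuples
  of cosets.\<close>

theorem slow_order_property_iff_unstable:
  fixes f :: "'a \<Rightarrow> 'u" and g :: "'a set \<Rightarrow> 'u"
  assumes "metric_group_structure G D" "inj_on f (carrier G)" "inj_on g \<Omega>"
  shows "has_slow_order_property TYPE('u) (1 / 2) G D \<longleftrightarrow>
    \<not> induced_structure_stable TYPE('u) (isometric_automorphisms G D) \<Omega> (`)"
proof
  assume "has_slow_order_property TYPE('u) (1 / 2) G D"
  from slow_order_property_imp_orders[OF this] obtain k R u
    where "(2 * k, R) \<in> invariants" "u \<in> UNIV \<rightarrow> \<Omega>" "\<forall>n. orders k R n u" by blast
  then show "\<not> induced_structure_stable TYPE('u) (isometric_automorphisms G D) \<Omega> (`)"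
    using orders_imp_unstable[OF assms(3)] by blast
next
  assume "\<not> induced_structure_stable TYPE('u) (isometric_automorphisms G D) \<Omega> (`)"
  from unstable_imp_orders[OF this] obtain k R u
    where "(2 * k, R) \<in> invariants" "u \<in> UNIV \<rightarrow> \<Omega>" "\<forall>n. orders k R n u" by blast
  then show "has_slow_order_property TYPE('u) (1 / 2) G D"
    using orders_imp_slow_order_property[OF assms(1,2)] by blast
qed

end

section \<open>The metric extended from the subgroup\<close>

text \<open>It remains to check that the metric \<open>d\<^sup>*\<close> of the theorem has the properties isolated above. Its right
  invariance comes from the conjugation invariance of \<open>d\<close>, and the description of cosets by distances from the
  bound \<open>1/2\<close> on \<open>d\<close>.\<close>

locale metrised_normal_subgroup = normal H G + Metric_space H d
  for H and G :: "('a, 'm) monoid_scheme" (structure) and d :: "'a \<Rightarrow> 'a \<Rightarrow> real" +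
  assumes half_bounded: "\<lbrakk>x \<in> H; y \<in> H\<rbrakk> \<Longrightarrow> d x y \<le> 1 / 2"
    and left_invariant_on: "\<lbrakk>h \<in> H; x \<in> H; y \<in> H\<rbrakk> \<Longrightarrow> d (h \<otimes> x) (h \<otimes> y) = d x y"
    and conjugation_invariant: "\<lbrakk>g \<in> carrier G; x \<in> H; y \<in> H\<rbrakk> \<Longrightarrow>
          d (inv g \<otimes> x \<otimes> g) (inv g \<otimes> y \<otimes> g) = d x y"
    and compact: "compactin mtopology H"
begin

abbreviation D :: "'a \<Rightarrow> 'a \<Rightarrow> real" where "D \<equiv> coset_metric G H d"

lemma one_H: "\<one> \<in> H"
  by (rule subgroup.one_closed[OF subgroup_axioms])

lemma coset_eq_iff:
  assumes "x \<in> carrier G" "y \<in> carrier G"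
  shows "H #> x = H #> y \<longleftrightarrow> inv x \<otimes> y \<in> H"
proof -
  have "H #> x = H #> y \<longleftrightarrow> y \<in> H #> x"
    using assms repr_independence repr_independenceD subgroup_axioms by metis
  also have "\<dots> \<longleftrightarrow> y \<otimes> inv x \<in> H"
    using rcos_module[OF is_group] assms by simp
  also have "\<dots> \<longleftrightarrow> inv x \<otimes> y \<in> H"
  proof
    assume "y \<otimes> inv x \<in> H"
    from inv_op_closed1[OF assms(1) this] show "inv x \<otimes> y \<in> H"
      using assms by (simp add: m_assoc)
  next
    assume "inv x \<otimes> y \<in> H"
    from inv_op_closed2[OF assms(1) this] show "y \<otimes> inv x \<in> H"
      using assms by (simp flip: m_assoc)
  qed
  finally show ?thesis .
qed

lemma D_eq:
  "\<lbrakk>x \<in> carrier G; y \<in> carrier G\<rbrakk> \<Longrightarrow> D x y = (if inv x \<otimes> y \<in> H then d \<one> (inv x \<otimes> y) else 1)"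
  by (simp add: coset_metric_def coset_eq_iff)

lemma D_near_iff:
  assumes "x \<in> carrier G" "y \<in> carrier G"
  shows "D x y \<le> 1 / 2 \<longleftrightarrow> H #> x = H #> y"
  using half_bounded[OF one_H] by (auto simp: D_eq coset_eq_iff assms)

lemma D_on_H:
  assumes "x \<in> H" "y \<in> H"
  shows "D x y = d x y"
proof -
  have "d (inv x \<otimes> x) (inv x \<otimes> y) = d x y"
    using assms by (intro left_invariant_on) auto
  then show ?thesis using assms by (simp add: D_eq)
qed

lemma D_commute: "D x y = D y x"
proof (cases "x \<in> carrier G \<and> y \<in> carrier G \<and> H #> x = H #> y")
  case True
  then have xy: "x \<in> carrier G" "y \<in> carrier G" and H: "inv x \<otimes> y \<in> H" "inv y \<otimes> x \<in> H"
    using True coset_eq_iff[of x y] coset_eq_iff[of y x] by auto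
  have "d (inv y \<otimes> x \<otimes> \<one>) (inv y \<otimes> x \<otimes> (inv x \<otimes> y)) = d \<one> (inv x \<otimes> y)"
    using H by (intro left_invariant_on) auto
  moreover have "inv y \<otimes> x \<otimes> (inv x \<otimes> y) = \<one>"
  proof -
    have "x \<otimes> (inv x \<otimes> y) = y" using xy by (simp flip: m_assoc)
    then show ?thesis using xy by (simp add: m_assoc)
  qed
  ultimately show ?thesis using xy H by (simp add: D_eq commute)
next
  case False
  then show ?thesis by (auto simp: coset_metric_def)
qed

lemma D_triangle:
  assumes "x \<in> carrier G" "y \<in> carrier G" "z \<in> carrier G"
  shows "D x z \<le> D x y + D y z"
proof (cases "inv x \<otimes> y \<in> H \<and> inv y \<otimes> z \<in> H")
  case True
  have xz: "inv x \<otimes> z = (inv x \<otimes> y) \<otimes> (inv y \<otimes> z)"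
  proof -
    have "y \<otimes> (inv y \<otimes> z) = z" using assms by (simp flip: m_assoc)
    then show ?thesis using assms by (simp add: m_assoc)
  qed
  have "d (inv x \<otimes> y \<otimes> \<one>) (inv x \<otimes> y \<otimes> (inv y \<otimes> z)) = d \<one> (inv y \<otimes> z)"
    using True by (intro left_invariant_on) auto
  then have "d (inv x \<otimes> y) (inv x \<otimes> z) = d \<one> (inv y \<otimes> z)"
    using assms xz by simp
  moreover have "inv x \<otimes> z \<in> H" using xz True by simp
  moreover have "d \<one> (inv x \<otimes> z) \<le> d \<one> (inv x \<otimes> y) + d (inv x \<otimes> y) (inv x \<otimes> z)"
    by (rule triangle) (use True \<open>inv x \<otimes> z \<in> H\<close> in auto)
  ultimately show ?thesis using True assms by (simp add: D_eq)
next
  case False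
  then have "D x y + D y z \<ge> 1"
    using assms by (auto simp: D_eq)
  moreover have "D x z \<le> 1"
    using half_bounded[OF one_H, of "inv x \<otimes> z"] assms by (auto simp: D_eq)
  ultimately show ?thesis by simp
qed

lemma D_left_invariant:
  assumes "g \<in> carrier G" "x \<in> carrier G" "y \<in> carrier G"
  shows "D (g \<otimes> x) (g \<otimes> y) = D x y"
proof -
  have "inv g \<otimes> (g \<otimes> y) = y"
    using assms by (simp flip: m_assoc)
  then have "inv (g \<otimes> x) \<otimes> (g \<otimes> y) = inv x \<otimes> y"
    using assms by (simp add: inv_mult_group m_assoc)
  then show ?thesis using assms by (simp add: D_eq)
qed

lemma D_right_invariant:
  assumes "g \<in> carrier G" "x \<in> carrier G" "y \<in> carrier G"
  shows "D (x \<otimes> g) (y \<otimes> g) = D x y"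
proof -
  have eq: "inv (x \<otimes> g) \<otimes> (y \<otimes> g) = inv g \<otimes> (inv x \<otimes> y) \<otimes> g"
    using assms by (simp add: inv_mult_group m_assoc)
  have iff: "inv g \<otimes> (inv x \<otimes> y) \<otimes> g \<in> H \<longleftrightarrow> inv x \<otimes> y \<in> H"
  proof
    assume "inv g \<otimes> (inv x \<otimes> y) \<otimes> g \<in> H"
    from inv_op_closed2[OF assms(1) this]
    have "g \<otimes> (inv g \<otimes> (inv x \<otimes> y) \<otimes> g) \<otimes> inv g \<in> H" .
    moreover have "g \<otimes> (inv g \<otimes> (inv x \<otimes> y) \<otimes> g) \<otimes> inv g = inv x \<otimes> y"
      using assms by (simp add: m_assoc) (simp flip: m_assoc)
    ultimately show "inv x \<otimes> y \<in> H" by simp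
  qed (rule inv_op_closed1[OF assms(1)])
  have "d \<one> (inv g \<otimes> (inv x \<otimes> y) \<otimes> g) = d \<one> (inv x \<otimes> y)" if "inv x \<otimes> y \<in> H"
    using conjugation_invariant[OF assms(1) one_H that] assms(1) by simp
  then show ?thesis using assms by (simp add: D_eq eq iff)
qed

lemma D_metric: "Metric_space (carrier G) D"
proof
  show "0 \<le> D x y" for x y by (simp add: coset_metric_def)
  show "D x y = D y x" for x y by (rule D_commute)
  show "D x y = 0 \<longleftrightarrow> x = y" if "x \<in> carrier G" "y \<in> carrier G" for x y
  proof -
    have "D x y = 0 \<longleftrightarrow> inv x \<otimes> y = \<one>"
      using that zero[OF one_H, of "inv x \<otimes> y"] by (auto simp: D_eq)
    also have "\<dots> \<longleftrightarrow> x = y"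
    proof
      assume "inv x \<otimes> y = \<one>"
      then have "x \<otimes> (inv x \<otimes> y) = x" using that by simp
      then show "x = y" using that by (simp flip: m_assoc)
    qed (use that in simp)
    finally show ?thesis .
  qed
qed (rule D_triangle)

lemma D_bounded: "bounded_metric_group G D"
proof -
  have "D x y \<le> 1" if "x \<in> carrier G" "y \<in> carrier G" for x y
    using half_bounded[OF one_H, of "inv x \<otimes> y"] that by (auto simp: D_eq)
  then show ?thesis
    using D_metric is_group by (simp add: bounded_metric_group_def bounded_metric_group_axioms_def)
qed

lemma compact_D: "compactin (Metric_space.mtopology (carrier G) D) H"
proof -
  interpret D: Metric_space "carrier G" D by (rule D_metric)
  interpret sub: Submetric "carrier G" D H
    by unfold_locales (rule subset)
  have "sub.sub.mball x r = mball x r" for x r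
    by (auto simp: D_on_H)
  then have "sub.sub.mtopology = mtopology"
    by (simp add: topology_eq sub.sub.openin_mtopology openin_mtopology)
  then have "subtopology D.mtopology H = mtopology"
    using sub.mtopology_submetric by simp
  then show ?thesis
    using compact by (metis compactin_subtopology order_refl)
qed

text \<open>The tail of a Cauchy sequence lies in one coset, and a translation moves this tail into \<open>H\<close>, where compactness
  applies.\<close>

lemma complete_D: "Metric_space.mcomplete (carrier G) D"
proof -
  interpret D: Metric_space "carrier G" D by (rule D_metric)
  show ?thesis
    unfolding D.mcomplete_def
  proof (intro allI impI)
    fix \<sigma> assume \<sigma>: "D.MCauchy \<sigma>"
    have range: "\<sigma> n \<in> carrier G" for n
      using \<sigma> unfolding D.MCauchy_def by auto
    obtain N where N: "\<And>n m. N \<le> n \<Longrightarrow> N \<le> m \<Longrightarrow> D (\<sigma> n) (\<sigma> m) < 1 / 2"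
      using \<sigma> unfolding D.MCauchy_def by (meson half_gt_zero zero_less_one)
    define a where "a = inv (\<sigma> N)"
    define \<tau> where "\<tau> n = a \<otimes> \<sigma> (N + n)" for n
    have a: "a \<in> carrier G" using range by (simp add: a_def)
    have \<tau>D: "D (\<tau> m) (\<tau> n) = D (\<sigma> (N + m)) (\<sigma> (N + n))" for m n
      using a range by (simp add: \<tau>_def D_left_invariant)
    have \<tau>H: "\<tau> n \<in> H" for n
      using N[of N "N + n"] D_near_iff[OF range range, of N "N + n"] coset_eq_iff[OF range range, of N "N + n"]
      by (simp add: \<tau>_def a_def)
    have "MCauchy \<tau>"
      unfolding MCauchy_def
    proof (intro conjI allI impI)
      show "range \<tau> \<subseteq> H" using \<tau>H by auto
      fix \<epsilon> :: real assume "\<epsilon> > 0"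
      then obtain K where "\<forall>n n'. K \<le> n \<longrightarrow> K \<le> n' \<longrightarrow> D (\<sigma> n) (\<sigma> n') < \<epsilon>"
        using \<sigma> unfolding D.MCauchy_def by blast
      then show "\<exists>K. \<forall>n n'. K \<le> n \<longrightarrow> K \<le> n' \<longrightarrow> d (\<tau> n) (\<tau> n') < \<epsilon>"
        using \<tau>D by (intro exI[of _ K]) (simp add: D_on_H[symmetric] \<tau>H)
    qed
    moreover have "mcomplete"
      using compact by (simp add: compact_space_imp_mcomplete compact_space_def)
    ultimately obtain y where y: "limitin mtopology \<tau> y sequentially"
      by (auto simp: mcomplete_def)
    then have yH: "y \<in> H" by (simp add: limit_metric_sequentially)
    have "limitin D.mtopology \<sigma> (inv a \<otimes> y) sequentially"
      unfolding D.limit_metric_sequentially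
    proof (intro conjI allI impI)
      show "inv a \<otimes> y \<in> carrier G" using a yH by simp
      fix \<epsilon> :: real assume "\<epsilon> > 0"
      then obtain K where K: "\<And>n. K \<le> n \<Longrightarrow> d (\<tau> n) y < \<epsilon>"
        using y unfolding limit_metric_sequentially by blast
      have "\<sigma> n \<in> carrier G \<and> D (\<sigma> n) (inv a \<otimes> y) < \<epsilon>" if "N + K \<le> n" for n
      proof -
        have n: "n = N + (n - N)" "K \<le> n - N" using that by auto
        have "D (\<sigma> n) (inv a \<otimes> y) = D (a \<otimes> \<sigma> n) (a \<otimes> (inv a \<otimes> y))"
          using D_left_invariant[OF a range[of n], of "inv a \<otimes> y"] a yH by simp
        also have "a \<otimes> (inv a \<otimes> y) = y" using a yH by (simp flip: m_assoc)
        also have "a \<otimes> \<sigma> n = \<tau> (n - N)" using n(1) by (simp add: \<tau>_def)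
        also have "D (\<tau> (n - N)) y = d (\<tau> (n - N)) y" by (rule D_on_H[OF \<tau>H yH])
        finally show ?thesis using K[OF n(2)] range by simp
      qed
      then show "\<exists>K. \<forall>n\<ge>K. \<sigma> n \<in> carrier G \<and> D (\<sigma> n) (inv a \<otimes> y) < \<epsilon>" by blast
    qed
    then show "\<exists>x. limitin D.mtopology \<sigma> x sequentially" by blast
  qed
qed

lemma D_inv: "\<lbrakk>x \<in> carrier G; y \<in> carrier G\<rbrakk> \<Longrightarrow> D (inv x) (inv y) = D x y"
  using bi_invariant_inv[of D x y] D_left_invariant D_right_invariant D_commute by metis

lemma metric_group_structure_D: "metric_group_structure G D"
proof -
  have "uniformly_continuous_operations G D"
    unfolding uniformly_continuous_operations_def
    by (intro exI[of _ "\<lambda>\<epsilon>. \<epsilon>"]) (simp add: D_inv D_left_invariant D_right_invariant)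
  then show ?thesis
    using D_bounded complete_D D_left_invariant is_group D_metric
    by (simp add: metric_group_structure_def bounded_metric_group_def bounded_metric_group_axioms_def)
qed

text \<open>The subgroup \<open>H\<close> is the closed ball of radius \<open>1/2\<close> about the neutral element, so an isometry preserves
  it; this is why the oligomorphic group of the hypothesis and the group inducing the structure on
  \<open>G/H\<close> coincide.\<close>

lemma automorphisms_eq: "automorphisms_preserving G H d = isometric_automorphisms G D"
proof -
  have iff: "(\<alpha> ` H = H \<and> (\<forall>x\<in>H. \<forall>y\<in>H. d (\<alpha> x) (\<alpha> y) = d x y)) \<longleftrightarrow>
      (\<forall>x\<in>carrier G. \<forall>y\<in>carrier G. D (\<alpha> x) (\<alpha> y) = D x y)" if \<alpha>: "\<alpha> \<in> auto G" for \<alpha>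
  proof -
    have hom: "\<alpha> \<in> hom G G" and bij: "bij_betw \<alpha> (carrier G) (carrier G)"
      using \<alpha> by (auto simp: auto_def Bij_def)
    interpret \<alpha>: group_hom G G \<alpha>
      by unfold_locales (rule hom)
    have inj: "inj_on \<alpha> (carrier G)" using bij by (simp add: bij_betw_def)
    show ?thesis
    proof
      assume L: "\<alpha> ` H = H \<and> (\<forall>x\<in>H. \<forall>y\<in>H. d (\<alpha> x) (\<alpha> y) = d x y)"
      have H_iff: "\<alpha> z \<in> H \<longleftrightarrow> z \<in> H" if "z \<in> carrier G" for z
        using L inj that subset inj_on_image_mem_iff[OF inj that subset] by simp
      show "\<forall>x\<in>carrier G. \<forall>y\<in>carrier G. D (\<alpha> x) (\<alpha> y) = D x y"
      proof (intro ballI)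
        fix x y assume xy: "x \<in> carrier G" "y \<in> carrier G"
        have eq: "inv (\<alpha> x) \<otimes> \<alpha> y = \<alpha> (inv x \<otimes> y)" using xy by simp
        have "d \<one> (\<alpha> (inv x \<otimes> y)) = d \<one> (inv x \<otimes> y)" if "inv x \<otimes> y \<in> H"
        proof -
          have "d (\<alpha> \<one>) (\<alpha> (inv x \<otimes> y)) = d \<one> (inv x \<otimes> y)"
            by (rule bspec[OF bspec[OF conjunct2[OF L] one_H] that])
          then show ?thesis by simp
        qed
        then show "D (\<alpha> x) (\<alpha> y) = D x y"
          using xy H_iff[of "inv x \<otimes> y"] by (simp add: D_eq eq del: \<alpha>.hom_mult)
      qed
    next
      assume R: "\<forall>x\<in>carrier G. \<forall>y\<in>carrier G. D (\<alpha> x) (\<alpha> y) = D x y"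
      have H_near: "z \<in> H \<longleftrightarrow> D \<one> z \<le> 1 / 2" if "z \<in> carrier G" for z
        using that D_near_iff[of \<one> z] coset_eq_iff[of \<one> z] by simp
      have H_iff: "\<alpha> z \<in> H \<longleftrightarrow> z \<in> H" if "z \<in> carrier G" for z
        using H_near[of z] H_near[of "\<alpha> z"] R[rule_format, of \<one> z] that by simp
      have "\<alpha> ` H = H"
      proof (intro equalityI subsetI)
        fix z assume z: "z \<in> H"
        then have "z \<in> \<alpha> ` carrier G" using bij subset by (auto simp: bij_betw_def)
        then obtain x where "x \<in> carrier G" "z = \<alpha> x" by blast
        moreover from this have "x \<in> H" using H_iff[of x] z by simp
        ultimately show "z \<in> \<alpha> ` H" by simp
      next
        fix z assume "z \<in> \<alpha> ` H"
        then obtain x where "x \<in> H" "z = \<alpha> x" by blast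
        then show "z \<in> H" using H_iff[of x] subsetD[OF subset] by simp
      qed
      moreover have "d (\<alpha> x) (\<alpha> y) = d x y" if xy: "x \<in> H" "y \<in> H" for x y
      proof -
        have G: "x \<in> carrier G" "y \<in> carrier G" using xy subsetD[OF subset] by auto
        then have "\<alpha> x \<in> H" "\<alpha> y \<in> H" using xy H_iff by auto
        then show ?thesis
          using R[rule_format, OF G] D_on_H[OF xy] D_on_H[of "\<alpha> x" "\<alpha> y"] by simp
      qed
      ultimately show "\<alpha> ` H = H \<and> (\<forall>x\<in>H. \<forall>y\<in>H. d (\<alpha> x) (\<alpha> y) = d x y)" by blast
    qed
  qed
  show ?thesis
    unfolding automorphisms_preserving_def isometric_automorphisms_def
    by (rule arg_cong[where f = "\<lambda>A. AutoGroup G\<lparr>carrier := A\<rparr>"])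
       (rule Collect_cong, rule conj_cong[OF refl], rule iff)
qed

lemma coset_metric_groupI:
  assumes "oligomorphic (automorphisms_preserving G H d) (carrier (G Mod H)) (`)"
    and "countable (carrier (G Mod H))"
  shows "coset_metric_group G D H"
  using assms D_left_invariant D_right_invariant D_near_iff compact_D normal_axioms D_bounded
  by (simp add: coset_metric_group_def coset_metric_group_axioms_def automorphisms_eq)

end

section \<open>Cardinalities\<close>

lemma countable_open_cosets:
  assumes top: "topological_group G X" and sep: "separable_space X"
    and sub: "subgroup H G" and "open": "openin X H"
  shows "countable (carrier (G Mod H))"
proof -
  interpret group G using top by (simp add: topological_group_def)
  have X: "topspace X = carrier G" using top by (simp add: topological_group_def)
  obtain S where S: "countable S" "S \<subseteq> topspace X" "X closure_of S = topspace X"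
    using sep by (auto simp: separable_space_def)
  have "H #>\<^bsub>G\<^esub> x \<in> (\<lambda>s. H #>\<^bsub>G\<^esub> s) ` S" if x: "x \<in> carrier G" for x
  proof -
    have "continuous_map X (prod_topology X X) (\<lambda>y. (y, inv\<^bsub>G\<^esub> x))"
      using x X by (simp add: continuous_map_pairedI)
    then have "continuous_map X X ((\<lambda>(x, y). x \<otimes>\<^bsub>G\<^esub> y) \<circ> (\<lambda>y. (y, inv\<^bsub>G\<^esub> x)))"
      using top by (intro continuous_map_compose) (auto simp: topological_group_def)
    then have "continuous_map X X (\<lambda>y. y \<otimes>\<^bsub>G\<^esub> inv\<^bsub>G\<^esub> x)" by (simp add: comp_def)
    from openin_continuous_map_preimage[OF this "open"]
    have "openin X {y \<in> carrier G. y \<otimes>\<^bsub>G\<^esub> inv\<^bsub>G\<^esub> x \<in> H}" by (simp add: X)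
    moreover have "x \<in> {y \<in> carrier G. y \<otimes>\<^bsub>G\<^esub> inv\<^bsub>G\<^esub> x \<in> H}"
      using x subgroup.one_closed[OF sub] by simp
    ultimately have "S \<inter> {y \<in> carrier G. y \<otimes>\<^bsub>G\<^esub> inv\<^bsub>G\<^esub> x \<in> H} \<noteq> {}"
      using S(3) unfolding dense_intersects_open by blast
    then obtain s where s: "s \<in> S" "s \<in> carrier G" "s \<otimes>\<^bsub>G\<^esub> inv\<^bsub>G\<^esub> x \<in> H" by blast
    then have "s \<in> H #>\<^bsub>G\<^esub> x"
      using subgroup.rcos_module[OF sub is_group x s(2)] by simp
    then show ?thesis using repr_independence[OF _ x sub] s(1) by blast
  qed
  then have "carrier (G Mod H) \<subseteq> (\<lambda>s. H #>\<^bsub>G\<^esub> s) ` S"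
    by (auto simp: FactGroup_def RCOSETS_def)
  then show ?thesis
    by (rule countable_subset) (rule countable_image[OF S(1)])
qed

text \<open>A point is determined by the balls of rational radius about points of a countable dense set that contain
  it.\<close>

lemma (in Metric_space) separable_embeds_in_real:
  assumes "separable_space mtopology"
  shows "\<exists>f :: 'a \<Rightarrow> real. inj_on f M"
proof -
  obtain S where S: "countable S" "S \<subseteq> M" "mtopology closure_of S = M"
    using assms by (auto simp: separable_space_def)
  define c where "c x = {(s, q :: rat). s \<in> S \<and> d x s < of_rat q}" for x
  have "inj_on c M"
  proof (rule inj_onI, rule ccontr)
    fix x y assume xy: "x \<in> M" "y \<in> M" "c x = c y" "x \<noteq> y"
    have pos: "d x y / 2 > 0" using xy by simp
    have "x \<in> mtopology closure_of S" using S(3) xy(1) by simp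
    then have "\<forall>r>0. \<exists>s\<in>S. s \<in> mball x r" by (simp add: metric_closure_of)
    from this[rule_format, OF pos] obtain s where s: "s \<in> S" "d x s < d x y / 2"
      unfolding in_mball by blast
    obtain q where q: "d x s < of_rat q" "of_rat q < d x y / 2"
      using of_rat_dense[OF s(2)] by blast
    have "(s, q) \<in> c x" using s(1) q(1) by (simp add: c_def)
    then have "(s, q) \<in> c y" using xy(3) by simp
    then have "d y s < of_rat q" by (simp add: c_def)
    moreover have "d x y \<le> d x s + d y s"
      using triangle'[of x s y] xy s(1) S(2) by blast
    ultimately show False using s(2) q(2) by linarith
  qed
  moreover have "countable (S \<times> (UNIV :: rat set))" using S(1) by simp
  then have "inj_on (to_nat_on (S \<times> (UNIV :: rat set))) (S \<times> UNIV)" by (rule inj_on_to_nat_on)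
  then have "inj_on (image (to_nat_on (S \<times> (UNIV :: rat set)))) (c ` M)"
    by (intro inj_on_image) (rule inj_on_subset, auto simp: c_def)
  moreover obtain h :: "nat set \<Rightarrow> real" where "inj h"
    using nat_sets_eqpoll_reals by (auto simp: eqpoll_def bij_betw_def)
  ultimately have "inj_on (h \<circ> (image (to_nat_on (S \<times> (UNIV :: rat set))) \<circ> c)) M"
    by (intro comp_inj_on) (auto intro: inj_on_subset)
  then show ?thesis by blast
qed

section \<open>Slow order and stability of the quotient\<close>

theorem theorem15:
  fixes G :: "('a, 'm) monoid_scheme" (structure)
    and X :: "'a topology"
    and H :: "'a set"
    and d :: "'a \<Rightarrow> 'a \<Rightarrow> real"
  assumes large_universe: "\<exists>f :: real \<Rightarrow> 'u. inj f"
    and top_group: "topological_group G X"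
    and separable: "separable_space X"
    and locally_compact: "locally_compact_space X"
    and presentable: "separably_categorically_presentable G X"
    and normal: "H \<lhd> G"
    and compact: "compactin X H"
    and clopen: "openin X H" "closedin X H"
    and metric: "Metric_space H d"
    and metric_topology: "Metric_space.mtopology H d = subtopology X H"
    and bi_invariant: "\<And>h x y. \<lbrakk>h \<in> H; x \<in> H; y \<in> H\<rbrakk> \<Longrightarrow>
          d (h \<otimes> x) (h \<otimes> y) = d x y \<and> d (x \<otimes> h) (y \<otimes> h) = d x y"
    and diameter: "if H = {\<one>} then \<forall>x\<in>H. \<forall>y\<in>H. d x y = 0
          else (SUP (x, y)\<in>H \<times> H. d x y) = 1/2"
    and conjugacy_invariant: "\<And>g x y. \<lbrakk>g \<in> carrier G; x \<in> H; y \<in> H\<rbrakk> \<Longrightarrow>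
          d (inv g \<otimes> x \<otimes> g) (inv g \<otimes> y \<otimes> g) = d x y"
    and oligomorphic: "oligomorphic (automorphisms_preserving G H d) (carrier (G Mod H)) (`)"
  shows "\<not> has_slow_order_property TYPE('u) (1/2) G (coset_metric G H d) \<longleftrightarrow>
         induced_structure_stable TYPE('u)
           (isometric_automorphisms G (coset_metric G H d)) (carrier (G Mod H)) (`)"
proof -
  interpret H: Metric_space H d by (fact metric)
  have compact_H: "compactin H.mtopology H"
    unfolding metric_topology using compact by (simp add: compactin_subtopology)
  have half: "d x y \<le> 1 / 2" if xy: "x \<in> H" "y \<in> H" for x y
  proof (cases "H = {\<one>}")
    case True
    then show ?thesis using diameter xy by simp
  next
    case False
    obtain B where "\<forall>x\<in>H. \<forall>y\<in>H. d x y \<le> B"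
      using H.compactin_imp_mbounded[OF compact_H] unfolding H.mbounded_alt by blast
    then have "bdd_above ((\<lambda>(x, y). d x y) ` (H \<times> H))" by (intro bdd_aboveI[of _ B]) auto
    then have "(\<lambda>(x, y). d x y) (x, y) \<le> (SUP (x, y)\<in>H \<times> H. d x y)"
      by (rule cSUP_upper[rotated]) (use xy in simp)
    then show ?thesis using diameter False by simp
  qed
  interpret metrised_normal_subgroup H G d
    by (intro metrised_normal_subgroup.intro metrised_normal_subgroup_axioms.intro normal metric)
       (use half bi_invariant conjugacy_invariant compact_H in auto)
  have countable: "countable (carrier (G Mod H))"
    by (rule countable_open_cosets[OF top_group separable subgroup_axioms clopen(1)])
  interpret cosets: coset_metric_group G "coset_metric G H d" H
    by (rule coset_metric_groupI[OF oligomorphic countable])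
  obtain h :: "real \<Rightarrow> 'u" where h: "inj h" using large_universe by blast
  \<comment> \<open>The topology is separable and metrisable, so \<open>G\<close> embeds into the reals and hence into the given type.\<close>
  obtain d' where d': "metric_group_structure G d'" "Metric_space.mtopology (carrier G) d' = X"
    using presentable unfolding separably_categorically_presentable_def by blast
  have "Metric_space (carrier G) d'" using d'(1) by (simp add: metric_group_structure_def)
  from Metric_space.separable_embeds_in_real[OF this] obtain f :: "'a \<Rightarrow> real" where f: "inj_on f (carrier G)"
    using separable d'(2) by blast
  have hf: "inj_on (h \<circ> f) (carrier G)"
    using f h by (meson comp_inj_on inj_on_subset subset_UNIV)
  have "inj_on (h \<circ> (real \<circ> to_nat_on (carrier (G Mod H)))) (carrier (G Mod H))"
    using countable h by (intro comp_inj_on inj_on_to_nat_on) (auto intro: inj_on_subset simp: inj_on_def)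
  from cosets.slow_order_property_iff_unstable[OF metric_group_structure_D hf this]
  show ?thesis by blast
qed

end
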